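(* Let $d\ge1$ be fixed (not changing with $n$). For each $n$ let $\mathbf{X}_0=[\mathbf{x}_{01},\ldots,\mathbf{x}_{0n}]^{\mathrm T}\in\mathbb{R}^{n\times d}$ have rows in $\mathcal{X}$, and let $\mathbf{Y}\sim\mathrm{RDPG}(\mathbf{X}_0)$. Let the prior $\Pi$ on $\mathbf{X}=[\mathbf{x}_1,\ldots,\mathbf{x}_n]^{\mathrm T}\in\mathcal{X}^n$ make $\mathbf{x}_1,\ldots,\mathbf{x}_n$ independent, each with density $\pi_{\mathbf{x}}$ supported on $\mathcal{X}$ and bounded away from $0$ and $\infty$ over $\mathcal{X}$. Assume $\frac1n\mathbf{X}_0^{\mathrm T}\mathbf{X}_0\to\mathbf{\Delta}$ as $n\to\infty$ for some positive definite $\mathbf{\Delta}\in\mathbb{R}^{d\times d}$, and $\delta\le\min_{i,j}\mathbf{x}_{0i}^{\mathrm T}\mathbf{x}_{0j}\le\max_{i,j}\mathbf{x}_{0i}^{\mathrm T}\mathbf{x}_{0j}\le 1-\delta$ for some constant $\delta\in(0,1/2)$ independent of $n$. Further assume that $\mathbf{X}_0$ has $K$ distinct rows $\mathbf{x}_{01}^*,\ldots,\mathbf{x}_{0K}^*$ for some $K\in[n]$, that $\min_{k\ne k'}\|\mathbf{x}_{0k}^*-\mathbf{x}_{0k'}^*\|_2>\xi$ for some constant $\xi>0$, and that $n_k:=\sum_{i=1}^n\mathbf{1}\{\mathbf{x}_{0i}=\mathbf{x}_{0k}^*\}\to\infty$ as $n\to\infty$ for all $k\in[K]$ (i.e. $\min_{k\in[K]}n_k\to\infty$).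 Then there exist (large) constants $M_1,M_2>0$, depending on $\mathbf{\Delta}$ and $\pi_{\mathbf{x}}$, such that for all sufficiently large $n$ $$\mathbb{E}_0\left\{\Pi\left(\tfrac1n\|\mathbf{X}\mathbf{X}^{\mathrm T}-\mathbf{X}_0\mathbf{X}_0^{\mathrm T}\|_{\mathrm F}>\tfrac{M_1}{\sqrt n}\,\Big|\,\mathbf{Y}\right)\right\}\le 8e^{-nd/2},\qquad \mathbb{E}_0\left\{\Pi\left(\tfrac1n\inf_{\mathbf{W}\in\mathbb{O}(d)}\|\mathbf{X}-\mathbf{X}_0\mathbf{W}\|_{\mathrm F}^2>\tfrac{M_2}{n}\,\Big|\,\mathbf{Y}\right)\right\}\le 8e^{-nd/2},$$ and with these constants the following hold. (1) For all sufficiently large $n$, $$\mathbb{E}_0\left\{\Pi\left(\inf_{\sigma\in\mathcal{S}_K}d_H(\sigma\circ\tau(\cdot;\mathbf{X}_0),\tau(\cdot;\mathbf{X}))\ge\frac{16M_2^2}{\xi^2}\ \Big|\ \mathbf{Y}\right)\right\}\le 8\exp\left(-\tfrac12nd\right).$$ (2) Let $\widehat{\mathbf{U}}\in\mathbb{R}^{n\times d}$ be the matrix whose columns are orthonormal eigenvectors associated with the $d$ largest eigenvalues of $\widetilde{\mathbf{P}}=\int_{\mathcal{X}^n}\mathbf{X}\mathbf{X}^{\mathrm T}\,\Pi(\mathrm{d}\mathbf{X}\mid\mathbf{Y})$, and let $\mathbf{U}_0$ be the left-singular vector matrix of $\mathbf{X}_0$. Then it almost always holds that $$\inf_{\sig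ma\in\mathcal{S}_K}d_H(\sigma\circ\tau(\cdot;\widehat{\mathbf{U}}),\tau(\cdot;\mathbf{U}_0))\le\frac{16}{\xi^2}\left\{\frac{8M_1\sqrt{2d}}{\lambda_d(\mathbf{\Delta})}\right\}^2.$$
   Context: $\mathcal{X}=\{\mathbf{x}\in\mathbb{R}^d:\|\mathbf{x}\|_2\le 1,\ \mathbf{x}\ge 0\}$ (entrywise), $\mathcal{X}^n$ is the set of $n\times d$ matrices with all rows in $\mathcal{X}$, and $[n]=\{1,\ldots,n\}$. A symmetric random matrix $\mathbf{Y}=[y_{ij}]\in\{0,1\}^{n\times n}$ satisfies $\mathbf{Y}\sim\mathrm{RDPG}(\mathbf{X})$ if $y_{ij}\sim\mathrm{Bernoulli}(\mathbf{x}_i^{\mathrm T}\mathbf{x}_j)$ independently for $1\le i\le j\le n$. The posterior distribution is, for measurable $\mathcal{A}\subset\mathcal{X}^n$, $$\Pi(\mathbf{X}\in\mathcal{A}\mid\mathbf{Y})=\frac{N_n(\mathcal{A})}{D_n},\quad N_n(\mathcal{A})=\int_{\mathcal{A}}\prod_{i\le j}\frac{p(y_{ij}\mid\mathbf{X})}{p(y_{ij}\mid\mathbf{X}_0)}\,\Pi(\mathrm{d}\mathbf{X}),\quad D_n=N_n(\mathcal{X}^n),$$ where $p(y_{ij}\mid\mathbf{X})=(\mathbf{x}_i^{\mathrm T}\mathbf{x}_j)^{y_{ij}}(1-\mathbf{x}_i^{\mathrm T}\mathbf{x}_j)^{1-y_{ij}}$. $\mathbb{P}_0,\mathbb{E}_0$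 are probability and expectation with respect to $\mathbf{Y}\sim\mathrm{RDPG}(\mathbf{X}_0)$. $\mathbb{O}(d)$ is the set of $d\times d$ orthogonal matrices; $\lambda_d(\mathbf{\Delta})$ is the smallest eigenvalue of $\mathbf{\Delta}$. $K$-means: for $\mathbf{Z}\in\mathbb{R}^{n\times d}$, the matrix of $K$-means centroids is $\mathbf{C}(\mathbf{Z})=\arg\min_{\mathbf{C}\in\mathcal{C}_K}\|\mathbf{C}-\mathbf{Z}\|_{\mathrm F}$, where $\mathcal{C}_K=\{\mathbf{C}\in\mathbb{R}^{n\times d}:\mathbf{C}\text{ has }K\text{ distinct rows}\}$. The cluster assignment function $\tau(\cdot;\mathbf{Z}):[n]\to[K]$ is any function such that $\tau(i;\mathbf{Z})=\tau(j;\mathbf{Z})$ if and only if the $i$th and $j$th rows of $\mathbf{C}(\mathbf{Z})$ coincide. The Hamming distance is $d_H(\tau_1,\tau_2)=\sum_{i=1}^n\mathbf{1}\{\tau_1(i)\ne\tau_2(i)\}$, and $\mathcal{S}_K$ is the set of permutations of $[K]$. The left-singular vector matrix of $\mathbf{X}_0$ is the $n\times d$ matrix $\mathbf{U}_0$ with orthonormal columns in the singular value decomposition $\mathbf{X}_0=\mathbf{U}_0\mathbf{S}_0^{1/2}\mathbf{V}_0^{\mathrm T}$. A sequence of events $(E_n)_{n\ge1}$ occurs "almost always" if $\mathbb{P}(\bigcup_{n=1}^\infty\bigcap_{k=n}^\infty E_k)=1$. *)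

theory Defs
  imports "HOL-Probability.Probability"
begin

text \<open>
  Indices run over \<open>{..<n}\<close> and \<open>{..<K}\<close> instead of \<open>{1..n}\<close> and \<open>{1..K}\<close>. An \<open>n \<times> d\<close> matrix is
  represented by its rows, a function \<open>nat \<Rightarrow> real ^ 'd\<close> of which only the values on \<open>{..<n}\<close>
  matter; an \<open>n \<times> n\<close> matrix is a function \<open>nat \<Rightarrow> nat \<Rightarrow> real\<close>, read on \<open>{..<n}\<close> in both arguments.
\<close>

section \<open>Matrices\<close>

text \<open>\<open>frob_rows\<close> is the Frobenius norm, as the norm of a row is the Euclidean one.\<close>

definition frob_rows :: "nat \<Rightarrow> (nat \<Rightarrow> real ^ 'd) \<Rightarrow> real" where
  "frob_rows n Z = L2_set (\<lambda>i. norm (Z i)) {..<n}"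

definition frob_sq :: "nat \<Rightarrow> (nat \<Rightarrow> nat \<Rightarrow> real) \<Rightarrow> real" where
  "frob_sq n A = L2_set (\<lambda>(i, j). A i j) ({..<n} \<times> {..<n})"

text \<open>The matrix \<open>X X\<^sup>T\<close>:\<close>

definition gram :: "(nat \<Rightarrow> real ^ 'd) \<Rightarrow> nat \<Rightarrow> nat \<Rightarrow> real" where
  "gram X i j = X i \<bullet> X j"

text \<open>The matrix \<open>X\<^sup>T X\<close>:\<close>

definition second_moment :: "nat \<Rightarrow> (nat \<Rightarrow> real ^ 'd) \<Rightarrow> real ^ 'd ^ 'd" where
  "second_moment n X = (\<chi> a b. \<Sum>i<n. X i $ a * X i $ b)"

definition positive_definite :: "real ^ 'd ^ 'd \<Rightarrow> bool" where
  "positive_definite A \<longleftrightarrow> transpose A = A \<and> (\<forall>v. v \<noteq> 0 \<longrightarrow> v \<bullet> (A *v v) > 0)"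

definition smallest_eigenvalue :: "real ^ 'd ^ 'd \<Rightarrow> real" where
  "smallest_eigenvalue A = (LEAST l. \<exists>v. v \<noteq> 0 \<and> A *v v = l *\<^sub>R v)"

definition orthonormal_columns :: "nat \<Rightarrow> (nat \<Rightarrow> real ^ 'd) \<Rightarrow> bool" where
  "orthonormal_columns n U \<longleftrightarrow>
     (\<forall>a b. (\<Sum>i<n. U i $ a * U i $ b) = (if a = b then 1 else 0))"

text \<open>\<open>X = U S\<^sup>1\<^sup>/\<^sup>2 V\<^sup>T\<close> with \<open>S = diag s\<close>, written row by row:\<close>

definition left_singular_matrix ::
    "nat \<Rightarrow> (nat \<Rightarrow> real ^ 'd) \<Rightarrow> (nat \<Rightarrow> real ^ 'd) \<Rightarrow> bool" where
  "left_singular_matrix n X U \<longleftrightarrow> orthonormal_columns n U \<and>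
     (\<exists>(s :: 'd \<Rightarrow> real) V. (\<forall>a. s a \<ge> 0) \<and> orthogonal_matrix V \<and>
        (\<forall>i<n. X i = (\<chi> a. U i $ a * sqrt (s a)) v* transpose V))"

text \<open>
  The columns of \<open>U\<close> are, in some order \<open>e\<close>, the first \<open>d\<close> members of an orthonormal eigenbasis
  \<open>u 0, \<dots>, u (n - 1)\<close> of \<open>P\<close> sorted by decreasing eigenvalue (with multiplicity).
\<close>

definition top_eigenvectors ::
    "nat \<Rightarrow> (nat \<Rightarrow> nat \<Rightarrow> real) \<Rightarrow> (nat \<Rightarrow> real ^ 'd) \<Rightarrow> bool" where
  "top_eigenvectors n P U \<longleftrightarrow> CARD('d) \<le> n \<and>
     (\<exists>(u :: nat \<Rightarrow> nat \<Rightarrow> real) (l :: nat \<Rightarrow> real).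
        (\<forall>k<n. \<forall>i<n. (\<Sum>j<n. P i j * u k j) = l k * u k i) \<and>
        (\<forall>k<n. \<forall>m<n. (\<Sum>i<n. u k i * u m i) = (if k = m then 1 else 0)) \<and>
        (\<forall>k m. k \<le> m \<and> m < n \<longrightarrow> l m \<le> l k) \<and>
        (\<exists>e :: 'd \<Rightarrow> nat. bij_betw e UNIV {..<CARD('d)} \<and>
           (\<forall>i<n. \<forall>a. U i $ a = u (e a) i)))"

section \<open>Random dot product graphs and the posterior\<close>

definition latent_space :: "(real ^ 'd) set" where
  "latent_space = {x. norm x \<le> 1 \<and> (\<forall>a. 0 \<le> x $ a)}"

definition latent_matrices :: "nat \<Rightarrow> (nat \<Rightarrow> real ^ 'd) set" where
  "latent_matrices n = (\<Pi>\<^sub>E i\<in>{..<n}. latent_space)"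

definition upper_pairs :: "nat \<Rightarrow> (nat \<times> nat) set" where
  "upper_pairs n = {(i, j). i \<le> j \<and> j < n}"

definition rdpg ::
    "'w measure \<Rightarrow> nat \<Rightarrow> (nat \<Rightarrow> real ^ 'd) \<Rightarrow> ('w \<Rightarrow> nat \<Rightarrow> nat \<Rightarrow> nat) \<Rightarrow> bool" where
  "rdpg M n X Y \<longleftrightarrow>
     (\<forall>\<omega>\<in>space M. \<forall>i<n. \<forall>j<n. Y \<omega> i j \<in> {0, 1} \<and> Y \<omega> i j = Y \<omega> j i) \<and>
     prob_space.indep_vars M (\<lambda>_. count_space UNIV) (\<lambda>(i, j) \<omega>. Y \<omega> i j) (upper_pairs n) \<and>
     (\<forall>(i, j)\<in>upper_pairs n. distr M (count_space UNIV) (\<lambda>\<omega>. Y \<omega> i j) =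
        measure_pmf (map_pmf of_bool (bernoulli_pmf (X i \<bullet> X j))))"

definition prior_density :: "(real ^ 'd \<Rightarrow> real) \<Rightarrow> bool" where
  "prior_density \<pi> \<longleftrightarrow> \<pi> \<in> borel_measurable borel \<and>
     prob_space (density lborel (\<lambda>x. ennreal (\<pi> x))) \<and>
     (\<forall>x. x \<notin> latent_space \<longrightarrow> \<pi> x = 0) \<and>
     (\<exists>c C. 0 < c \<and> (\<forall>x\<in>latent_space. c \<le> \<pi> x \<and> \<pi> x \<le> C))"

definition prior :: "nat \<Rightarrow> (real ^ 'd \<Rightarrow> real) \<Rightarrow> (nat \<Rightarrow> real ^ 'd) measure" where
  "prior n \<pi> = PiM {..<n} (\<lambda>_. density lborel (\<lambda>x. ennreal (\<pi> x)))"

definition bernoulli_lik :: "real \<Rightarrow> nat \<Rightarrow> real" where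
  "bernoulli_lik p y = p ^ y * (1 - p) ^ (1 - y)"

definition lik_ratio ::
    "nat \<Rightarrow> (nat \<Rightarrow> real ^ 'd) \<Rightarrow> (nat \<Rightarrow> nat \<Rightarrow> nat) \<Rightarrow> (nat \<Rightarrow> real ^ 'd) \<Rightarrow> real" where
  "lik_ratio n X0 Y X = (\<Prod>(i, j)\<in>upper_pairs n.
     bernoulli_lik (X i \<bullet> X j) (Y i j) / bernoulli_lik (X0 i \<bullet> X0 j) (Y i j))"

definition posterior_weight ::
    "nat \<Rightarrow> (real ^ 'd \<Rightarrow> real) \<Rightarrow> (nat \<Rightarrow> real ^ 'd) \<Rightarrow> (nat \<Rightarrow> nat \<Rightarrow> nat) \<Rightarrow>
       (nat \<Rightarrow> real ^ 'd) set \<Rightarrow> ennreal" where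
  "posterior_weight n \<pi> X0 Y A = (\<integral>\<^sup>+X\<in>A. ennreal (lik_ratio n X0 Y X) \<partial>prior n \<pi>)"

text \<open>
  The prior is concentrated on \<open>latent_matrices n\<close>, where \<open>lik_ratio\<close> is nonnegative. The lemma
  below is the defining quotient of the posterior.
\<close>

definition posterior ::
    "nat \<Rightarrow> (real ^ 'd \<Rightarrow> real) \<Rightarrow> (nat \<Rightarrow> real ^ 'd) \<Rightarrow> (nat \<Rightarrow> nat \<Rightarrow> nat) \<Rightarrow>
       (nat \<Rightarrow> real ^ 'd) measure" where
  "posterior n \<pi> X0 Y = density (prior n \<pi>)
     (\<lambda>X. ennreal (lik_ratio n X0 Y X) / posterior_weight n \<pi> X0 Y (latent_matrices n))"

lemma lik_ratio_measurable [measurable]: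
  "lik_ratio n X0 Y \<in> borel_measurable (prior n \<pi>)"
proof -
  have [measurable]: "(\<lambda>X. X i \<bullet> X j) \<in> borel_measurable (prior n \<pi>)" if "i < n" "j < n" for i j
  proof -
    have "(\<lambda>X. X k) \<in> borel_measurable (prior n \<pi>)" if "k < n" for k
    proof -
      have "(\<lambda>X. X k) \<in> measurable (prior n \<pi>) (density lborel (\<lambda>x. ennreal (\<pi> x)))"
        unfolding prior_def using that by (intro measurable_component_singleton) auto
      then show ?thesis by (simp cong: measurable_cong_sets)
    qed
    with that show ?thesis by (intro borel_measurable_inner) auto
  qed
  show ?thesis
    unfolding lik_ratio_def bernoulli_lik_def
    by (intro borel_measurable_prod) (auto simp: upper_pairs_def split_beta)
qed

lemma emeasure_posterior:
  assumes "A \<in> sets (prior n \<pi>)"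
  shows "emeasure (posterior n \<pi> X0 Y) A =
    posterior_weight n \<pi> X0 Y A / posterior_weight n \<pi> X0 Y (latent_matrices n)"
proof -
  let ?D = "posterior_weight n \<pi> X0 Y (latent_matrices n)"
  have "emeasure (posterior n \<pi> X0 Y) A =
      (\<integral>\<^sup>+X. (ennreal (lik_ratio n X0 Y X) * indicator A X) / ?D \<partial>prior n \<pi>)"
    unfolding posterior_def using assms
    by (subst emeasure_density) (auto simp: divide_ennreal_def mult_ac)
  also have "\<dots> = posterior_weight n \<pi> X0 Y A / ?D"
    unfolding posterior_weight_def using assms by (subst nn_integral_divide) auto
  finally show ?thesis .
qed

definition posterior_mean_gram ::
    "nat \<Rightarrow> (real ^ 'd \<Rightarrow> real) \<Rightarrow> (nat \<Rightarrow> real ^ 'd) \<Rightarrow> (nat \<Rightarrow> nat \<Rightarrow> nat) \<Rightarrow>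
       nat \<Rightarrow> nat \<Rightarrow> real" where
  "posterior_mean_gram n \<pi> X0 Y i j = (\<integral>X. gram X i j \<partial>posterior n \<pi> X0 Y)"

definition almost_always :: "'w measure \<Rightarrow> (nat \<Rightarrow> 'w set) \<Rightarrow> bool" where
  "almost_always M E \<longleftrightarrow> measure M (\<Union>n\<in>{1..}. \<Inter>k\<in>{n..}. E k) = 1"

section \<open>K-means clustering\<close>

definition kmeans_centroids ::
    "nat \<Rightarrow> nat \<Rightarrow> (nat \<Rightarrow> real ^ 'd) \<Rightarrow> (nat \<Rightarrow> real ^ 'd) \<Rightarrow> bool" where
  "kmeans_centroids n K Z C \<longleftrightarrow>
     is_arg_min (\<lambda>C. frob_rows n (\<lambda>i. C i - Z i)) (\<lambda>C. card (C ` {..<n}) = K) C"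

text \<open>
  A minimiser need not be unique, and does not exist when \<open>Z\<close> has fewer than \<open>K\<close> distinct rows.
  An assignment may come from any minimiser; without a minimiser every map into \<open>{..<K}\<close> counts
  as an assignment, so that a bound for all assignments is never vacuous.
\<close>

definition cluster_assignment ::
    "nat \<Rightarrow> nat \<Rightarrow> (nat \<Rightarrow> real ^ 'd) \<Rightarrow> (nat \<Rightarrow> nat) \<Rightarrow> bool" where
  "cluster_assignment n K Z \<tau> \<longleftrightarrow> (\<forall>i<n. \<tau> i < K) \<and>
     ((\<exists>C. kmeans_centroids n K Z C) \<longrightarrow>
      (\<exists>C. kmeans_centroids n K Z C \<and> (\<forall>i<n. \<forall>j<n. \<tau> i = \<tau> j \<longleftrightarrow> C i = C j)))"

definition hamming :: "nat \<Rightarrow> (nat \<Rightarrow> nat) \<Rightarrow> (nat \<Rightarrow> nat) \<Rightarrow> nat" where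
  "hamming n \<tau>1 \<tau>2 = (\<Sum>i<n. if \<tau>1 i \<noteq> \<tau>2 i then 1 else 0)"

definition clustering_error :: "nat \<Rightarrow> nat \<Rightarrow> (nat \<Rightarrow> nat) \<Rightarrow> (nat \<Rightarrow> nat) \<Rightarrow> nat" where
  "clustering_error n K \<tau>1 \<tau>2 = (INF \<sigma>\<in>{\<sigma>. \<sigma> permutes {..<K}}. hamming n (\<sigma> \<circ> \<tau>1) \<tau>2)"

end

theory Submission
  imports Defs
begin

text \<open>
  Let \<open>\<Delta> = X X\<^sup>T - X0 X0\<^sup>T\<close>. A single factor of the likelihood ratio is \<open>1 + e\<^sub>i\<^sub>j \<Delta>\<^sub>i\<^sub>j\<close>, where
  \<open>e\<^sub>i\<^sub>j\<close> is the centred and rescaled edge indicator. The true edge probabilities stay away from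
  \<open>0\<close> and \<open>1\<close>, so \<open>1 + h \<le> exp (h - \<delta> h\<^sup>2 / 2)\<close> applies to each factor, whatever \<open>X\<close> is, and the
  log-likelihood ratio is at most \<open>\<langle>e, \<Delta>\<rangle> - \<delta> |\<Delta>|\<^sup>2 / 4\<close> (\<open>lik_ratio_upper_bound\<close>). The linear term is
  controlled for all \<open>X\<close> at once: outside an event of probability at most \<open>2 exp (- n d)\<close> the
  operator norm of the noise is of order \<open>sqrt n\<close> (Hoeffding's inequality on a net,
  \<open>noise_bounded_with_high_probability\<close>), and \<open>|\<Delta>|\<^sup>2\<close> is at least a multiple of \<open>n |X - X0 W|\<^sup>2\<close> for the
  best rotation \<open>W\<close> (\<open>procrustes_bound\<close>). From there on the graph is fixed and the argument is
  deterministic.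

  A ball of bounded Frobenius radius around \<open>X0\<close> only has prior mass of order \<open>n\<close> to the power
  \<open>- n d / 2\<close>, and a lower bound for the evidence alone would cost a factor \<open>log n\<close> in the rate. The
  same power appears in the numerator: where \<open>|\<Delta>|\<^sup>2 > M\<^sup>2 n\<close>, the likelihood ratio is at most
  \<open>exp (- c M\<^sup>2 n)\<close> times a sum of Gaussians of variance of order \<open>1 / n\<close> in every row, centred at
  \<open>X0 B\<close> for the matrices \<open>B\<close> of a net of polynomial size. Both powers of \<open>n\<close> cancel
  (\<open>far_weight_le\<close>, \<open>evidence_ge\<close>, \<open>posterior_far_le\<close>), so that a large constant \<open>M\<close> leaves posterior
  mass at most \<open>exp (- n d / 2)\<close> on the far set.

  Off the far set, \<open>X\<close> is within bounded Frobenius distance of \<open>X0 W\<close>, whose rows take \<open>K\<close> separated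
  values. Then all but boundedly many rows of the K-means centroids of \<open>X\<close> are close to the
  corresponding row of \<open>X0 W\<close>; as every class has more members than that, the centroids inherit the
  classes of \<open>X0\<close> on all those rows (\<open>clustering_error_le\<close>). For the spectral estimate, the posterior
  mean \<open>P\<close> of the Gram matrix is within \<open>O (sqrt n)\<close> of \<open>X0 X0\<^sup>T\<close>, and the eigenvector equation
  \<open>U = P U L\<^sup>-\<^sup>1\<close> exhibits \<open>U\<close> directly as a perturbation of \<open>X0 B\<close> with \<open>B = X0\<^sup>T U L\<^sup>-\<^sup>1\<close>. The matrix \<open>B\<close>
  shrinks distances at most by a factor of order \<open>sqrt n\<close>, so the same clustering argument applies to
  \<open>U\<close>. Borel and Cantelli turn the summable failure probabilities into an almost sure statement.
\<close>

section \<open>K-means clustering of perturbed points\<close>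

lemma frob_rows_power2: "(frob_rows n Z)\<^sup>2 = (\<Sum>i<n. (norm (Z i))\<^sup>2)"
  by (simp add: frob_rows_def L2_set_def sum_nonneg)

lemma frob_rows_le_iff:
  "frob_rows n Z \<le> frob_rows n Z' \<longleftrightarrow> (\<Sum>i<n. (norm (Z i))\<^sup>2) \<le> (\<Sum>i<n. (norm (Z' i))\<^sup>2)"
  by (simp add: frob_rows_def L2_set_def)

lemma power2_norm_add_le: "(norm (x + y))\<^sup>2 \<le> 2 * (norm x)\<^sup>2 + 2 * (norm y)\<^sup>2"
proof -
  have "(norm (x + y))\<^sup>2 \<le> (norm x + norm y)\<^sup>2" by (intro power_mono norm_triangle_ineq) auto
  also have "\<dots> \<le> 2 * (norm x)\<^sup>2 + 2 * (norm y)\<^sup>2"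
    using sum_squares_bound[of "norm x" "norm y"] by (simp add: power2_sum)
  finally show ?thesis .
qed

lemma card_image_eq_if_same_kernel:
  assumes "\<And>i j. i \<in> A \<Longrightarrow> j \<in> A \<Longrightarrow> f i = f j \<longleftrightarrow> g i = g j"
  shows "card (f ` A) = card (g ` A)"
proof -
  define h where "h = (\<lambda>x. g (inv_into A f x))"
  have h: "h (f i) = g i" if "i \<in> A" for i
  proof -
    have "f i \<in> f ` A" using that by simp
    then have "inv_into A f (f i) \<in> A" "f (inv_into A f (f i)) = f i"
      by (rule inv_into_into, rule f_inv_into_f)
    then show ?thesis using assms that by (simp add: h_def)
  qed
  have "inj_on h (f ` A)"
  proof (rule inj_onI)
    fix x y assume "x \<in> f ` A" "y \<in> f ` A" "h x = h y"
    then obtain i j where "i \<in> A" "j \<in> A" "x = f i" "y = f j" by auto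
    then show "x = y" using \<open>h x = h y\<close> h assms by simp
  qed
  then have "card (h ` f ` A) = card (f ` A)" by (rule card_image)
  moreover have "h ` f ` A = g ` A" using h by (auto simp: image_image)
  ultimately show ?thesis by simp
qed

text \<open>
  Within each class the deviations from the class mean add up to zero, so Pythagoras applies.
\<close>

lemma class_means_optimal:
  fixes Z g :: "nat \<Rightarrow> real ^ 'd" and p :: "nat \<Rightarrow> nat" and n :: nat
  defines "m \<equiv> \<lambda>k. (1 / real (card {i\<in>{..<n}. p i = k})) *\<^sub>R (\<Sum>i\<in>{i\<in>{..<n}. p i = k}. Z i)"
  shows "(\<Sum>i<n. (norm (m (p i) - Z i))\<^sup>2) \<le> (\<Sum>i<n. (norm (g (p i) - Z i))\<^sup>2)"
proof -
  have zero: "(\<Sum>i\<in>{i\<in>{..<n}. p i = k}. m k - Z i) = 0" for k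
  proof (cases "{i\<in>{..<n}. p i = k} = {}")
    case False
    then have "card {i\<in>{..<n}. p i = k} \<noteq> 0" by simp
    then show ?thesis by (auto simp: sum_subtractf m_def sum_constant_scaleR simp del: sum_constant)
  next
    case True
    then show ?thesis by (simp only: sum.empty)
  qed
  have cross: "(\<Sum>i<n. (g (p i) - m (p i)) \<bullet> (m (p i) - Z i)) = 0"
  proof -
    have "(\<Sum>i<n. (g (p i) - m (p i)) \<bullet> (m (p i) - Z i)) =
      (\<Sum>k\<in>p ` {..<n}. \<Sum>i\<in>{i\<in>{..<n}. p i = k}. (g (p i) - m (p i)) \<bullet> (m (p i) - Z i))"
      by (rule sum.image_gen) simp
    also have "\<dots> = (\<Sum>k\<in>p ` {..<n}. (g k - m k) \<bullet> (\<Sum>i\<in>{i\<in>{..<n}. p i = k}. m k - Z i))"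
      by (intro sum.cong refl) (auto simp: inner_sum_right intro!: sum.cong)
    finally show ?thesis by (simp only: zero inner_zero_right sum.neutral_const)
  qed
  have "(norm (g (p i) - Z i))\<^sup>2 = (norm (g (p i) - m (p i)))\<^sup>2 + (norm (m (p i) - Z i))\<^sup>2
      + 2 * ((g (p i) - m (p i)) \<bullet> (m (p i) - Z i))" for i
    by (simp add: power2_norm_eq_inner inner_diff_left inner_diff_right inner_commute algebra_simps)
  then have "(\<Sum>i<n. (norm (g (p i) - Z i))\<^sup>2) =
      (\<Sum>i<n. (norm (g (p i) - m (p i)))\<^sup>2) + (\<Sum>i<n. (norm (m (p i) - Z i))\<^sup>2)"
    using cross by (simp add: sum.distrib flip: sum_distrib_left)
  moreover have "(\<Sum>i<n. (norm (g (p i) - m (p i)))\<^sup>2) \<ge> 0" by (simp add: sum_nonneg)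
  ultimately show ?thesis by linarith
qed

text \<open>
  Finitely many partitions into at most \<open>K\<close> classes compete, each of them served best by its class
  means, so there is a best choice with at most \<open>K\<close> distinct centroids. It has exactly \<open>K\<close>: with fewer,
  some row of \<open>Z\<close> differs from its centroid, and moving the centroid of this row alone onto it lowers
  the cost at the price of one more centroid.
\<close>

lemma kmeans_centroids_exist:
  fixes Z :: "nat \<Rightarrow> real ^ 'd"
  assumes K: "1 \<le> K" "K \<le> card (Z ` {..<n})"
  shows "\<exists>C. kmeans_centroids n K Z C"
proof -
  define m where "m = (\<lambda>(p :: nat \<Rightarrow> nat) k. (1 / real (card {i\<in>{..<n}. p i = k})) *\<^sub>R
    (\<Sum>i\<in>{i\<in>{..<n}. p i = k}. Z i))"
  define c where "c = (\<lambda>C. \<Sum>i<n. (norm (C i - Z i))\<^sup>2)"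
  define P where "P = ({..<n} \<rightarrow>\<^sub>E {..<K})"
  have "finite P" "P \<noteq> {}" using K by (auto simp: P_def PiE_eq_empty_iff lessThan_empty_iff bot_nat_def intro!: finite_PiE)
  then obtain p where "is_arg_min (\<lambda>p. c (\<lambda>i. m p (p i))) (\<lambda>p. p \<in> P) p"
    using ex_is_arg_min_if_finite by blast
  then have p: "p \<in> P" "\<And>q. q \<in> P \<Longrightarrow> c (\<lambda>i. m p (p i)) \<le> c (\<lambda>i. m q (q i))"
    by (auto simp: is_arg_min_linorder)
  define C where "C = (\<lambda>i. m p (p i))"
  have opt: "c C \<le> c D" if D: "card (D ` {..<n}) \<le> K" for D
  proof -
    obtain h where h: "inj_on h (D ` {..<n})" "h ` D ` {..<n} \<subseteq> {..<K}"
      using D card_le_inj[of "D ` {..<n}" "{..<K}"] by auto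
    define q where "q = restrict (h \<circ> D) {..<n}"
    have q: "q \<in> P" using h(2) by (auto simp: q_def P_def image_subset_iff)
    have g: "inv_into (D ` {..<n}) h (q i) = D i" if "i < n" for i
      using that h by (simp add: q_def)
    have "c C \<le> c (\<lambda>i. m q (q i))" using p q by (simp add: C_def)
    also have "\<dots> \<le> (\<Sum>i<n. (norm (inv_into (D ` {..<n}) h (q i) - Z i))\<^sup>2)"
      unfolding c_def m_def by (rule class_means_optimal)
    also have "\<dots> = c D" unfolding c_def using g by simp
    finally show ?thesis .
  qed
  have "C ` {..<n} \<subseteq> m p ` {..<K}" using p(1) by (auto simp: C_def P_def)
  then have le: "card (C ` {..<n}) \<le> K"
    by (metis card_image_le card_lessThan card_mono finite_imageI finite_lessThan le_trans)
  have "card (C ` {..<n}) = K"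
  proof (rule ccontr)
    assume "card (C ` {..<n}) \<noteq> K"
    with le have lt: "card (C ` {..<n}) < K" by simp
    have "C ` {..<n} \<noteq> Z ` {..<n}" using lt K by auto
    then obtain i where i: "i < n" "C i \<noteq> Z i" by (metis image_cong lessThan_iff)
    have "C(i := Z i) ` {..<n} \<subseteq> insert (Z i) (C ` {..<n})" by auto
    then have "card (C(i := Z i) ` {..<n}) \<le> card (insert (Z i) (C ` {..<n}))"
      by (intro card_mono) auto
    also have "\<dots> \<le> K" using lt card_insert_le_m1[of K "C ` {..<n}" "Z i"] K by auto
    finally have "c C \<le> c (C(i := Z i))" by (rule opt)
    moreover have "c (C(i := Z i)) < c C"
      unfolding c_def using i by (intro sum_strict_mono_ex1) auto
    ultimately show False by simp
  qed
  with opt have "kmeans_centroids n K Z C"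
    unfolding kmeans_centroids_def is_arg_min_def not_less[symmetric]
    by (auto simp: not_less frob_rows_le_iff c_def)
  then show ?thesis by blast
qed

text \<open>
  The matrix \<open>Z\<close> competes at cost zero, so that every minimiser equals \<open>Z\<close>.
\<close>

lemma cluster_assignment_exact:
  fixes Z :: "nat \<Rightarrow> real ^ 'd"
  assumes K: "card (Z ` {..<n}) = K" and \<tau>: "cluster_assignment n K Z \<tau>" and ij: "i < n" "j < n"
  shows "\<tau> i = \<tau> j \<longleftrightarrow> Z i = Z j"
proof -
  have Z0: "frob_rows n (\<lambda>i. Z i - Z i) = 0" by (simp add: frob_rows_def L2_set_def)
  have nn: "0 \<le> frob_rows n D" for D :: "nat \<Rightarrow> real ^ 'd" by (simp add: frob_rows_def)
  have "kmeans_centroids n K Z Z"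
    unfolding kmeans_centroids_def is_arg_min_def using K Z0 nn by (simp add: not_less)
  then obtain C where C: "kmeans_centroids n K Z C" "\<forall>i<n. \<forall>j<n. \<tau> i = \<tau> j \<longleftrightarrow> C i = C j"
    using \<tau> unfolding cluster_assignment_def by blast
  have "frob_rows n (\<lambda>i. C i - Z i) \<le> 0"
    using C(1) K Z0 unfolding kmeans_centroids_def is_arg_min_def by (metis not_less)
  then have "(\<Sum>i<n. (norm (C i - Z i))\<^sup>2) = 0"
    using nn[of "\<lambda>i. C i - Z i"] by (metis frob_rows_power2 order_antisym zero_power2)
  then have "C i = Z i" if "i < n" for i
    using that by (subst (asm) sum_nonneg_eq_0_iff) auto
  with C(2) ij show ?thesis by simp
qed

text \<open>Chebyshev's inequality for the counting measure.\<close>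

lemma card_far_rows_le:
  fixes W T :: "nat \<Rightarrow> real ^ 'd"
  assumes "(\<Sum>i<n. (norm (W i - T i))\<^sup>2) \<le> t" "\<zeta> > 0"
  shows "real (card {i\<in>{..<n}. norm (W i - T i) \<ge> \<zeta> / 2}) \<le> 4 * t / \<zeta>\<^sup>2"
proof -
  let ?B = "{i\<in>{..<n}. norm (W i - T i) \<ge> \<zeta> / 2}"
  have "real (card ?B) * (\<zeta>/2)\<^sup>2 = (\<Sum>i\<in>?B. (\<zeta>/2)\<^sup>2)" by simp
  also have "\<dots> \<le> (\<Sum>i\<in>?B. (norm (W i - T i))\<^sup>2)"
    using assms(2) by (intro sum_mono power_mono) auto
  also have "\<dots> \<le> (\<Sum>i<n. (norm (W i - T i))\<^sup>2)" by (intro sum_mono2) auto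
  finally have "real (card ?B) * (\<zeta>/2)\<^sup>2 \<le> t" using assms(1) by linarith
  then show ?thesis using assms(2) by (simp add: field_simps power2_eq_square)
qed

text \<open>
  The rows far from their target are too few to fill a class, so each class has a member
  close to its target.
\<close>

lemma close_representatives:
  fixes W T :: "nat \<Rightarrow> real ^ 'd"
  assumes "(\<Sum>i<n. (norm (W i - T i))\<^sup>2) \<le> t" "\<zeta> > 0"
    and big: "\<And>j. j < n \<Longrightarrow> 4 * t / \<zeta>\<^sup>2 < real (card {i\<in>{..<n}. T i = T j})"
  shows "\<exists>g. \<forall>x\<in>T ` {..<n}. g x < n \<and> T (g x) = x \<and> norm (W (g x) - x) < \<zeta> / 2"
proof -
  have "\<exists>i<n. T i = x \<and> norm (W i - x) < \<zeta> / 2" if x: "x \<in> T ` {..<n}" for x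
  proof (rule ccontr)
    assume neg: "\<not> ?thesis"
    from x obtain j where j: "j < n" "x = T j" by auto
    have "{i\<in>{..<n}. T i = T j} \<subseteq> {i\<in>{..<n}. norm (W i - T i) \<ge> \<zeta> / 2}"
      using neg j by force
    then have "card {i\<in>{..<n}. T i = T j} \<le> card {i\<in>{..<n}. norm (W i - T i) \<ge> \<zeta> / 2}"
      by (intro card_mono) auto
    then show False using card_far_rows_le[OF assms(1,2)] big[OF j(1)] by linarith
  qed
  then show ?thesis by metis
qed

text \<open>
  The centroids \<open>C\<close> of \<open>Z\<close> are within twice the distance of \<open>Z\<close> to \<open>T\<close>, because \<open>T\<close> is a competitor.
  Call a row good if \<open>C\<close> is within \<open>\<zeta> / 2\<close> of \<open>T\<close> there. Good rows of different classes have different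
  centroids. Good rows of the same class have the same one: representatives of the \<open>K\<close> classes
  already use up all \<open>K\<close> centroids. So the labels agree, up to the permutation read off from the
  representatives, except on the bad rows. The size condition on the classes serves twice, for \<open>Z\<close> to
  ensure that a minimiser exists and for \<open>C\<close> to find good representatives.
\<close>

lemma clustering_error_le:
  fixes Z T :: "nat \<Rightarrow> real ^ 'd"
  assumes K: "card (T ` {..<n}) = K" and n: "n \<ge> 1"
    and \<zeta>: "\<zeta> > 0"
    and sep: "\<And>i j. i < n \<Longrightarrow> j < n \<Longrightarrow> T i \<noteq> T j \<Longrightarrow> norm (T i - T j) \<ge> \<zeta>"
    and s: "(\<Sum>i<n. (norm (Z i - T i))\<^sup>2) \<le> s"
    and big: "\<And>j. j < n \<Longrightarrow> 16 * s / \<zeta>\<^sup>2 < real (card {i\<in>{..<n}. T i = T j})"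
    and \<tau>: "cluster_assignment n K Z \<tau>"
    and \<tau>0: "\<And>i. i < n \<Longrightarrow> \<tau>0 i < K"
      "\<And>i j. i < n \<Longrightarrow> j < n \<Longrightarrow> \<tau>0 i = \<tau>0 j \<longleftrightarrow> T i = T j"
  shows "real (clustering_error n K \<tau>0 \<tau>) \<le> 16 * s / \<zeta>\<^sup>2"
    and "real (clustering_error n K \<tau> \<tau>0) \<le> 16 * s / \<zeta>\<^sup>2"
proof -
  have s0: "s \<ge> 0" using s by (smt (verit) sum_nonneg zero_le_power2)
  have near: "x = y" if "x \<in> T ` {..<n}" "y \<in> T ` {..<n}"
    "norm (w - x) < \<zeta> / 2" "norm (w - y) < \<zeta> / 2" for w x y
  proof (rule ccontr)
    assume "x \<noteq> y"
    then have "norm (x - y) \<ge> \<zeta>" using that sep by auto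
    moreover have "norm (x - y) \<le> norm (w - x) + norm (w - y)"
      using norm_triangle_ineq4[of "w - y" "w - x"] by (simp add: add.commute)
    ultimately show False using that by linarith
  qed
  have "4 * s / \<zeta>\<^sup>2 \<le> 16 * s / \<zeta>\<^sup>2" using s0 by (intro divide_right_mono) auto
  then obtain g0 where g0: "\<forall>x\<in>T ` {..<n}. g0 x < n \<and> T (g0 x) = x \<and> norm (Z (g0 x) - x) < \<zeta> / 2"
    using close_representatives[OF s \<zeta>] big by (meson order.strict_trans1)
  have "inj_on (Z \<circ> g0) (T ` {..<n})"
    by (rule inj_onI) (metis comp_apply g0 near)
  moreover have "(Z \<circ> g0) ` T ` {..<n} \<subseteq> Z ` {..<n}" using g0 by auto
  ultimately have "K \<le> card (Z ` {..<n})"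
    using card_inj_on_le[of "Z \<circ> g0" "T ` {..<n}" "Z ` {..<n}"] K by auto
  moreover have "0 < K" using K n by (auto simp: card_gt_0_iff lessThan_empty_iff bot_nat_def)
  then have "1 \<le> K" by simp
  ultimately obtain C where C: "kmeans_centroids n K Z C" "\<forall>i<n. \<forall>j<n. \<tau> i = \<tau> j \<longleftrightarrow> C i = C j"
    using kmeans_centroids_exist \<tau> unfolding cluster_assignment_def by blast
  have "frob_rows n (\<lambda>i. C i - Z i) \<le> frob_rows n (\<lambda>i. T i - Z i)"
    using C(1) K unfolding kmeans_centroids_def is_arg_min_def by (metis not_less)
  then have CZ: "(\<Sum>i<n. (norm (C i - Z i))\<^sup>2) \<le> s"
    using s by (simp add: frob_rows_le_iff norm_minus_commute)
  have "(norm (C i - T i))\<^sup>2 \<le> 2 * (norm (C i - Z i))\<^sup>2 + 2 * (norm (Z i - T i))\<^sup>2" for i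
    using power2_norm_add_le[of "C i - Z i" "Z i - T i"] by simp
  then have "(\<Sum>i<n. (norm (C i - T i))\<^sup>2) \<le>
      (\<Sum>i<n. 2 * (norm (C i - Z i))\<^sup>2 + 2 * (norm (Z i - T i))\<^sup>2)" by (rule sum_mono)
  also have "\<dots> \<le> 4 * s" using CZ s by (simp add: sum.distrib flip: sum_distrib_left)
  finally have CT: "(\<Sum>i<n. (norm (C i - T i))\<^sup>2) \<le> 4 * s" .
  define Bad where "Bad = {i\<in>{..<n}. norm (C i - T i) \<ge> \<zeta> / 2}"
  have Bad: "real (card Bad) \<le> 16 * s / \<zeta>\<^sup>2"
    using card_far_rows_le[OF CT \<zeta>] by (simp add: Bad_def)
  obtain g where g: "\<And>x. x \<in> T ` {..<n} \<Longrightarrow> g x < n \<and> T (g x) = x \<and> norm (C (g x) - x) < \<zeta> / 2"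
    using close_representatives[OF CT \<zeta>] big by auto
  have injC: "inj_on (C \<circ> g) (T ` {..<n})"
    by (rule inj_onI) (metis comp_apply g near)
  have "(C \<circ> g) ` T ` {..<n} = C ` {..<n}"
  proof (rule card_subset_eq)
    show "(C \<circ> g) ` T ` {..<n} \<subseteq> C ` {..<n}" using g by auto
    have "card (C ` {..<n}) = K" using C(1) unfolding kmeans_centroids_def is_arg_min_def by auto
    then show "card ((C \<circ> g) ` T ` {..<n}) = card (C ` {..<n})"
      using card_image[OF injC] K by simp
  qed simp
  then have goodC: "C i = C (g (T i))" if "i < n" "i \<notin> Bad" for i
  proof -
    from that have "C i \<in> (C \<circ> g) ` T ` {..<n}"
      using \<open>(C \<circ> g) ` T ` {..<n} = C ` {..<n}\<close> by auto
    then obtain x where x: "x \<in> T ` {..<n}" "C i = C (g x)" by auto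
    have "norm (C i - T i) < \<zeta> / 2" using that by (auto simp: Bad_def)
    then have "x = T i" using near[of x "T i" "C i"] g[OF x(1)] x that by auto
    then show ?thesis using x by simp
  qed
  define R where "R = g ` T ` {..<n}"
  have Rn: "r < n" if "r \<in> R" for r using that g by (auto simp: R_def)
  have cardR: "card R = K"
    unfolding R_def using K injC by (metis card_image inj_on_imageI2)
  have finR: "finite R" by (simp add: R_def)
  have Rg: "r = g (T r)" if "r \<in> R" for r using that g by (auto simp: R_def)
  have inj0: "inj_on \<tau>0 R" by (rule inj_onI) (metis Rg Rn \<tau>0(2))
  have inj1: "inj_on \<tau> R"
  proof (rule inj_onI)
    fix r r' assume rr: "r \<in> R" "r' \<in> R" "\<tau> r = \<tau> r'"
    then have "C r = C r'" using C(2) Rn by blast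
    then have "(C \<circ> g) (T r) = (C \<circ> g) (T r')" using Rg rr by simp
    then have "T r = T r'" using injC Rn rr unfolding inj_on_def by blast
    then show "r = r'" using Rg rr by metis
  qed
  have bij: "bij_betw \<alpha> R {..<K}" if "inj_on \<alpha> R" "\<And>i. i < n \<Longrightarrow> \<alpha> i < K" for \<alpha> :: "nat \<Rightarrow> nat"
  proof -
    have "\<alpha> ` R = {..<K}"
      using that Rn cardR by (intro card_subset_eq) (auto simp: card_image)
    then show ?thesis using that by (simp add: bij_betw_def)
  qed
  have b0: "bij_betw \<tau>0 R {..<K}" using inj0 \<tau>0(1) by (rule bij)
  have b1: "bij_betw \<tau> R {..<K}" using inj1 \<tau> by (auto intro!: bij simp: cluster_assignment_def)
  define f where "f = (\<lambda>k. if k < K then \<tau> (inv_into R \<tau>0 k) else k)"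
  have "bij_betw (\<tau> \<circ> inv_into R \<tau>0) {..<K} {..<K}"
    using b0 b1 by (meson bij_betw_inv_into bij_betw_trans)
  then have "bij_betw f {..<K} {..<K}"
    by (rule bij_betw_cong[THEN iffD1, rotated]) (simp add: f_def)
  then have f: "f permutes {..<K}" by (rule bij_imp_permutes) (simp add: f_def)
  have fgood: "f (\<tau>0 i) = \<tau> i" if "i < n" "i \<notin> Bad" for i
  proof -
    have Ti: "T i \<in> T ` {..<n}" using that by simp
    let ?r = "g (T i)"
    have r: "?r \<in> R" "?r < n" "T ?r = T i" using g[OF Ti] Ti by (auto simp: R_def)
    have "\<tau>0 ?r = \<tau>0 i" using \<tau>0(2) r that by blast
    then have "f (\<tau>0 i) = \<tau> ?r"
      unfolding f_def using \<tau>0(1)[OF that(1)] r(1) inj0 by (metis inv_into_f_f)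
    also have "\<dots> = \<tau> i" using C(2) goodC[OF that] r that by metis
    finally show ?thesis .
  qed
  have ham: "real (hamming n \<alpha> \<beta>) \<le> 16 * s / \<zeta>\<^sup>2" if "\<And>i. i < n \<Longrightarrow> i \<notin> Bad \<Longrightarrow> \<alpha> i = \<beta> i" for \<alpha> \<beta>
  proof -
    have "hamming n \<alpha> \<beta> = card {i\<in>{..<n}. \<alpha> i \<noteq> \<beta> i}"
      by (simp add: hamming_def sum.If_cases Int_def)
    also have "\<dots> \<le> card Bad" using that by (intro card_mono) (auto simp: Bad_def)
    finally show ?thesis using Bad by linarith
  qed
  have err: "clustering_error n K \<alpha> \<beta> \<le> hamming n (\<sigma> \<circ> \<alpha>) \<beta>" if "\<sigma> permutes {..<K}" for \<sigma> \<alpha> \<beta>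
    unfolding clustering_error_def using that by (intro cINF_lower) auto
  show "real (clustering_error n K \<tau>0 \<tau>) \<le> 16 * s / \<zeta>\<^sup>2"
    using err[OF f, of \<tau>0 \<tau>] ham[of "f \<circ> \<tau>0" \<tau>] fgood by fastforce
  have "(inv f \<circ> \<tau>) i = \<tau>0 i" if "i < n" "i \<notin> Bad" for i
    using fgood[OF that] f by (metis comp_apply permutes_inverses(2))
  then show "real (clustering_error n K \<tau> \<tau>0) \<le> 16 * s / \<zeta>\<^sup>2"
    using err[OF permutes_inv[OF f], of \<tau> \<tau>0] ham[of "inv f \<circ> \<tau>" \<tau>0] by fastforce
qed

section \<open>Rayleigh quotients and Procrustes alignment\<close>

lemma quadratic_form_second_moment:
  fixes X :: "nat \<Rightarrow> real ^ 'd"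
  shows "v \<bullet> (second_moment n X *v v) = (\<Sum>i<n. (X i \<bullet> v)\<^sup>2)"
proof -
  have "v \<bullet> (second_moment n X *v v) = (\<Sum>a\<in>UNIV. \<Sum>b\<in>UNIV. \<Sum>i<n. v $ a * X i $ a * (X i $ b * v $ b))"
    by (simp add: inner_vec_def matrix_vector_mult_def second_moment_def sum_distrib_left sum_distrib_right mult_ac)
  also have "\<dots> = (\<Sum>i<n. \<Sum>a\<in>UNIV. \<Sum>b\<in>UNIV. v $ a * X i $ a * (X i $ b * v $ b))"
    by (simp only: sum.swap[of _ "{..<n}" UNIV])
  also have "\<dots> = (\<Sum>i<n. (X i \<bullet> v)\<^sup>2)"
    by (simp add: inner_vec_def power2_eq_square sum_product mult_ac)
  finally show ?thesis .
qed

lemma norm_matrix_vector_mult_le: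
  fixes A :: "real ^ 'd ^ 'e"
  shows "norm (A *v v) \<le> norm A * norm v"
proof -
  have "(A *v v) $ i = A $ i \<bullet> v" for i
    by (simp add: matrix_vector_mult_def inner_vec_def)
  then have "norm ((A *v v) $ i) \<le> norm (A $ i) * norm v" for i
    by (simp add: Cauchy_Schwarz_ineq2)
  then have "norm (A *v v) \<le> L2_set (\<lambda>i. norm (A $ i) * norm v) UNIV"
    by (subst norm_vec_def, intro L2_set_mono) auto
  also have "\<dots> = norm A * norm v"
    by (subst norm_vec_def, subst L2_set_left_distrib[symmetric]) auto
  finally show ?thesis .
qed

lemma inner_symmetric_matrix:
  fixes A :: "real ^ 'd ^ 'd"
  assumes "transpose A = A"
  shows "v \<bullet> (A *v w) = w \<bullet> (A *v v)"
  using assms by (metis dot_lmul_matrix inner_commute transpose_matrix_vector)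

text \<open>
  The definition by \<open>LEAST\<close> only means something once a least eigenvalue exists. The Rayleigh
  quotient attains its minimum \<open>\<mu>\<close> on the unit sphere; the form of \<open>A - \<mu>\<close> is nonnegative and vanishes at
  the minimiser, so a first-order variation shows that the minimiser is an eigenvector.
\<close>

lemma smallest_eigenvalue_rayleigh:
  fixes A :: "real ^ 'd ^ 'd"
  assumes A: "positive_definite A"
  shows "smallest_eigenvalue A > 0" and "smallest_eigenvalue A * (norm v)\<^sup>2 \<le> v \<bullet> (A *v v)"
proof -
  have sym: "transpose A = A" and pos: "\<And>v. v \<noteq> 0 \<Longrightarrow> v \<bullet> (A *v v) > 0"
    using A unfolding positive_definite_def by auto
  have cont: "continuous_on (sphere 0 1) (\<lambda>v. v \<bullet> (A *v v))"
    by (intro continuous_intros matrix_vector_mult_linear_continuous_on)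
  have "sphere (0 :: real ^ 'd) 1 \<noteq> {}" by simp
  then obtain v0 where v0: "norm v0 = 1" and min: "\<And>v. norm v = 1 \<Longrightarrow> v0 \<bullet> (A *v v0) \<le> v \<bullet> (A *v v)"
    using continuous_attains_inf[OF compact_sphere _ cont] by auto
  define \<mu> where "\<mu> = v0 \<bullet> (A *v v0)"
  have v0': "v0 \<noteq> 0" using v0 by auto
  have ray: "\<mu> * (norm v)\<^sup>2 \<le> v \<bullet> (A *v v)" for v
  proof (cases "v = 0")
    case False
    have "\<mu> \<le> (v /\<^sub>R norm v) \<bullet> (A *v (v /\<^sub>R norm v))"
      unfolding \<mu>_def using False by (intro min) simp
    also have "\<dots> = (v \<bullet> (A *v v)) / (norm v)\<^sup>2"
      by (simp add: matrix_vector_mult_scaleR power2_eq_square divide_inverse mult_ac)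
    finally show ?thesis using False by (simp add: pos_le_divide_eq)
  qed auto
  define f where "f = (\<lambda>v. v \<bullet> (A *v v) - \<mu> * (v \<bullet> v))"
  have f0: "f v \<ge> 0" for v using ray[of v] by (simp add: f_def power2_norm_eq_inner)
  define w where "w = A *v v0 - \<mu> *\<^sub>R v0"
  have "w = 0"
  proof (rule ccontr)
    assume "w \<noteq> 0"
    then have w2: "w \<bullet> w > 0" by simp
    have exp: "f (v0 - s *\<^sub>R w) = - 2 * s * (w \<bullet> w) + s\<^sup>2 * f w" for s
    proof -
      have "v0 \<bullet> (A *v w) = w \<bullet> (A *v v0)" by (rule inner_symmetric_matrix[OF sym])
      moreover have "w \<bullet> w = w \<bullet> (A *v v0) - \<mu> * (w \<bullet> v0)" by (simp add: w_def inner_diff_right)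
      moreover have "v0 \<bullet> v0 = 1" using v0 by (simp flip: power2_norm_eq_inner)
      moreover have "v0 \<bullet> (A *v v0) = \<mu>" by (simp add: \<mu>_def)
      ultimately show ?thesis
        unfolding f_def
        by (simp add: matrix_vector_mult_diff_distrib matrix_vector_mult_scaleR inner_diff_left
            inner_diff_right inner_commute[of w v0] power2_eq_square) (simp add: algebra_simps)
    qed
    \<comment> \<open>A step so small that the negative linear term outweighs \<open>s\<^sup>2 * f w\<close>.\<close>
    define s where "s = (w \<bullet> w) / (f w + 1)"
    have fw: "f w + 1 > 0" using f0[of w] by linarith
    then have s: "s > 0" using w2 by (simp add: s_def)
    have "s * (f w + 1) = w \<bullet> w" using fw by (simp add: s_def)
    moreover have "0 \<le> - 2 * s * (w \<bullet> w) + s\<^sup>2 * f w" using f0[of "v0 - s *\<^sub>R w"] exp by simp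
    then have "0 \<le> s * (s * f w - 2 * (w \<bullet> w))" by (simp add: power2_eq_square algebra_simps)
    then have "0 \<le> s * f w - 2 * (w \<bullet> w)" using s by (simp add: zero_le_mult_iff)
    ultimately show False using s w2 by (simp add: algebra_simps)
  qed
  have "smallest_eigenvalue A = \<mu>"
    unfolding smallest_eigenvalue_def
  proof (rule Least_equality)
    show "\<exists>v. v \<noteq> 0 \<and> A *v v = \<mu> *\<^sub>R v" using \<open>w = 0\<close> v0' by (auto simp: w_def)
  next
    fix l assume "\<exists>v. v \<noteq> 0 \<and> A *v v = l *\<^sub>R v"
    then obtain v where v: "v \<noteq> 0" "A *v v = l *\<^sub>R v" by auto
    then have "\<mu> * (norm v)\<^sup>2 \<le> l * (norm v)\<^sup>2" using ray[of v] by (simp add: power2_norm_eq_inner)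
    then show "\<mu> \<le> l" using v(1) by simp
  qed
  then show "smallest_eigenvalue A > 0" "smallest_eigenvalue A * (norm v)\<^sup>2 \<le> v \<bullet> (A *v v)"
    using ray pos[OF v0'] by (simp_all add: \<mu>_def)
qed

lemma eventually_second_moment_ge:
  fixes X :: "nat \<Rightarrow> nat \<Rightarrow> real ^ 'd"
  assumes \<Delta>: "positive_definite \<Delta>"
    and lim: "(\<lambda>n. (1 / real n) *\<^sub>R second_moment n (X n)) \<longlonglongrightarrow> \<Delta>"
  shows "\<forall>\<^sub>F n in sequentially. \<forall>v. real n * (smallest_eigenvalue \<Delta> / 2) * (norm v)\<^sup>2 \<le> (\<Sum>i<n. (X n i \<bullet> v)\<^sup>2)"
proof -
  note ray = smallest_eigenvalue_rayleigh[OF \<Delta>]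
  have "\<forall>\<^sub>F n in sequentially. norm ((1 / real n) *\<^sub>R second_moment n (X n) - \<Delta>) < smallest_eigenvalue \<Delta> / 2"
    using tendstoD[OF lim half_gt_zero[OF ray(1)]] by (simp only: dist_norm)
  then show ?thesis using eventually_gt_at_top[of 0]
  proof eventually_elim
    case (elim n)
    show ?case
    proof
      fix v :: "real ^ 'd"
      let ?E = "(1 / real n) *\<^sub>R second_moment n (X n) - \<Delta>"
      have "\<bar>v \<bullet> (?E *v v)\<bar> \<le> norm v * (norm ?E * norm v)"
        by (meson Cauchy_Schwarz_ineq2 mult_left_mono norm_ge_zero norm_matrix_vector_mult_le order_trans)
      also have "\<dots> \<le> smallest_eigenvalue \<Delta> / 2 * (norm v)\<^sup>2"
        using mult_right_mono[OF less_imp_le[OF elim(1)], of "(norm v)\<^sup>2"]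
        by (simp add: power2_eq_square mult_ac)
      finally have "smallest_eigenvalue \<Delta> / 2 * (norm v)\<^sup>2 \<le> v \<bullet> (\<Delta> *v v) + v \<bullet> (?E *v v)"
        using ray(2)[of v] by (simp add: abs_le_iff)
      also have "\<dots> = (\<Sum>i<n. (X n i \<bullet> v)\<^sup>2) / real n"
        by (simp add: matrix_vector_mult_diff_rdistrib inner_diff_right
            scaleR_matrix_vector_assoc[symmetric] quadratic_form_second_moment)
      finally show "real n * (smallest_eigenvalue \<Delta> / 2) * (norm v)\<^sup>2 \<le> (\<Sum>i<n. (X n i \<bullet> v)\<^sup>2)"
        using elim by (simp add: field_simps)
    qed
  qed
qed

text \<open>At \<open>v = 0\<close> the division by zero makes this the identity.\<close>

definition householder :: "real ^ 'd \<Rightarrow> real ^ 'd \<Rightarrow> real ^ 'd" where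
  "householder v x = x - (2 * (v \<bullet> x) / (v \<bullet> v)) *\<^sub>R v"

lemma orthogonal_householder: "orthogonal_transformation (householder v)"
proof (cases "v = 0")
  case True
  then show ?thesis by (simp add: householder_def orthogonal_transformation_def linear_iff)
next
  case False
  have "linear (householder v)"
    by (rule linearI) (simp_all add: householder_def inner_add_right add_divide_distrib
        scaleR_add_left distrib_left algebra_simps)
  moreover have "householder v x \<bullet> householder v y = x \<bullet> y" for x y
    using False
    by (simp add: householder_def inner_diff_left inner_diff_right field_simps inner_commute)
  ultimately show ?thesis by (simp add: orthogonal_transformation_def)
qed

lemma matrix_inner_columns:
  fixes R Q :: "real ^ 'd ^ 'd"
  shows "R \<bullet> Q = (\<Sum>b\<in>UNIV. column b R \<bullet> column b Q)"
  unfolding inner_vec_def column_def by (subst sum.swap) simp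

text \<open>
  Comparison with a single reflection gives \<open>v \<bullet> Q v \<ge> 0\<close>. The product of the reflections
  along two nearly parallel vectors is a small rotation, and the term of first order in the angle
  gives the symmetry.
\<close>

lemma trace_maximal_imp_symmetric_psd:
  fixes Q :: "real ^ 'd ^ 'd"
  assumes max: "\<And>R. orthogonal_matrix R \<Longrightarrow> R \<bullet> Q \<le> mat 1 \<bullet> Q"
  shows "transpose Q = Q" and "v \<bullet> (Q *v v) \<ge> 0"
proof -
  define q where "q = (\<lambda>u v. u \<bullet> (Q *v v))"
  have q_lin: "q (x + y) z = q x z + q y z" "q x (y + z) = q x y + q x z"
    "q (c *\<^sub>R x) z = c * q x z" "q x (c *\<^sub>R z) = c * q x z"
    "q (x - y) z = q x z - q y z" for x y z c
    by (simp_all add: q_def inner_add_left inner_diff_left matrix_vector_right_distrib inner_add_right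
        matrix_vector_mult_scaleR)
  have q_col: "u \<bullet> column b Q = q u (axis b 1)" for u b
    by (simp add: q_def matrix_vector_mul_component column_def matrix_vector_mult_basis)
  have q_sum: "(\<Sum>b\<in>UNIV. v $ b * q u (axis b 1)) = q u v" for u v
  proof -
    have "v = (\<Sum>b\<in>UNIV. v $ b *\<^sub>R axis b 1)" by (metis basis_expansion scalar_mult_eq_scaleR)
    moreover have "q u (\<Sum>b\<in>UNIV. v $ b *\<^sub>R axis b 1) = (\<Sum>b\<in>UNIV. v $ b * q u (axis b 1))"
      unfolding q_def by (simp add: linear_sum[OF matrix_vector_mul_linear] inner_sum_right matrix_vector_mult_scaleR)
    ultimately show ?thesis by simp
  qed
  have max': "(\<Sum>b\<in>UNIV. q (f (axis b 1)) (axis b 1)) \<le> (\<Sum>b\<in>UNIV. q (axis b 1) (axis b 1))"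
    if f: "orthogonal_transformation f" for f :: "real ^ 'd \<Rightarrow> real ^ 'd"
  proof -
    have "orthogonal_matrix (matrix f)" using f by (simp add: orthogonal_transformation_matrix)
    from max[OF this] show ?thesis
      unfolding matrix_inner_columns q_col by (simp add: column_def matrix_def mat_def axis_def
          flip: vec_lambda_eta) (simp add: vec_lambda_eta)
  qed
  have psd: "q v v \<ge> 0" for v
  proof (cases "v = 0")
    case False
    have "q (householder v (axis b 1)) (axis b 1) =
        q (axis b 1) (axis b 1) - 2 / (v \<bullet> v) * (v $ b * q v (axis b 1))" for b
      by (simp add: householder_def q_lin inner_axis)
    note eq = this
    have "0 \<le> 2 / (v \<bullet> v) * q v v"
      using max'[OF orthogonal_householder[of v]]
      unfolding eq sum_subtractf sum_distrib_left[symmetric] q_sum by simp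
    moreover have "2 / (v \<bullet> v) > 0" using False by simp
    ultimately show ?thesis using zero_le_mult_iff[of "2 / (v \<bullet> v)" "q v v"] by linarith
  qed (simp add: q_def)
  then show "v \<bullet> (Q *v v) \<ge> 0" by (simp add: q_def)
  \<comment> \<open>The product of two reflections does not increase the trace; cleared of denominators.\<close>
  have two: "2 * (u \<bullet> v) * q u v \<le> (v \<bullet> v) * q u u + q v v" if u: "u \<bullet> u = 1" and v: "v \<noteq> 0" for u v
  proof -
    have orth: "orthogonal_transformation (householder u \<circ> householder v)"
      by (intro orthogonal_transformation_compose orthogonal_householder)
    have "householder u (householder v (axis b 1)) =
       axis b 1 + (- 2 * u $ b) *\<^sub>R u + (- 2 / (v \<bullet> v) * v $ b) *\<^sub>R v
       + (4 * (u \<bullet> v) / (v \<bullet> v) * v $ b) *\<^sub>R u" for b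
      using u by (simp add: householder_def inner_axis inner_diff_right algebra_simps)
    then have eq: "q ((householder u \<circ> householder v) (axis b 1)) (axis b 1) = q (axis b 1) (axis b 1)
       + (- 2) * (u $ b * q u (axis b 1)) + (- 2 / (v \<bullet> v)) * (v $ b * q v (axis b 1))
       + 4 * (u \<bullet> v) / (v \<bullet> v) * (v $ b * q u (axis b 1))" for b
      by (simp only: o_apply q_lin mult.assoc)
    have "0 \<le> 2 * q u u + 2 / (v \<bullet> v) * q v v - 4 * (u \<bullet> v) / (v \<bullet> v) * q u v"
      using max'[OF orth] unfolding eq sum.distrib sum_distrib_left[symmetric] q_sum by simp
    then have "0 \<le> (v \<bullet> v) * (2 * q u u + 2 / (v \<bullet> v) * q v v - 4 * (u \<bullet> v) / (v \<bullet> v) * q u v)"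
      by (intro mult_nonneg_nonneg) auto
    also have "\<dots> = 2 * ((v \<bullet> v) * q u u + q v v) - 2 * (2 * (u \<bullet> v) * q u v)"
      using v by (simp add: field_simps)
    finally show ?thesis by simp
  qed
  have sym: "q u w = q w u" if u: "u \<bullet> u = 1" and w: "w \<bullet> w = 1" and uw: "u \<bullet> w = 0" for u w
  proof -
    define e where "e = q u w - q w u"
    define c where "c = q u u + q w w"
    have c: "c \<ge> 0" using psd by (simp add: c_def)
    \<comment> \<open>Reflections along \<open>u\<close> and \<open>u + t w\<close>, a rotation by an angle of order \<open>t\<close>.\<close>
    have key: "t * e \<le> t\<^sup>2 * c" for t
    proof -
      have vv: "(u + t *\<^sub>R w) \<bullet> (u + t *\<^sub>R w) = 1 + t\<^sup>2"
        using u w uw by (simp add: inner_add_left inner_add_right inner_commute power2_eq_square)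
      moreover have "1 + t\<^sup>2 > 0" by (simp add: add_pos_nonneg)
      ultimately have "u + t *\<^sub>R w \<noteq> 0" by force
      from two[OF u this] show ?thesis
        unfolding vv using u uw
        by (simp add: q_lin inner_add_right e_def c_def power2_eq_square algebra_simps)
    qed
    have "e = 0"
    proof (rule ccontr)
      assume "e \<noteq> 0"
      then have e2: "e * e > 0" using not_real_square_gt_zero by blast
      define s where "s = 1 / (c + 1)"
      have s: "s > 0" "s * c < 1" using c by (auto simp: s_def)
      have "(s * (e * e)) * 1 \<le> (s * (e * e)) * (s * c)"
        using key[of "s * e"] by (simp add: power2_eq_square mult_ac)
      then have "1 \<le> s * c" using s e2 by (simp only: mult_le_cancel_left_pos mult_pos_pos)
      then show False using s by simp
    qed
    then show ?thesis by (simp add: e_def)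
  qed
  have "Q $ a $ b = Q $ b $ a" for a b
  proof (cases "a = b")
    case False
    have "q (axis a 1) (axis b 1) = q (axis b 1) (axis a 1)"
      using False by (intro sym) (auto simp: inner_axis_axis)
    then show ?thesis by (simp add: q_def inner_axis' matrix_vector_mult_basis column_def)
  qed simp
  then show "transpose Q = Q" by (simp add: transpose_def vec_eq_iff)
qed

lemma compact_orthogonal_matrices: "compact {W :: real ^ 'd ^ 'd. orthogonal_matrix W}"
proof -
  have "norm W \<le> (\<Sum>i\<in>(UNIV :: 'd set). 1)" if "orthogonal_matrix W" for W :: "real ^ 'd ^ 'd"
  proof -
    have "norm (W $ i) = 1" for i
      using that by (simp add: orthogonal_matrix_orthonormal_rows row_def vec_lambda_eta)
    then show ?thesis using norm_le_l1_cart
      by (metis (no_types, lifting) L2_set_le_sum norm_ge_zero norm_vec_def sum.cong)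
  qed
  then have "bounded {W :: real ^ 'd ^ 'd. orthogonal_matrix W}"
    unfolding bounded_iff by blast
  moreover have "closed {W :: real ^ 'd ^ 'd. orthogonal_matrix W}"
  proof -
    have "{W :: real ^ 'd ^ 'd. orthogonal_matrix W} =
      (\<Inter>a b. {W. (\<Sum>k\<in>UNIV. W $ k $ a * W $ k $ b) = (if a = b then 1 else 0)})"
      by (auto simp: orthogonal_matrix vec_eq_iff matrix_matrix_mult_def transpose_def mat_def)
    moreover have "closed \<dots>" by (intro closed_INT ballI closed_Collect_eq continuous_intros)
    ultimately show ?thesis by simp
  qed
  ultimately show ?thesis by (simp add: compact_eq_bounded_closed)
qed

lemma matrix_mult_inner_left:
  fixes W R H :: "real ^ 'd ^ 'd"
  shows "(W ** R) \<bullet> H = R \<bullet> (transpose W ** H)"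
proof -
  have "(W ** R) \<bullet> H = (\<Sum>a\<in>UNIV. \<Sum>b\<in>UNIV. \<Sum>k\<in>UNIV. W $ a $ k * R $ k $ b * H $ a $ b)"
    by (simp add: inner_vec_def matrix_matrix_mult_def sum_distrib_right)
  also have "\<dots> = (\<Sum>a\<in>UNIV. \<Sum>k\<in>UNIV. \<Sum>b\<in>UNIV. W $ a $ k * R $ k $ b * H $ a $ b)"
    by (intro sum.cong refl sum.swap)
  also have "\<dots> = (\<Sum>k\<in>UNIV. \<Sum>a\<in>UNIV. \<Sum>b\<in>UNIV. W $ a $ k * R $ k $ b * H $ a $ b)"
    by (rule sum.swap)
  also have "\<dots> = (\<Sum>k\<in>UNIV. \<Sum>b\<in>UNIV. \<Sum>a\<in>UNIV. W $ a $ k * R $ k $ b * H $ a $ b)"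
    by (intro sum.cong refl sum.swap)
  also have "\<dots> = R \<bullet> (transpose W ** H)"
    by (simp add: inner_vec_def matrix_matrix_mult_def transpose_def sum_distrib_left mult_ac)
  finally show ?thesis .
qed

text \<open>
  The best rotation maximises a linear functional over the compact orthogonal group; maximality
  is inherited by all products with a further rotation, which makes \<open>W\<^sup>T H\<close> the positive semidefinite
  factor of a polar decomposition of \<open>H\<close>.
\<close>

lemma polar_rotation_exists:
  fixes H :: "real ^ 'd ^ 'd"
  obtains W where "orthogonal_matrix W" "transpose (transpose W ** H) = transpose W ** H"
    "\<And>v. v \<bullet> ((transpose W ** H) *v v) \<ge> 0"
proof -
  have "{W :: real ^ 'd ^ 'd. orthogonal_matrix W} \<noteq> {}" using orthogonal_matrix_id by blast
  moreover have "continuous_on {W. orthogonal_matrix W} (\<lambda>W. W \<bullet> H)" by (intro continuous_intros)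
  ultimately obtain W where W: "orthogonal_matrix W" "\<And>V. orthogonal_matrix V \<Longrightarrow> V \<bullet> H \<le> W \<bullet> H"
    using continuous_attains_sup[OF compact_orthogonal_matrices] by blast
  have "R \<bullet> (transpose W ** H) \<le> mat 1 \<bullet> (transpose W ** H)" if "orthogonal_matrix R" for R
    using W(2)[OF orthogonal_matrix_mul[OF W(1) that]]
    by (metis matrix_mul_rid matrix_mult_inner_left)
  from trace_maximal_imp_symmetric_psd[OF this] that[OF W(1)] show ?thesis by blast
qed

text \<open>
  The sum is the trace of the square of \<open>F\<^sup>T G\<close>, which is a squared Frobenius norm when this
  matrix is symmetric.
\<close>

lemma sum_inner_cross:
  fixes f g :: "nat \<Rightarrow> real ^ 'd"
  assumes sym: "\<And>a b. (\<Sum>i<n. f i $ a * g i $ b) = (\<Sum>i<n. f i $ b * g i $ a)"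
  shows "(\<Sum>i<n. \<Sum>j<n. (f i \<bullet> g j) * (g i \<bullet> f j)) \<ge> 0"
proof -
  have "(\<Sum>i<n. \<Sum>j<n. (f i \<bullet> g j) * (g i \<bullet> f j)) =
     (\<Sum>i<n. \<Sum>j<n. \<Sum>a\<in>UNIV. \<Sum>b\<in>UNIV. (f i $ a * g i $ b) * (f j $ b * g j $ a))"
    by (simp add: inner_vec_def sum_product mult_ac)
  also have "\<dots> = (\<Sum>i<n. \<Sum>a\<in>UNIV. \<Sum>j<n. \<Sum>b\<in>UNIV. (f i $ a * g i $ b) * (f j $ b * g j $ a))"
    by (intro sum.cong refl sum.swap)
  also have "\<dots> = (\<Sum>a\<in>UNIV. \<Sum>i<n. \<Sum>j<n. \<Sum>b\<in>UNIV. (f i $ a * g i $ b) * (f j $ b * g j $ a))"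
    by (rule sum.swap)
  also have "\<dots> = (\<Sum>a\<in>UNIV. \<Sum>i<n. \<Sum>b\<in>UNIV. \<Sum>j<n. (f i $ a * g i $ b) * (f j $ b * g j $ a))"
    by (intro sum.cong refl sum.swap)
  also have "\<dots> = (\<Sum>a\<in>UNIV. \<Sum>b\<in>UNIV. \<Sum>i<n. \<Sum>j<n. (f i $ a * g i $ b) * (f j $ b * g j $ a))"
    by (intro sum.cong refl sum.swap)
  also have "\<dots> = (\<Sum>a\<in>UNIV. \<Sum>b\<in>UNIV. (\<Sum>i<n. f i $ a * g i $ b)\<^sup>2)"
  proof (intro sum.cong refl)
    fix a b
    have "(\<Sum>j<n. f j $ b * g j $ a) = (\<Sum>i<n. f i $ a * g i $ b)" by (rule sym)
    then show "(\<Sum>i<n. \<Sum>j<n. (f i $ a * g i $ b) * (f j $ b * g j $ a)) = (\<Sum>i<n. f i $ a * g i $ b)\<^sup>2"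
      by (simp add: power2_eq_square flip: sum_product)
  qed
  also have "\<dots> \<ge> 0" by (intro sum_nonneg) auto
  finally show ?thesis .
qed

text \<open>
  In terms of \<open>D = X - Z\<close> the difference of the Gram matrices is \<open>Z D\<^sup>T + D Z\<^sup>T + D D\<^sup>T\<close>, of squared
  norm \<open>2 a + 2 s + 4 t + q\<close> with the sums \<open>a\<close>, \<open>s\<close>, \<open>t\<close>, \<open>q\<close> of the proof. The squared norm of
  \<open>D\<^sup>T D + \<beta> Z\<^sup>T D\<close> is \<open>q + 2 \<beta> t + \<beta>\<^sup>2 s\<close>, and \<open>t + a \<ge> 0\<close> because \<open>Z\<^sup>T X\<close> is positive
  semidefinite. For \<open>1 < \<beta>\<close> and \<open>\<beta>\<^sup>2 \<le> 2\<close> this leaves \<open>(2 \<beta> - 2) a\<close>; the proof takes \<open>\<beta> = 4 / 3\<close>.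
\<close>

lemma gram_difference_lower_bound:
  fixes X Z :: "nat \<Rightarrow> real ^ 'd"
  defines "D \<equiv> \<lambda>i. X i - Z i"
  assumes sym: "\<And>a b. (\<Sum>i<n. Z i $ a * X i $ b) = (\<Sum>i<n. Z i $ b * X i $ a)"
    and psd: "\<And>v. (\<Sum>i<n. (Z i \<bullet> v) * (X i \<bullet> v)) \<ge> 0"
  shows "2 / 3 * (\<Sum>i<n. \<Sum>j<n. (Z i \<bullet> D j)\<^sup>2) \<le> (\<Sum>i<n. \<Sum>j<n. (X i \<bullet> X j - Z i \<bullet> Z j)\<^sup>2)"
proof -
  define a where "a = (\<Sum>i<n. \<Sum>j<n. (Z i \<bullet> D j)\<^sup>2)"
  define q where "q = (\<Sum>i<n. \<Sum>j<n. (D i \<bullet> D j)\<^sup>2)"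
  define s where "s = (\<Sum>i<n. \<Sum>j<n. (Z i \<bullet> D j) * (D i \<bullet> Z j))"
  define t where "t = (\<Sum>i<n. \<Sum>j<n. (Z i \<bullet> D j) * (D i \<bullet> D j))"
  have a': "(\<Sum>i<n. \<Sum>j<n. (D i \<bullet> Z j)\<^sup>2) = a"
    unfolding a_def by (subst sum.swap) (simp add: inner_commute)
  have t': "(\<Sum>i<n. \<Sum>j<n. (D i \<bullet> Z j) * (D i \<bullet> D j)) = t"
    unfolding t_def by (subst sum.swap) (simp add: inner_commute)
  have symD: "(\<Sum>i<n. Z i $ a * D i $ b) = (\<Sum>i<n. Z i $ b * D i $ a)" for a b
    using sym[of a b] by (simp add: D_def algebra_simps sum_subtractf)
  have s0: "s \<ge> 0" unfolding s_def by (rule sum_inner_cross) (rule symD)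
  have "0 \<le> (\<Sum>i<n. \<Sum>j<n. ((D i + (4/3) *\<^sub>R Z i) \<bullet> D j) * (D i \<bullet> (D j + (4/3) *\<^sub>R Z j)))"
  proof (rule sum_inner_cross)
    fix a b
    have "(\<Sum>i<n. (D i + (4/3) *\<^sub>R Z i) $ a * D i $ b) =
      (\<Sum>i<n. D i $ a * D i $ b) + 4/3 * (\<Sum>i<n. Z i $ a * D i $ b)" for a b
      by (simp add: distrib_right sum.distrib sum_distrib_left mult.assoc)
    then show "(\<Sum>i<n. (D i + (4/3) *\<^sub>R Z i) $ a * D i $ b) = (\<Sum>i<n. (D i + (4/3) *\<^sub>R Z i) $ b * D i $ a)"
      using symD[of a b] by (simp add: mult.commute)
  qed
  also have "\<dots> = q + 4/3 * t + 4/3 * t + 16/9 * s"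
  proof -
    have "((D i + (4/3) *\<^sub>R Z i) \<bullet> D j) * (D i \<bullet> (D j + (4/3) *\<^sub>R Z j)) =
      (D i \<bullet> D j)\<^sup>2 + 4/3 * ((Z i \<bullet> D j) * (D i \<bullet> D j)) + 4/3 * ((D i \<bullet> Z j) * (D i \<bullet> D j))
      + 16/9 * ((Z i \<bullet> D j) * (D i \<bullet> Z j))" for i j
      by (simp add: inner_add_left inner_add_right power2_eq_square algebra_simps)
    then show ?thesis
      by (simp only: sum.distrib sum_distrib_left[symmetric] q_def[symmetric] s_def[symmetric] t_def[symmetric] t')
  qed
  finally have sq: "q + 8/3 * t + 16/9 * s \<ge> 0" by simp
  have "0 \<le> (\<Sum>j<n. \<Sum>i<n. (Z i \<bullet> D j) * (X i \<bullet> D j))" by (intro sum_nonneg psd)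
  also have "\<dots> = (\<Sum>i<n. \<Sum>j<n. (Z i \<bullet> D j) * (D i \<bullet> D j) + (Z i \<bullet> D j)\<^sup>2)"
    by (subst sum.swap) (simp add: D_def inner_diff_left power2_eq_square algebra_simps)
  also have "\<dots> = t + a" by (simp add: sum.distrib t_def a_def)
  finally have ta: "t + a \<ge> 0" .
  have "(X i \<bullet> X j - Z i \<bullet> Z j)\<^sup>2 = (Z i \<bullet> D j)\<^sup>2 + (D i \<bullet> Z j)\<^sup>2 + (D i \<bullet> D j)\<^sup>2
    + 2 * ((Z i \<bullet> D j) * (D i \<bullet> Z j)) + 2 * ((Z i \<bullet> D j) * (D i \<bullet> D j)) + 2 * ((D i \<bullet> Z j) * (D i \<bullet> D j))" for i j
  proof -
    have "X i \<bullet> X j - Z i \<bullet> Z j = Z i \<bullet> D j + D i \<bullet> Z j + D i \<bullet> D j"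
      by (simp add: D_def inner_diff_left inner_diff_right)
    then show ?thesis by (simp add: power2_eq_square algebra_simps)
  qed
  then have "(\<Sum>i<n. \<Sum>j<n. (X i \<bullet> X j - Z i \<bullet> Z j)\<^sup>2) = a + a + q + 2 * s + 2 * t + 2 * t"
    by (simp add: sum.distrib a_def[symmetric] a' q_def[symmetric] s_def[symmetric] t_def[symmetric] t'
        flip: sum_distrib_left)
  then show ?thesis unfolding a_def[symmetric] using sq ta s0 by linarith
qed

text \<open>
  The rotation that aligns \<open>X0\<close> best with \<open>X\<close> leaves the Gram matrix of \<open>X0\<close> unchanged and puts the
  pair into the position of the previous lemma.
\<close>

lemma procrustes_bound:
  fixes X X0 :: "nat \<Rightarrow> real ^ 'd"
  assumes m: "\<And>v. m * (norm v)\<^sup>2 \<le> (\<Sum>i<n. (X0 i \<bullet> v)\<^sup>2)"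
  obtains W where "orthogonal_matrix W"
    "2 / 3 * m * (\<Sum>i<n. (norm (X i - X0 i v* W))\<^sup>2) \<le> (\<Sum>i<n. \<Sum>j<n. (gram X i j - gram X0 i j)\<^sup>2)"
proof -
  define H where "H = (\<chi> a b. \<Sum>i<n. X0 i $ a * X i $ b)"
  obtain W where W: "orthogonal_matrix W" "transpose (transpose W ** H) = transpose W ** H"
    "\<And>v. v \<bullet> ((transpose W ** H) *v v) \<ge> 0" using polar_rotation_exists by blast
  define Z where "Z = (\<lambda>i. X0 i v* W)"
  have Zc: "(transpose W ** H) $ a $ b = (\<Sum>i<n. Z i $ a * X i $ b)" for a b
  proof -
    have "(transpose W ** H) $ a $ b = (\<Sum>k\<in>UNIV. \<Sum>i<n. W $ k $ a * (X0 i $ k * X i $ b))"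
      by (simp add: matrix_matrix_mult_def transpose_def H_def sum_distrib_left)
    also have "\<dots> = (\<Sum>i<n. \<Sum>k\<in>UNIV. W $ k $ a * (X0 i $ k * X i $ b))" by (rule sum.swap)
    also have "\<dots> = (\<Sum>i<n. Z i $ a * X i $ b)"
      by (simp add: Z_def vector_matrix_mult_def sum_distrib_right mult.assoc mult.left_commute)
    finally show ?thesis .
  qed
  have sym: "(\<Sum>i<n. Z i $ a * X i $ b) = (\<Sum>i<n. Z i $ b * X i $ a)" for a b
  proof -
    have "transpose A $ a $ b = A $ b $ a" for A :: "real ^ 'd ^ 'd" by (simp add: transpose_def)
    from this[of "transpose W ** H"] show ?thesis unfolding W(2) Zc .
  qed
  have psd: "(\<Sum>i<n. (Z i \<bullet> v) * (X i \<bullet> v)) \<ge> 0" for v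
  proof -
    have "v \<bullet> ((transpose W ** H) *v v) = (\<Sum>a\<in>UNIV. \<Sum>b\<in>UNIV. \<Sum>i<n. (Z i $ a * v $ a) * (X i $ b * v $ b))"
      by (simp add: inner_vec_def matrix_vector_mult_def Zc sum_distrib_left sum_distrib_right mult_ac)
    also have "\<dots> = (\<Sum>i<n. \<Sum>a\<in>UNIV. \<Sum>b\<in>UNIV. (Z i $ a * v $ a) * (X i $ b * v $ b))"
      by (simp only: sum.swap[of _ "{..<n}" UNIV])
    also have "\<dots> = (\<Sum>i<n. (Z i \<bullet> v) * (X i \<bullet> v))"
      by (simp add: inner_vec_def sum_product)
    finally show ?thesis using W(3)[of v] by simp
  qed
  have WW: "transpose W ** W = mat 1" "W ** transpose W = mat 1"
    using W(1) by (auto simp: orthogonal_matrix_def)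
  have ZZ: "Z i \<bullet> Z j = X0 i \<bullet> X0 j" for i j
    unfolding Z_def by (metis WW(2) dot_lmul_matrix matrix_vector_mul_assoc matrix_vector_mul_lid transpose_matrix_vector)
  have nW: "norm (W *v v) = norm v" for v
    using W(1) by (metis WW(1) dot_lmul_matrix matrix_vector_mul_assoc matrix_vector_mul_lid norm_eq transpose_matrix_vector transpose_transpose)
  have "m * (\<Sum>j<n. (norm (X j - Z j))\<^sup>2) \<le> (\<Sum>j<n. \<Sum>i<n. (X0 i \<bullet> (W *v (X j - Z j)))\<^sup>2)"
    unfolding sum_distrib_left using m by (intro sum_mono) (metis nW)
  also have "\<dots> = (\<Sum>i<n. \<Sum>j<n. (Z i \<bullet> (X j - Z j))\<^sup>2)"
    by (subst sum.swap) (simp add: Z_def dot_lmul_matrix)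
  finally have "2 / 3 * m * (\<Sum>j<n. (norm (X j - Z j))\<^sup>2) \<le> 2 / 3 * (\<Sum>i<n. \<Sum>j<n. (Z i \<bullet> (X j - Z j))\<^sup>2)"
    by simp
  also have "\<dots> \<le> (\<Sum>i<n. \<Sum>j<n. (X i \<bullet> X j - Z i \<bullet> Z j)\<^sup>2)"
    by (rule gram_difference_lower_bound) (auto intro: sym psd)
  also have "\<dots> = (\<Sum>i<n. \<Sum>j<n. (gram X i j - gram X0 i j)\<^sup>2)" by (simp add: ZZ gram_def)
  finally show ?thesis using W(1) by (intro that[of W]) (auto simp: Z_def)
qed

section \<open>Leading eigenvectors of a perturbed Gram matrix\<close>

lemma bessel_identity:
  fixes u :: "'k \<Rightarrow> nat \<Rightarrow> real" and w :: "nat \<Rightarrow> real"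
  assumes S: "finite S"
    and on: "\<And>k m. k \<in> S \<Longrightarrow> m \<in> S \<Longrightarrow> (\<Sum>i<n. u k i * u m i) = (if k = m then 1 else 0)"
  defines "\<alpha> \<equiv> \<lambda>k. \<Sum>i<n. w i * u k i"
  shows "(\<Sum>j<n. (w j - (\<Sum>k\<in>S. \<alpha> k * u k j))\<^sup>2) = (\<Sum>j<n. (w j)\<^sup>2) - (\<Sum>k\<in>S. (\<alpha> k)\<^sup>2)"
proof -
  have cross: "(\<Sum>j<n. w j * (\<Sum>k\<in>S. \<alpha> k * u k j)) = (\<Sum>k\<in>S. (\<alpha> k)\<^sup>2)"
  proof -
    have "(\<Sum>j<n. w j * (\<Sum>k\<in>S. \<alpha> k * u k j)) = (\<Sum>k\<in>S. \<Sum>j<n. \<alpha> k * (w j * u k j))"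
      by (subst sum.swap) (simp add: sum_distrib_left mult_ac)
    also have "\<dots> = (\<Sum>k\<in>S. \<alpha> k * \<alpha> k)" by (simp only: sum_distrib_left[symmetric] \<alpha>_def)
    finally show ?thesis by (simp add: power2_eq_square)
  qed
  have sq: "(\<Sum>j<n. (\<Sum>k\<in>S. \<alpha> k * u k j)\<^sup>2) = (\<Sum>k\<in>S. (\<alpha> k)\<^sup>2)"
  proof -
    have "(\<Sum>j<n. (\<Sum>k\<in>S. \<alpha> k * u k j)\<^sup>2) = (\<Sum>j<n. \<Sum>k\<in>S. \<Sum>m\<in>S. \<alpha> k * \<alpha> m * (u k j * u m j))"
      by (simp add: power2_eq_square sum_product mult_ac)
    also have "\<dots> = (\<Sum>k\<in>S. \<Sum>j<n. \<Sum>m\<in>S. \<alpha> k * \<alpha> m * (u k j * u m j))" by (rule sum.swap)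
    also have "\<dots> = (\<Sum>k\<in>S. \<Sum>m\<in>S. \<Sum>j<n. \<alpha> k * \<alpha> m * (u k j * u m j))"
      by (intro sum.cong refl sum.swap)
    also have "\<dots> = (\<Sum>k\<in>S. \<Sum>m\<in>S. \<alpha> k * \<alpha> m * (if k = m then 1 else 0))"
      by (intro sum.cong refl) (simp only: sum_distrib_left[symmetric] on)
    also have "\<dots> = (\<Sum>k\<in>S. (\<alpha> k)\<^sup>2)"
      using S by (simp add: if_distrib sum.delta power2_eq_square cong: if_cong)
    finally show ?thesis .
  qed
  have "(\<Sum>j<n. (w j - (\<Sum>k\<in>S. \<alpha> k * u k j))\<^sup>2) =
      (\<Sum>j<n. (w j)\<^sup>2) + (\<Sum>j<n. (\<Sum>k\<in>S. \<alpha> k * u k j)\<^sup>2) - 2 * (\<Sum>j<n. w j * (\<Sum>k\<in>S. \<alpha> k * u k j))"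
    by (simp add: power2_diff sum_subtractf sum.distrib mult.assoc flip: sum_distrib_left)
  then show ?thesis unfolding cross sq by simp
qed

lemma bessel_inequality:
  fixes u :: "'k \<Rightarrow> nat \<Rightarrow> real" and w :: "nat \<Rightarrow> real"
  assumes "finite S"
    and "\<And>k m. k \<in> S \<Longrightarrow> m \<in> S \<Longrightarrow> (\<Sum>i<n. u k i * u m i) = (if k = m then 1 else 0)"
  shows "(\<Sum>k\<in>S. (\<Sum>i<n. w i * u k i)\<^sup>2) \<le> (\<Sum>j<n. (w j)\<^sup>2)"
proof -
  have "0 \<le> (\<Sum>j<n. (w j - (\<Sum>k\<in>S. (\<Sum>i<n. w i * u k i) * u k j))\<^sup>2)" by (intro sum_nonneg) auto
  then show ?thesis using bessel_identity[OF assms, where w = w] by simp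
qed

text \<open>
  By Bessel's identity the \<open>i\<close>-th standard basis vector has squared distance
  \<open>1 - (\<Sum>k<n. (u k i)\<^sup>2)\<close> from the span. These numbers are nonnegative and add up to \<open>n - n\<close>, so all of them
  vanish.
\<close>

lemma orthonormal_basis_complete:
  fixes u :: "nat \<Rightarrow> nat \<Rightarrow> real" and w :: "nat \<Rightarrow> real"
  assumes on: "\<And>k m. k < n \<Longrightarrow> m < n \<Longrightarrow> (\<Sum>i<n. u k i * u m i) = (if k = m then 1 else 0)"
  shows "j < n \<Longrightarrow> (\<Sum>k<n. (\<Sum>i<n. w i * u k i) * u k j) = w j"
    and "(\<Sum>k<n. (\<Sum>i<n. w i * u k i)\<^sup>2) = (\<Sum>j<n. (w j)\<^sup>2)"
proof -
  have on': "(\<Sum>i<n. u k i * u m i) = (if k = m then 1 else 0)" if "k \<in> {..<n}" "m \<in> {..<n}" for k m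
    using on that by auto
  define e :: "nat \<Rightarrow> nat \<Rightarrow> real" where "e = (\<lambda>i j. if j = i then 1 else 0)"
  have coef: "(\<Sum>j<n. e i j * u k j) = u k i" if "i < n" for i k
    using that by (simp add: e_def if_distrib[of "\<lambda>x. x * _"] sum.delta cong: if_cong)
  define R where "R = (\<lambda>i. \<Sum>j<n. (e i j - (\<Sum>k<n. u k i * u k j))\<^sup>2)"
  have R: "R i = 1 - (\<Sum>k<n. (u k i)\<^sup>2)" if "i < n" for i
  proof -
    have "(\<Sum>j<n. (e i j)\<^sup>2) = 1"
      using that by (simp add: e_def if_distrib[of "\<lambda>x. x\<^sup>2"] sum.delta cong: if_cong)
    then show ?thesis
      using bessel_identity[where S = "{..<n}" and n = n and u = u and w = "e i", OF finite_lessThan on'] that by (simp add: R_def coef)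
  qed
  have "(\<Sum>i<n. R i) = real n - (\<Sum>i<n. \<Sum>k<n. u k i * u k i)"
    by (simp add: R sum_subtractf power2_eq_square)
  also have "(\<Sum>i<n. \<Sum>k<n. u k i * u k i) = (\<Sum>k<n. \<Sum>i<n. u k i * u k i)" by (rule sum.swap)
  also have "real n - (\<Sum>k<n. \<Sum>i<n. u k i * u k i) = 0" by (simp add: on)
  finally have "R i = 0" if "i < n" for i
    using that by (subst (asm) sum_nonneg_eq_0_iff) (auto simp: R_def intro!: sum_nonneg)
  then have "(e i j - (\<Sum>k<n. u k i * u k j))\<^sup>2 = 0" if "i < n" "j < n" for i j
    using that unfolding R_def by (subst (asm) sum_nonneg_eq_0_iff) auto
  then have e: "(\<Sum>k<n. u k i * u k j) = e i j" if "i < n" "j < n" for i j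
    using that by simp
  have *: "(\<Sum>k<n. (\<Sum>i<n. w i * u k i) * u k j) = w j" if "j < n" for j
  proof -
    have "(\<Sum>k<n. (\<Sum>i<n. w i * u k i) * u k j) = (\<Sum>i<n. w i * (\<Sum>k<n. u k i * u k j))"
      unfolding sum_distrib_left sum_distrib_right by (subst sum.swap) (simp add: mult_ac)
    also have "\<dots> = (\<Sum>i<n. w i * e i j)" using that by (simp add: e)
    also have "\<dots> = w j"
      using that by (simp add: e_def if_distrib sum.delta cong: if_cong)
    finally show ?thesis .
  qed
  then show "j < n \<Longrightarrow> (\<Sum>k<n. (\<Sum>i<n. w i * u k i) * u k j) = w j" .
  show "(\<Sum>k<n. (\<Sum>i<n. w i * u k i)\<^sup>2) = (\<Sum>j<n. (w j)\<^sup>2)"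
    using bessel_identity[where S = "{..<n}" and n = n and u = u and w = w, OF finite_lessThan on'] * by simp
qed

lemma quadratic_form_frobenius_le:
  fixes E :: "nat \<Rightarrow> nat \<Rightarrow> real" and w :: "nat \<Rightarrow> real"
  assumes "(\<Sum>i<n. \<Sum>j<n. (E i j)\<^sup>2) \<le> \<epsilon>\<^sup>2" "\<epsilon> \<ge> 0"
  shows "\<bar>\<Sum>i<n. \<Sum>j<n. E i j * (w i * w j)\<bar> \<le> \<epsilon> * (\<Sum>i<n. (w i)\<^sup>2)"
proof -
  have "(\<Sum>i<n. \<Sum>j<n. E i j * (w i * w j))\<^sup>2 \<le>
     (\<Sum>i<n. \<Sum>j<n. (E i j)\<^sup>2) * (\<Sum>i<n. \<Sum>j<n. (w i * w j)\<^sup>2)"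
    using Cauchy_Schwarz_ineq_sum[of "\<lambda>(i, j). E i j" "\<lambda>(i, j). w i * w j" "{..<n} \<times> {..<n}"]
    by (simp add: sum.cartesian_product case_prod_unfold)
  also have "\<dots> \<le> \<epsilon>\<^sup>2 * (\<Sum>i<n. \<Sum>j<n. (w i * w j)\<^sup>2)"
    using assms by (intro mult_right_mono sum_nonneg) auto
  also have "(\<Sum>i<n. \<Sum>j<n. (w i * w j)\<^sup>2) = (\<Sum>i<n. (w i)\<^sup>2)\<^sup>2"
    by (simp add: power2_eq_square sum_product mult_ac)
  finally have "(\<Sum>i<n. \<Sum>j<n. E i j * (w i * w j))\<^sup>2 \<le> (\<epsilon> * (\<Sum>i<n. (w i)\<^sup>2))\<^sup>2"
    by (simp add: power_mult_distrib)
  then have "\<bar>\<Sum>i<n. \<Sum>j<n. E i j * (w i * w j)\<bar> \<le> \<bar>\<epsilon> * (\<Sum>i<n. (w i)\<^sup>2)\<bar>"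
    by (simp only: abs_le_square_iff)
  also have "\<dots> = \<epsilon> * (\<Sum>i<n. (w i)\<^sup>2)" using assms(2) by (simp add: sum_nonneg)
  finally show ?thesis .
qed

text \<open>
  The matrices \<open>X X\<^sup>T\<close> and \<open>X\<^sup>T X\<close> have the same nonzero eigenvalues, and the former only has these on
  the range of \<open>X\<close>.
\<close>

lemma gram_quadratic_form_range_ge:
  fixes X :: "nat \<Rightarrow> real ^ 'd"
  assumes m: "m * (norm v)\<^sup>2 \<le> (\<Sum>i<n. (X i \<bullet> v)\<^sup>2)" and m0: "m > 0" and v: "v \<noteq> 0"
  defines "w \<equiv> \<lambda>i. X i \<bullet> v"
  shows "m * (\<Sum>i<n. (w i)\<^sup>2) \<le> (\<Sum>i<n. \<Sum>j<n. gram X i j * (w i * w j))"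
proof -
  define g where "g = (\<Sum>i<n. w i *\<^sub>R X i)"
  define q where "q = (\<Sum>i<n. (w i)\<^sup>2)"
  have g_left: "g \<bullet> y = (\<Sum>i<n. w i * (X i \<bullet> y))" for y by (simp add: g_def inner_sum_left)
  have g_right: "X i \<bullet> g = (\<Sum>j<n. w j * (X i \<bullet> X j))" for i by (simp add: g_def inner_sum_right)
  have gg: "(\<Sum>i<n. \<Sum>j<n. gram X i j * (w i * w j)) = (norm g)\<^sup>2"
    unfolding power2_norm_eq_inner g_left[of g] g_right
    by (simp add: sum_distrib_left gram_def mult_ac)
  have "q = g \<bullet> v" by (simp add: q_def g_def inner_sum_left w_def power2_eq_square)
  then have "q \<le> norm g * norm v" using norm_cauchy_schwarz[of g v] by simp
  moreover have "m * (norm v)\<^sup>2 \<le> q" using m by (simp add: q_def w_def)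
  moreover have "0 < m * (norm v)\<^sup>2" using m0 v by simp
  ultimately have q0: "q > 0" and "q\<^sup>2 \<le> (norm g * norm v)\<^sup>2" by (auto intro!: power_mono)
  then have "m * (q * q) \<le> (norm g)\<^sup>2 * (m * (norm v)\<^sup>2)"
    using m0 by (simp add: power2_eq_square mult_ac)
  also have "\<dots> \<le> (norm g)\<^sup>2 * q" using \<open>m * (norm v)\<^sup>2 \<le> q\<close> by (intro mult_left_mono) auto
  finally have "(m * q) * q \<le> (norm g)\<^sup>2 * q" by (simp add: mult_ac)
  then have "m * q \<le> (norm g)\<^sup>2" using q0 by simp
  then show ?thesis by (simp add: gg q_def)
qed

lemma exists_orthogonal_to_all_but_one:
  fixes f :: "'d \<Rightarrow> real ^ 'd" and a0 :: 'd
  shows "\<exists>v. v \<noteq> 0 \<and> (\<forall>a. a \<noteq> a0 \<longrightarrow> f a \<bullet> v = 0)"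
proof (rule ccontr)
  assume neg: "\<not> ?thesis"
  define T :: "real ^ 'd \<Rightarrow> real ^ 'd" where "T = (\<lambda>v. \<chi> a. if a = a0 then 0 else f a \<bullet> v)"
  have lin: "linear T"
    by (rule linearI) (auto simp: T_def vec_eq_iff inner_add_right)
  have "v = 0" if "T v = 0" for v
  proof (rule ccontr)
    assume "v \<noteq> 0"
    moreover have "f a \<bullet> v = 0" if "a \<noteq> a0" for a
    proof -
      have "T v $ a = 0" using \<open>T v = 0\<close> by simp
      then show ?thesis using that by (simp add: T_def)
    qed
    ultimately show False using neg by blast
  qed
  then have "inj T" using lin linear_injective_0 by blast
  then have "surj T" using lin linear_inj_imp_surj by blast
  then obtain v where "T v = axis a0 1" by (metis surjD)
  then have "T v $ a0 = 1" by simp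
  then show False by (simp add: T_def)
qed

text \<open>
  The range of \<open>X0\<close> has dimension \<open>d\<close>, so it contains a vector orthogonal to the first \<open>d - 1\<close>
  eigenvectors of \<open>P\<close>; its Rayleigh quotient shows that the \<open>d\<close>-th eigenvalue is at least \<open>m - \<epsilon>\<close>. An
  eigenvector \<open>u\<close> with eigenvalue \<open>l\<close> is \<open>P u / l\<close>, which differs from the element \<open>X0 X0\<^sup>T u / l\<close> of the
  range by \<open>(P - X0 X0\<^sup>T) u / l\<close>. Bessel's inequality sums these errors over the orthonormal \<open>u\<close>
  without a factor \<open>d\<close>.
\<close>

lemma top_eigenvectors_close_to_range:
  fixes X0 U :: "nat \<Rightarrow> real ^ 'd"
  assumes m: "\<And>v. m * (norm v)\<^sup>2 \<le> (\<Sum>i<n. (X0 i \<bullet> v)\<^sup>2)" and m0: "m > 0"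
    and E: "(\<Sum>i<n. \<Sum>j<n. (P i j - gram X0 i j)\<^sup>2) \<le> \<epsilon>\<^sup>2" and \<epsilon>: "0 \<le> \<epsilon>" "\<epsilon> < m"
    and top: "top_eigenvectors n P U"
  shows "orthonormal_columns n U"
    and "\<exists>B. (\<Sum>i<n. (norm (U i - X0 i v* B))\<^sup>2) \<le> (\<epsilon> / (m - \<epsilon>))\<^sup>2"
proof -
  let ?d = "CARD('d)"
  from top obtain u l and e :: "'d \<Rightarrow> nat" where dn: "?d \<le> n"
    and "\<forall>k<n. \<forall>i<n. (\<Sum>j<n. P i j * u k j) = l k * u k i"
      "\<forall>k<n. \<forall>m<n. (\<Sum>i<n. u k i * u m i) = (if k = m then 1 else 0)"
      "\<forall>k m. k \<le> m \<and> m < n \<longrightarrow> l m \<le> l k"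
    and e: "bij_betw e UNIV {..<?d}" and "\<forall>i<n. \<forall>a. U i $ a = u (e a) i"
    unfolding top_eigenvectors_def by (elim conjE exE) (rule that)
  then have eig: "\<And>k i. k < n \<Longrightarrow> i < n \<Longrightarrow> (\<Sum>j<n. P i j * u k j) = l k * u k i"
    and on: "\<And>k m. k < n \<Longrightarrow> m < n \<Longrightarrow> (\<Sum>i<n. u k i * u m i) = (if k = m then 1 else 0)"
    and dec: "\<And>k m. k \<le> m \<Longrightarrow> m < n \<Longrightarrow> l m \<le> l k"
    and U: "\<And>i a. i < n \<Longrightarrow> U i $ a = u (e a) i"
    by simp_all
  have d0: "?d > 0" by simp
  have ran: "range e = {..<?d}" using e by (simp add: bij_betw_def)
  have ed1: "e a < ?d" for a using ran by blast
  have ed: "e a < ?d" "e a < n" for a using ed1[of a] dn by simp_all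
  have einj: "e a = e b \<longleftrightarrow> a = b" for a b using e by (auto simp: bij_betw_def inj_on_def)
  have onU: "(\<Sum>i<n. u (e a) i * u (e b) i) = (if a = b then 1 else 0)" for a b
    using on[OF ed(2) ed(2)] einj by simp
  then show "orthonormal_columns n U"
    unfolding orthonormal_columns_def by (simp add: U)
  have "?d - 1 \<in> range e" using ran d0 by simp
  then obtain a0 where a0: "e a0 = ?d - 1" by auto
  obtain v where v: "v \<noteq> 0" "\<And>a. a \<noteq> a0 \<Longrightarrow> (\<Sum>i<n. u (e a) i *\<^sub>R X0 i) \<bullet> v = 0"
    using exists_orthogonal_to_all_but_one[of a0 "\<lambda>a. \<Sum>i<n. u (e a) i *\<^sub>R X0 i"] by blast
  define w where "w = (\<lambda>i. X0 i \<bullet> v)"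
  define \<alpha> where "\<alpha> = (\<lambda>k. \<Sum>i<n. w i * u k i)"
  have \<alpha>0: "\<alpha> k = 0" if "k < ?d - 1" for k
  proof -
    have "k \<in> range e" using ran that by simp
    then obtain a where "k = e a" by auto
    moreover have "a \<noteq> a0" using that a0 \<open>k = e a\<close> by auto
    ultimately show ?thesis using v(2)[of a] by (simp add: \<alpha>_def w_def inner_sum_left mult.commute)
  qed
  define q where "q = (\<Sum>i<n. (w i)\<^sup>2)"
  have q0: "q > 0"
  proof -
    have "0 < m * (norm v)\<^sup>2" using m0 v(1) by simp
    then show ?thesis using m[of v] by (simp add: q_def w_def)
  qed
  have \<alpha>q: "(\<Sum>k<n. (\<alpha> k)\<^sup>2) = q" unfolding \<alpha>_def q_def by (rule orthonormal_basis_complete(2)[OF on])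
  have Pw: "(\<Sum>i<n. \<Sum>j<n. P i j * (w i * w j)) = (\<Sum>k<n. l k * (\<alpha> k)\<^sup>2)"
  proof -
    have "(\<Sum>j<n. P i j * w j) = (\<Sum>k<n. \<alpha> k * (l k * u k i))" if "i < n" for i
    proof -
      have "(\<Sum>j<n. P i j * w j) = (\<Sum>j<n. P i j * (\<Sum>k<n. \<alpha> k * u k j))"
        unfolding \<alpha>_def by (intro sum.cong refl) (simp add: orthonormal_basis_complete(1)[OF on])
      also have "\<dots> = (\<Sum>k<n. \<alpha> k * (\<Sum>j<n. P i j * u k j))"
        unfolding sum_distrib_left by (subst sum.swap) (simp add: mult_ac)
      finally show ?thesis using that by (simp add: eig)
    qed
    then have "(\<Sum>i<n. \<Sum>j<n. P i j * (w i * w j)) = (\<Sum>i<n. w i * (\<Sum>k<n. \<alpha> k * (l k * u k i)))"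
      by (intro sum.cong refl) (simp add: sum_distrib_left[symmetric] mult.left_commute[of _ "w _"])
    also have "\<dots> = (\<Sum>k<n. l k * \<alpha> k * (\<Sum>i<n. w i * u k i))"
      unfolding sum_distrib_left by (subst sum.swap) (simp add: mult_ac)
    finally show ?thesis by (simp add: \<alpha>_def power2_eq_square mult.assoc)
  qed
  also have "\<dots> \<le> (\<Sum>k<n. l (?d - 1) * (\<alpha> k)\<^sup>2)"
  proof (intro sum_mono)
    fix k assume "k \<in> {..<n}"
    then show "l k * (\<alpha> k)\<^sup>2 \<le> l (?d - 1) * (\<alpha> k)\<^sup>2"
      using \<alpha>0[of k] dec[of "?d - 1" k] by (cases "k < ?d - 1") (auto intro: mult_right_mono)
  qed
  also have "\<dots> = l (?d - 1) * q" by (simp add: \<alpha>q flip: sum_distrib_left)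
  finally have up: "(\<Sum>i<n. \<Sum>j<n. P i j * (w i * w j)) \<le> l (?d - 1) * q" .
  have "m * q \<le> (\<Sum>i<n. \<Sum>j<n. gram X0 i j * (w i * w j))"
    unfolding q_def w_def by (rule gram_quadratic_form_range_ge[OF m m0 v(1)])
  moreover have "\<bar>\<Sum>i<n. \<Sum>j<n. (P i j - gram X0 i j) * (w i * w j)\<bar> \<le> \<epsilon> * q"
    unfolding q_def by (rule quadratic_form_frobenius_le[OF E \<epsilon>(1)])
  ultimately have "(m - \<epsilon>) * q \<le> l (?d - 1) * q"
    using up by (simp add: left_diff_distrib sum_subtractf)
  then have ld: "m - \<epsilon> \<le> l (?d - 1)" using q0 by simp
  have le: "m - \<epsilon> \<le> l (e a)" for a
    using ld dec[of "e a" "?d - 1"] ed(1)[of a] dn d0 by linarith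
  have me: "m - \<epsilon> > 0" using \<epsilon> by simp
  define B :: "real ^ 'd ^ 'd" where
    "B = (\<chi> k a. ((1 / l (e a)) *\<^sub>R (\<Sum>j<n. u (e a) j *\<^sub>R X0 j)) $ k)"
  have XB: "(x v* B) $ a = (1 / l (e a)) * (\<Sum>j<n. (x \<bullet> X0 j) * u (e a) j)" for x a
  proof -
    have "(x v* B) $ a = x \<bullet> ((1 / l (e a)) *\<^sub>R (\<Sum>j<n. u (e a) j *\<^sub>R X0 j))"
      by (simp add: vector_matrix_mult_def B_def inner_vec_def mult.commute)
    then show ?thesis by (simp add: inner_sum_right mult.commute)
  qed
  have comp: "(U i - X0 i v* B) $ a = (1 / l (e a)) * (\<Sum>j<n. (P i j - gram X0 i j) * u (e a) j)"
    if "i < n" for i a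
  proof -
    have "l (e a) \<noteq> 0" using le[of a] me by simp
    then have "u (e a) i = (1 / l (e a)) * (\<Sum>j<n. P i j * u (e a) j)"
      using eig[OF ed(2) that] by simp
    then show ?thesis
      by (simp add: U[OF that] XB gram_def left_diff_distrib sum_subtractf right_diff_distrib diff_divide_distrib)
  qed
  have row: "(norm (U i - X0 i v* B))\<^sup>2 \<le> (1 / (m - \<epsilon>))\<^sup>2 * (\<Sum>j<n. (P i j - gram X0 i j)\<^sup>2)" if "i < n" for i
  proof -
    have "(norm (U i - X0 i v* B))\<^sup>2 = (\<Sum>a\<in>UNIV. ((U i - X0 i v* B) $ a)\<^sup>2)"
      by (simp add: norm_vec_def L2_set_def sum_nonneg)
    also have "\<dots> \<le> (\<Sum>a\<in>UNIV. (1 / (m - \<epsilon>))\<^sup>2 * (\<Sum>j<n. (P i j - gram X0 i j) * u (e a) j)\<^sup>2)"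
      unfolding comp[OF that] power_mult_distrib
      using le me by (intro sum_mono mult_right_mono power_mono divide_left_mono)
        (auto intro!: mult_pos_pos simp: less_le_trans[OF me le] less_imp_le)
    also have "\<dots> = (1 / (m - \<epsilon>))\<^sup>2 * (\<Sum>a\<in>UNIV. (\<Sum>j<n. (P i j - gram X0 i j) * u (e a) j)\<^sup>2)"
      by (simp only: sum_distrib_left)
    also have "\<dots> \<le> (1 / (m - \<epsilon>))\<^sup>2 * (\<Sum>j<n. (P i j - gram X0 i j)\<^sup>2)"
      by (intro mult_left_mono bessel_inequality) (auto simp: onU)
    finally show ?thesis .
  qed
  have "(\<Sum>i<n. (norm (U i - X0 i v* B))\<^sup>2) \<le> (\<Sum>i<n. (1 / (m - \<epsilon>))\<^sup>2 * (\<Sum>j<n. (P i j - gram X0 i j)\<^sup>2))"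
    using row by (intro sum_mono) auto
  also have "\<dots> = (1 / (m - \<epsilon>))\<^sup>2 * (\<Sum>i<n. \<Sum>j<n. (P i j - gram X0 i j)\<^sup>2)"
    by (simp only: sum_distrib_left)
  also have "\<dots> \<le> (1 / (m - \<epsilon>))\<^sup>2 * \<epsilon>\<^sup>2" using E by (intro mult_left_mono) auto
  also have "\<dots> = (\<epsilon> / (m - \<epsilon>))\<^sup>2" by (simp add: power_divide)
  finally show "\<exists>B. (\<Sum>i<n. (norm (U i - X0 i v* B))\<^sup>2) \<le> (\<epsilon> / (m - \<epsilon>))\<^sup>2" by blast
qed

text \<open>
  Since \<open>X B\<close> is nearly orthonormal and \<open>X\<close> has operator norm at most \<open>sqrt n\<close>, the square matrix \<open>B\<close>
  shrinks by at most \<open>2 * sqrt n\<close>. Duality carries this over to its transpose, which is what acts on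
  the rows.
\<close>

lemma near_orthonormal_expands:
  fixes X U :: "nat \<Rightarrow> real ^ 'd"
  assumes X: "\<And>i. i < n \<Longrightarrow> norm (X i) \<le> 1" and U: "orthonormal_columns n U"
    and B: "(\<Sum>i<n. (norm (U i - X i v* B))\<^sup>2) \<le> (1 / 2)\<^sup>2"
  shows "norm y \<le> 2 * sqrt (real n) * norm (y v* B)"
proof -
  have expand: "norm v \<le> 2 * sqrt (real n) * norm (B *v v)" for v
  proof -
    have Uv: "L2_set (\<lambda>i. U i \<bullet> v) {..<n} = norm v"
    proof -
      have "(\<Sum>i<n. (U i \<bullet> v)\<^sup>2) = (\<Sum>i<n. \<Sum>a\<in>UNIV. \<Sum>b\<in>UNIV. v $ a * v $ b * (U i $ a * U i $ b))"
        by (simp add: inner_vec_def power2_eq_square sum_product mult_ac)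
      also have "\<dots> = (\<Sum>a\<in>UNIV. \<Sum>b\<in>UNIV. \<Sum>i<n. v $ a * v $ b * (U i $ a * U i $ b))"
        by (simp only: sum.swap[of _ UNIV "{..<n}"])
      also have "\<dots> = (\<Sum>a\<in>UNIV. \<Sum>b\<in>UNIV. v $ a * v $ b * (if a = b then 1 else 0))"
        using U unfolding orthonormal_columns_def by (simp only: sum_distrib_left[symmetric])
      also have "\<dots> = (\<Sum>a\<in>UNIV. (v $ a)\<^sup>2)"
        by (simp add: if_distrib sum.delta power2_eq_square cong: if_cong)
      finally show ?thesis by (simp add: L2_set_def norm_vec_def)
    qed
    have "L2_set (\<lambda>i. (U i - X i v* B) \<bullet> v) {..<n} \<le> L2_set (\<lambda>i. norm (U i - X i v* B) * norm v) {..<n}"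
      unfolding L2_set_def
      by (intro real_sqrt_le_mono sum_mono) (simp add: abs_le_square_iff[symmetric] Cauchy_Schwarz_ineq2)
    also have "\<dots> = L2_set (\<lambda>i. norm (U i - X i v* B)) {..<n} * norm v"
      by (rule L2_set_left_distrib[symmetric]) simp
    also have "\<dots> \<le> 1 / 2 * norm v"
      using real_sqrt_le_mono[OF B] unfolding L2_set_def real_sqrt_abs by (intro mult_right_mono) auto
    finally have 1: "L2_set (\<lambda>i. (U i - X i v* B) \<bullet> v) {..<n} \<le> 1 / 2 * norm v" .
    have "(\<Sum>i<n. ((X i v* B) \<bullet> v)\<^sup>2) \<le> (\<Sum>i<n. (norm (B *v v))\<^sup>2)"
    proof (intro sum_mono)
      fix i assume "i \<in> {..<n}"
      have "\<bar>X i \<bullet> (B *v v)\<bar> \<le> norm (X i) * norm (B *v v)" by (rule Cauchy_Schwarz_ineq2)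
      also have "\<dots> \<le> 1 * norm (B *v v)" using X \<open>i \<in> {..<n}\<close> by (intro mult_right_mono) auto
      finally show "((X i v* B) \<bullet> v)\<^sup>2 \<le> (norm (B *v v))\<^sup>2"
        by (simp add: dot_lmul_matrix abs_le_square_iff[symmetric])
    qed
    then have 2: "L2_set (\<lambda>i. (X i v* B) \<bullet> v) {..<n} \<le> sqrt (real n) * norm (B *v v)"
      using real_sqrt_le_mono by (fastforce simp: L2_set_def real_sqrt_mult)
    have "norm v = L2_set (\<lambda>i. (U i - X i v* B) \<bullet> v + (X i v* B) \<bullet> v) {..<n}"
      by (simp add: Uv[symmetric] inner_diff_left)
    also have "\<dots> \<le> 1 / 2 * norm v + sqrt (real n) * norm (B *v v)"
      using L2_set_triangle_ineq[of "\<lambda>i. (U i - X i v* B) \<bullet> v" "\<lambda>i. (X i v* B) \<bullet> v" "{..<n}"] 1 2 by linarith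
    finally show ?thesis by simp
  qed
  have "inj ((*v) B)"
  proof (subst linear_injective_0[OF matrix_vector_mul_linear], intro allI impI)
    fix v assume "B *v v = 0"
    then show "v = 0" using expand[of v] by simp
  qed
  then have "surj ((*v) B)" by (intro linear_inj_imp_surj matrix_vector_mul_linear)
  then obtain v where v: "y = B *v v" by (metis surjD)
  show ?thesis
  proof (cases "y = 0")
    case False
    have "norm y * norm y = (y v* B) \<bullet> v"
      using v by (simp add: dot_lmul_matrix flip: power2_eq_square power2_norm_eq_inner)
    also have "\<dots> \<le> norm (y v* B) * norm v" by (rule norm_cauchy_schwarz)
    also have "\<dots> \<le> norm (y v* B) * (2 * sqrt (real n) * norm y)"
      using expand[of v] v by (intro mult_left_mono) auto
    finally have "norm y * norm y \<le> (2 * sqrt (real n) * norm (y v* B)) * norm y" by (simp add: mult_ac)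
    then show ?thesis using False by simp
  qed simp
qed

text \<open>
  Full column rank excludes zero singular values, so \<open>X\<close> and \<open>U\<close> determine each other row by row.
\<close>

lemma left_singular_rows_eq_iff:
  fixes X U :: "nat \<Rightarrow> real ^ 'd"
  assumes U: "left_singular_matrix n X U"
    and rank: "\<And>v. v \<noteq> 0 \<Longrightarrow> 0 < (\<Sum>i<n. (X i \<bullet> v)\<^sup>2)"
    and ij: "i < n" "j < n"
  shows "U i = U j \<longleftrightarrow> X i = X j"
proof -
  obtain s V where V: "orthogonal_matrix V"
    and X: "\<And>i. i < n \<Longrightarrow> X i = V *v (\<chi> a. U i $ a * sqrt (s a))"
    using U unfolding left_singular_matrix_def by (auto simp: transpose_transpose)
  define y where "y = (\<lambda>i. (\<chi> a. U i $ a * sqrt (s a)) :: real ^ 'd)"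
  have VV: "transpose V ** V = mat 1" using V by (simp add: orthogonal_matrix)
  have inv: "transpose V *v (V *v x) = x" for x
    by (simp only: matrix_vector_mul_assoc VV matrix_vector_mul_lid)
  have inn: "(V *v x) \<bullet> (V *v z) = x \<bullet> z" for x z
    by (metis inv dot_lmul_matrix transpose_matrix_vector transpose_transpose)
  have s0: "sqrt (s a) \<noteq> 0" for a
  proof
    assume s: "sqrt (s a) = 0"
    have "V *v axis a 1 \<noteq> 0"
      using inv[of "axis a 1"] by (metis axis_eq_0_iff matrix_vector_mult_0_right zero_neq_one)
    from rank[OF this] have "0 < (\<Sum>i<n. (y i \<bullet> axis a 1)\<^sup>2)"
      by (simp add: X inn y_def)
    then show False by (simp add: y_def inner_axis s)
  qed
  show ?thesis
  proof
    assume "X i = X j"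
    then have "y i = y j" using X ij inv unfolding y_def by metis
    then have "y i $ a = y j $ a" for a by simp
    then have "U i $ a * sqrt (s a) = U j $ a * sqrt (s a)" for a by (simp only: y_def vec_lambda_beta)
    then have "U i $ a = U j $ a" for a using s0[of a] mult_cancel_right by blast
    then show "U i = U j" by (simp add: vec_eq_iff)
  qed (simp add: X ij)
qed

section \<open>Quadratic bounds for the log-likelihood ratio\<close>

text \<open>
  The difference of the logarithms of both sides has derivative \<open>h * (1 / (1 + h) - \<delta>)\<close>, which has
  the sign of \<open>h\<close> on the whole range allowed.
\<close>

lemma one_plus_le_exp_quadratic:
  fixes \<delta> h :: real
  assumes \<delta>: "0 < \<delta>" and h: "-1 \<le> h" "\<delta> * (1 + h) \<le> 1" and \<delta>1: "\<delta> \<le> 1"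
  shows "1 + h \<le> exp (h - \<delta> / 2 * h\<^sup>2)"
proof (cases "h = -1")
  case False
  with h have h1: "-1 < h" by simp
  define f where "f = (\<lambda>x. x - \<delta> / 2 * x\<^sup>2 - ln (1 + x))"
  have deriv: "(f has_real_derivative x * (1 / (1 + x) - \<delta>)) (at x)" if "-1 < x" for x
  proof -
    have "(f has_real_derivative 1 - \<delta> * x - 1 / (1 + x)) (at x)"
      unfolding f_def by (rule derivative_eq_intros refl | use that in simp)+
    moreover have "1 - \<delta> * x - 1 / (1 + x) = x * (1 / (1 + x) - \<delta>)"
      using that by (simp add: field_simps)
    ultimately show ?thesis by simp
  qed
  have slope: "1 / (1 + x) - \<delta> \<ge> 0" if "-1 < x" "x \<le> max 0 h" for x
  proof -
    have "\<delta> * (1 + x) \<le> \<delta> * (1 + max 0 h)" using that \<delta> by (intro mult_left_mono) auto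
    also have "\<dots> \<le> 1" using h \<delta>1 by (auto simp: max_def)
    finally show ?thesis using that by (simp add: field_simps)
  qed
  have "f 0 \<le> f h"
  proof (cases "h \<ge> 0")
    case True
    show ?thesis
    proof (rule DERIV_nonneg_imp_nondecreasing[OF True])
      fix x assume "0 \<le> x" "x \<le> h"
      then show "\<exists>y. (f has_real_derivative y) (at x) \<and> 0 \<le> y"
        using deriv[of x] slope[of x] by (intro exI[of _ "x * (1 / (1 + x) - \<delta>)"]) auto
    qed
  next
    case False
    then have "h \<le> 0" by simp
    then show ?thesis
    proof (rule DERIV_nonpos_imp_nonincreasing)
      fix x assume "h \<le> x" "x \<le> 0"
      then show "\<exists>y. (f has_real_derivative y) (at x) \<and> y \<le> 0"
        using deriv[of x] slope[of x] h1
        by (intro exI[of _ "x * (1 / (1 + x) - \<delta>)"]) (auto intro: mult_nonpos_nonneg)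
    qed
  qed
  then have "ln (1 + h) \<le> h - \<delta> / 2 * h\<^sup>2" by (simp add: f_def)
  then show ?thesis using h1 by (metis exp_le_cancel_iff exp_ln add.commute less_add_same_cancel1
        neg_less_iff_less real_0_less_add_iff)
qed auto

text \<open>
  Rescaled such that one factor of the likelihood ratio is \<open>1\<close> plus the noise times the difference
  of the edge probabilities.
\<close>

definition noise :: "(nat \<Rightarrow> real ^ 'd) \<Rightarrow> (nat \<Rightarrow> nat \<Rightarrow> nat) \<Rightarrow> nat \<Rightarrow> nat \<Rightarrow> real" where
  "noise X0 Y i j = (real (Y i j) - X0 i \<bullet> X0 j) / ((X0 i \<bullet> X0 j) * (1 - X0 i \<bullet> X0 j))"

lemma noise_cases:
  assumes "Y i j \<in> {0, 1}" "0 < X0 i \<bullet> X0 j" "X0 i \<bullet> X0 j < 1"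
  shows "noise X0 Y i j = (if Y i j = 1 then 1 / (X0 i \<bullet> X0 j) else - 1 / (1 - X0 i \<bullet> X0 j))"
  using assms by (auto simp: noise_def field_simps)

lemma noise_bounds:
  assumes "Y i j \<in> {0, 1}" "\<delta> \<le> X0 i \<bullet> X0 j" "X0 i \<bullet> X0 j \<le> 1 - \<delta>" "0 < \<delta>"
  shows "\<bar>noise X0 Y i j\<bar> \<le> 1 / \<delta>" "1 \<le> (noise X0 Y i j)\<^sup>2"
proof -
  have n: "noise X0 Y i j = (if Y i j = 1 then 1 / (X0 i \<bullet> X0 j) else - 1 / (1 - X0 i \<bullet> X0 j))"
    using assms by (intro noise_cases) auto
  show "\<bar>noise X0 Y i j\<bar> \<le> 1 / \<delta>" using assms by (simp add: n frac_le)
  have "1 \<le> \<bar>noise X0 Y i j\<bar>" using assms by (simp add: n)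
  then show "1 \<le> (noise X0 Y i j)\<^sup>2" by (metis one_le_power power2_abs)
qed

lemma bernoulli_lik_ratio:
  assumes "Y i j \<in> {0, 1}" "0 < X0 i \<bullet> X0 j" "X0 i \<bullet> X0 j < 1"
  shows "bernoulli_lik p (Y i j) / bernoulli_lik (X0 i \<bullet> X0 j) (Y i j) =
    1 + noise X0 Y i j * (p - X0 i \<bullet> X0 j)"
  using assms by (auto simp: noise_cases bernoulli_lik_def field_simps)

lemma lik_ratio_eq_prod_noise:
  assumes "\<And>i j. i < n \<Longrightarrow> j < n \<Longrightarrow> Y i j \<in> {0, 1}"
    "\<And>i j. i < n \<Longrightarrow> j < n \<Longrightarrow> 0 < X0 i \<bullet> X0 j \<and> X0 i \<bullet> X0 j < 1"
  shows "lik_ratio n X0 Y X =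
    (\<Prod>(i, j)\<in>upper_pairs n. 1 + noise X0 Y i j * (gram X i j - gram X0 i j))"
  unfolding lik_ratio_def gram_def
proof (intro prod.cong refl, clarify)
  fix i j assume "(i, j) \<in> upper_pairs n"
  then have ij: "i < n" "j < n" by (auto simp: upper_pairs_def)
  show "bernoulli_lik (X i \<bullet> X j) (Y i j) / bernoulli_lik (X0 i \<bullet> X0 j) (Y i j) =
      1 + noise X0 Y i j * (X i \<bullet> X j - X0 i \<bullet> X0 j)"
    using assms(2)[OF ij] by (intro bernoulli_lik_ratio assms(1) ij) auto
qed

lemma finite_upper_pairs [simp]: "finite (upper_pairs n)"
  by (rule finite_subset[of _ "{..<n} \<times> {..<n}"]) (auto simp: upper_pairs_def)

lemma upper_pairs_subset: "upper_pairs n \<subseteq> {..<n} \<times> {..<n}"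
  by (auto simp: upper_pairs_def)

lemma sum_upper_pairs_bounds:
  fixes f :: "nat \<Rightarrow> nat \<Rightarrow> real"
  assumes sym: "\<And>i j. f i j = f j i" and nn: "\<And>i j. f i j \<ge> 0"
  shows "(\<Sum>i<n. \<Sum>j<n. f i j) \<le> 2 * (\<Sum>(i, j)\<in>upper_pairs n. f i j)"
    and "(\<Sum>(i, j)\<in>upper_pairs n. f i j) \<le> (\<Sum>i<n. \<Sum>j<n. f i j)"
proof -
  let ?L = "prod.swap ` upper_pairs n"
  have cover: "{..<n} \<times> {..<n} = upper_pairs n \<union> ?L"
    by (auto simp: upper_pairs_def image_iff)
  have "(\<Sum>i<n. \<Sum>j<n. f i j) = (\<Sum>(i, j)\<in>upper_pairs n \<union> ?L. f i j)"
    by (simp add: sum.cartesian_product cover[symmetric])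
  also have "\<dots> \<le> (\<Sum>(i, j)\<in>upper_pairs n. f i j) + (\<Sum>(i, j)\<in>?L. f i j)"
    using sum.union_inter[of "upper_pairs n" ?L "\<lambda>(i, j). f i j"]
      sum_nonneg[of "upper_pairs n \<inter> ?L" "\<lambda>(i, j). f i j"] nn by (auto simp: split_beta)
  also have "(\<Sum>(i, j)\<in>?L. f i j) = (\<Sum>(i, j)\<in>upper_pairs n. f i j)"
    using sym by (subst sum.reindex) (auto simp: split_beta)
  finally show "(\<Sum>i<n. \<Sum>j<n. f i j) \<le> 2 * (\<Sum>(i, j)\<in>upper_pairs n. f i j)" by simp
  show "(\<Sum>(i, j)\<in>upper_pairs n. f i j) \<le> (\<Sum>i<n. \<Sum>j<n. f i j)"
    using nn upper_pairs_subset by (subst sum.cartesian_product) (intro sum_mono2, auto)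
qed

lemma gram_commute: "gram X i j = gram X j i"
  by (simp add: gram_def inner_commute)

text \<open>
  Each factor \<open>1 + h\<close> is a ratio of probabilities whose denominator is at least \<open>\<delta>\<close>, hence the
  quadratic bound applies, also where a probability under \<open>X\<close> is \<open>0\<close> or \<open>1\<close>. As the noise is at least
  \<open>1\<close> in absolute value, \<open>h\<^sup>2\<close> dominates the squared difference of the probabilities. The pairs
  \<open>i \<le> j\<close> carry at least half of the symmetric sum, which turns \<open>\<delta> / 2\<close> into \<open>\<delta> / 4\<close>.
\<close>

lemma lik_ratio_upper_bound:
  fixes X X0 :: "nat \<Rightarrow> real ^ 'd"
  assumes Y: "\<And>i j. i < n \<Longrightarrow> j < n \<Longrightarrow> Y i j \<in> {0, 1}"
    and X0: "\<And>i j. i < n \<Longrightarrow> j < n \<Longrightarrow> \<delta> \<le> X0 i \<bullet> X0 j \<and> X0 i \<bullet> X0 j \<le> 1 - \<delta>"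
    and \<delta>: "0 < \<delta>" "\<delta> < 1 / 2"
    and X: "\<And>i j. i < n \<Longrightarrow> j < n \<Longrightarrow> 0 \<le> X i \<bullet> X j \<and> X i \<bullet> X j \<le> 1"
  shows "0 \<le> lik_ratio n X0 Y X"
    and "lik_ratio n X0 Y X \<le>
      exp ((\<Sum>(i, j)\<in>upper_pairs n. noise X0 Y i j * (gram X i j - gram X0 i j))
        - \<delta> / 4 * (\<Sum>i<n. \<Sum>j<n. (gram X i j - gram X0 i j)\<^sup>2))"
proof -
  define \<Delta> where "\<Delta> = (\<lambda>i j. gram X i j - gram X0 i j)"
  define h where "h = (\<lambda>i j. noise X0 Y i j * \<Delta> i j)"
  have X0': "0 < X0 i \<bullet> X0 j \<and> X0 i \<bullet> X0 j < 1" if "i < n" "j < n" for i j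
    using X0[OF that] \<delta> by linarith
  have eq: "lik_ratio n X0 Y X = (\<Prod>(i, j)\<in>upper_pairs n. 1 + h i j)"
    unfolding h_def \<Delta>_def by (rule lik_ratio_eq_prod_noise) (use Y X0' in auto)
  have h: "0 \<le> 1 + h i j \<and> \<delta> * (1 + h i j) \<le> 1" if ij: "i < n" "j < n" for i j
  proof -
    have n: "noise X0 Y i j = (if Y i j = 1 then 1 / (X0 i \<bullet> X0 j) else - 1 / (1 - X0 i \<bullet> X0 j))"
      using noise_cases[of Y i j X0, OF Y[OF ij]] X0'[OF ij] by blast
    then have e: "1 + h i j = (if Y i j = 1 then (X i \<bullet> X j) / (X0 i \<bullet> X0 j) else (1 - X i \<bullet> X j) / (1 - X0 i \<bullet> X0 j))"
    proof -
      have "1 + 1 / p * (x - p) = x / p" "1 + - 1 / (1 - p) * (x - p) = (1 - x) / (1 - p)"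
        if "0 < p" "p < 1" for p x :: real
        using that by (auto simp: field_simps)
      then show ?thesis using X0'[OF ij] n by (simp add: h_def \<Delta>_def gram_def)
    qed
    have "\<delta> * (X i \<bullet> X j) \<le> \<delta> * 1" "\<delta> * (1 - X i \<bullet> X j) \<le> \<delta> * 1"
      using X[OF ij] \<delta> by (intro mult_left_mono; simp)+
    then have "\<delta> * (X i \<bullet> X j) \<le> X0 i \<bullet> X0 j" "\<delta> * (1 - X i \<bullet> X j) \<le> 1 - X0 i \<bullet> X0 j"
      using X0[OF ij] by linarith+
    then show ?thesis
      using X[OF ij] X0'[OF ij] by (auto simp: e pos_divide_le_eq)
  qed
  then show "0 \<le> lik_ratio n X0 Y X"
    unfolding eq by (intro prod_nonneg) (auto simp: upper_pairs_def)
  have "lik_ratio n X0 Y X \<le> (\<Prod>(i, j)\<in>upper_pairs n. exp (h i j - \<delta> / 2 * (\<Delta> i j)\<^sup>2))"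
    unfolding eq
  proof (intro prod_mono, clarify)
    fix i j assume "(i, j) \<in> upper_pairs n"
    then have ij: "i < n" "j < n" by (auto simp: upper_pairs_def)
    have "1 + h i j \<le> exp (h i j - \<delta> / 2 * (h i j)\<^sup>2)"
      using h[OF ij] \<delta> by (intro one_plus_le_exp_quadratic) auto
    also have "\<dots> \<le> exp (h i j - \<delta> / 2 * (\<Delta> i j)\<^sup>2)"
    proof -
      have "1 * (\<Delta> i j)\<^sup>2 \<le> (h i j)\<^sup>2"
        unfolding h_def power_mult_distrib
        using noise_bounds(2)[of Y i j \<delta> X0] Y[OF ij] X0[OF ij] \<delta> by (intro mult_right_mono) auto
      then show ?thesis using \<delta> by simp
    qed
    finally show "0 \<le> 1 + h i j \<and> 1 + h i j \<le> exp (h i j - \<delta> / 2 * (\<Delta> i j)\<^sup>2)"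
      using h[OF ij] by auto
  qed
  also have "\<dots> = exp ((\<Sum>(i, j)\<in>upper_pairs n. h i j) - \<delta> / 2 * (\<Sum>(i, j)\<in>upper_pairs n. (\<Delta> i j)\<^sup>2))"
    by (simp add: exp_sum[symmetric] split_beta sum_subtractf sum_distrib_left)
  also have "\<dots> \<le> exp ((\<Sum>(i, j)\<in>upper_pairs n. h i j) - \<delta> / 4 * (\<Sum>i<n. \<Sum>j<n. (\<Delta> i j)\<^sup>2))"
    using sum_upper_pairs_bounds(1)[of "\<lambda>i j. (\<Delta> i j)\<^sup>2" n] \<delta> by (simp add: \<Delta>_def gram_commute)
  finally show "lik_ratio n X0 Y X \<le>
      exp ((\<Sum>(i, j)\<in>upper_pairs n. noise X0 Y i j * (gram X i j - gram X0 i j))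
        - \<delta> / 4 * (\<Sum>i<n. \<Sum>j<n. (gram X i j - gram X0 i j)\<^sup>2))"
    by (simp add: h_def \<Delta>_def)
qed

lemma lik_ratio_lower_bound:
  fixes X X0 :: "nat \<Rightarrow> real ^ 'd"
  assumes Y: "\<And>i j. i < n \<Longrightarrow> j < n \<Longrightarrow> Y i j \<in> {0, 1}"
    and X0: "\<And>i j. i < n \<Longrightarrow> j < n \<Longrightarrow> \<delta> \<le> X0 i \<bullet> X0 j \<and> X0 i \<bullet> X0 j \<le> 1 - \<delta>"
    and \<delta>: "0 < \<delta>"
    and near: "\<And>i j. i < n \<Longrightarrow> j < n \<Longrightarrow> \<bar>gram X i j - gram X0 i j\<bar> \<le> \<delta> / 2"
  shows "exp ((\<Sum>(i, j)\<in>upper_pairs n. noise X0 Y i j * (gram X i j - gram X0 i j))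
        - 2 / \<delta>\<^sup>2 * (\<Sum>i<n. \<Sum>j<n. (gram X i j - gram X0 i j)\<^sup>2)) \<le> lik_ratio n X0 Y X"
proof -
  define \<Delta> where "\<Delta> = (\<lambda>i j. gram X i j - gram X0 i j)"
  define h where "h = (\<lambda>i j. noise X0 Y i j * \<Delta> i j)"
  have X0': "0 < X0 i \<bullet> X0 j \<and> X0 i \<bullet> X0 j < 1" if "i < n" "j < n" for i j
    using X0[OF that] \<delta> by linarith
  have eq: "lik_ratio n X0 Y X = (\<Prod>(i, j)\<in>upper_pairs n. 1 + h i j)"
    unfolding h_def \<Delta>_def by (rule lik_ratio_eq_prod_noise) (use Y X0' in auto)
  have "exp ((\<Sum>(i, j)\<in>upper_pairs n. h i j) - 2 / \<delta>\<^sup>2 * (\<Sum>i<n. \<Sum>j<n. (\<Delta> i j)\<^sup>2)) \<le>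
      exp ((\<Sum>(i, j)\<in>upper_pairs n. h i j) - 2 / \<delta>\<^sup>2 * (\<Sum>(i, j)\<in>upper_pairs n. (\<Delta> i j)\<^sup>2))"
    using sum_upper_pairs_bounds(2)[of "\<lambda>i j. (\<Delta> i j)\<^sup>2" n] \<delta>
    by (simp add: \<Delta>_def gram_commute divide_right_mono)
  also have "\<dots> = (\<Prod>(i, j)\<in>upper_pairs n. exp (h i j - 2 / \<delta>\<^sup>2 * (\<Delta> i j)\<^sup>2))"
    by (simp add: exp_sum[symmetric] split_beta sum_subtractf sum_distrib_left)
  also have "\<dots> \<le> lik_ratio n X0 Y X"
    unfolding eq
  proof (intro prod_mono, clarify)
    fix i j assume "(i, j) \<in> upper_pairs n"
    then have ij: "i < n" "j < n" by (auto simp: upper_pairs_def)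
    have nb: "\<bar>noise X0 Y i j\<bar> \<le> 1 / \<delta>"
      using noise_bounds(1)[of Y i j \<delta> X0] Y[OF ij] X0[OF ij] \<delta> by auto
    have "\<bar>h i j\<bar> \<le> 1 / \<delta> * \<bar>\<Delta> i j\<bar>"
      unfolding h_def abs_mult by (intro mult_right_mono nb) auto
    moreover have "1 / \<delta> * \<bar>\<Delta> i j\<bar> \<le> 1 / \<delta> * (\<delta> / 2)"
      using near[OF ij] \<delta> unfolding \<Delta>_def by (intro mult_left_mono) auto
    moreover have "1 / \<delta> * (\<delta> / 2) = 1 / 2" using \<delta> by simp
    ultimately have h2: "\<bar>h i j\<bar> \<le> 1 / 2" by linarith
    have "(h i j)\<^sup>2 \<le> (1 / \<delta> * \<bar>\<Delta> i j\<bar>)\<^sup>2"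
      using \<open>\<bar>h i j\<bar> \<le> 1 / \<delta> * \<bar>\<Delta> i j\<bar>\<close> by (metis abs_ge_zero power2_abs power_mono)
    then have sq: "(h i j)\<^sup>2 \<le> (\<Delta> i j)\<^sup>2 / \<delta>\<^sup>2" by (simp add: power_divide power_mult_distrib)
    have pos: "1 + h i j > 0" using h2 by linarith
    have "h i j - 2 / \<delta>\<^sup>2 * (\<Delta> i j)\<^sup>2 \<le> h i j - 2 * (h i j)\<^sup>2" using sq by simp
    also have "\<dots> \<le> ln (1 + h i j)"
      using abs_ln_one_plus_x_minus_x_bound[OF h2] by linarith
    finally have "exp (h i j - 2 / \<delta>\<^sup>2 * (\<Delta> i j)\<^sup>2) \<le> 1 + h i j" using pos by (simp add: ln_ge_iff)
    then show "0 \<le> exp (h i j - 2 / \<delta>\<^sup>2 * (\<Delta> i j)\<^sup>2) \<and> exp (h i j - 2 / \<delta>\<^sup>2 * (\<Delta> i j)\<^sup>2) \<le> 1 + h i j"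
      by simp
  qed
  finally show ?thesis by (simp add: h_def \<Delta>_def)
qed

text \<open>
  The strictly lower triangle is filled with zeros; the resulting \<open>n \<times> n\<close> matrix has operator norm at
  most \<open>C * sqrt n\<close>.
\<close>

definition noise_bounded ::
    "nat \<Rightarrow> (nat \<Rightarrow> real ^ 'd) \<Rightarrow> (nat \<Rightarrow> nat \<Rightarrow> nat) \<Rightarrow> real \<Rightarrow> bool" where
  "noise_bounded n X0 Y C \<longleftrightarrow> (\<forall>u v. \<bar>\<Sum>(i, j)\<in>upper_pairs n. noise X0 Y i j * (u i * v j)\<bar>
     \<le> C * sqrt (real n) * (L2_set u {..<n} * L2_set v {..<n}))"

lemma noise_bounded_rows:
  fixes A B :: "nat \<Rightarrow> real ^ 'd"
  assumes nb: "noise_bounded n X0 Y C" and C: "C \<ge> 0"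
  shows "\<bar>\<Sum>(i, j)\<in>upper_pairs n. noise X0 Y i j * (A i \<bullet> B j)\<bar>
    \<le> C * sqrt (real n) * (frob_rows n A * frob_rows n B)"
proof -
  have fr: "frob_rows n A = L2_set (\<lambda>a. L2_set (\<lambda>i. A i $ a) {..<n}) UNIV" for A :: "nat \<Rightarrow> real ^ 'd"
    unfolding frob_rows_def L2_set_def norm_vec_def
    by (simp add: sum_nonneg sum.swap[of _ "{..<n}" UNIV])
  have "(\<Sum>(i, j)\<in>upper_pairs n. noise X0 Y i j * (A i \<bullet> B j)) =
      (\<Sum>a\<in>UNIV. \<Sum>(i, j)\<in>upper_pairs n. noise X0 Y i j * (A i $ a * B j $ a))"
    by (subst sum.swap) (simp add: split_beta inner_vec_def sum_distrib_left)
  also have "\<bar>\<dots>\<bar> \<le> (\<Sum>a\<in>UNIV. \<bar>\<Sum>(i, j)\<in>upper_pairs n. noise X0 Y i j * (A i $ a * B j $ a)\<bar>)"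
    by (rule sum_abs)
  also have "\<dots> \<le> (\<Sum>a\<in>UNIV. C * sqrt (real n) * (L2_set (\<lambda>i. A i $ a) {..<n} * L2_set (\<lambda>i. B i $ a) {..<n}))"
    by (intro sum_mono nb[unfolded noise_bounded_def, rule_format])
  also have "\<dots> = C * sqrt (real n) * (\<Sum>a\<in>UNIV. \<bar>L2_set (\<lambda>i. A i $ a) {..<n}\<bar> * \<bar>L2_set (\<lambda>i. B i $ a) {..<n}\<bar>)"
    by (simp add: sum_distrib_left)
  also have "\<dots> \<le> C * sqrt (real n) * (frob_rows n A * frob_rows n B)"
    unfolding fr using C by (intro mult_left_mono L2_set_mult_ineq) auto
  finally show ?thesis .
qed

text \<open>
  With \<open>D = X - Z\<close> the difference is \<open>Z D\<^sup>T + D Z\<^sup>T + D D\<^sup>T\<close>, a sum of terms that are bilinear in the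
  rows. The freedom in \<open>Z\<close> admits the rotation of \<open>X0\<close> that is closest to \<open>X\<close>.
\<close>

lemma noise_bounded_gram:
  fixes X Z X0 :: "nat \<Rightarrow> real ^ 'd"
  assumes nb: "noise_bounded n X0 Y C" and C: "C \<ge> 0"
    and Z: "\<And>i j. i < n \<Longrightarrow> j < n \<Longrightarrow> gram Z i j = gram X0 i j"
  defines "r \<equiv> frob_rows n (\<lambda>i. X i - Z i)"
  shows "\<bar>\<Sum>(i, j)\<in>upper_pairs n. noise X0 Y i j * (gram X i j - gram X0 i j)\<bar>
    \<le> C * sqrt (real n) * (2 * frob_rows n Z * r + r\<^sup>2)"
proof -
  define D where "D = (\<lambda>i. X i - Z i)"
  have "gram X i j - gram X0 i j = Z i \<bullet> D j + D i \<bullet> Z j + D i \<bullet> D j" if "i < n" "j < n" for i j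
    using Z[OF that] by (simp add: D_def gram_def inner_diff_left inner_diff_right)
  then have "(\<Sum>(i, j)\<in>upper_pairs n. noise X0 Y i j * (gram X i j - gram X0 i j)) =
     (\<Sum>(i, j)\<in>upper_pairs n. noise X0 Y i j * (Z i \<bullet> D j) + noise X0 Y i j * (D i \<bullet> Z j)
        + noise X0 Y i j * (D i \<bullet> D j))"
    by (intro sum.cong) (auto simp: upper_pairs_def algebra_simps)
  also have "\<dots> = (\<Sum>(i, j)\<in>upper_pairs n. noise X0 Y i j * (Z i \<bullet> D j))
      + (\<Sum>(i, j)\<in>upper_pairs n. noise X0 Y i j * (D i \<bullet> Z j))
      + (\<Sum>(i, j)\<in>upper_pairs n. noise X0 Y i j * (D i \<bullet> D j))"
    by (simp add: split_beta sum.distrib)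
  also have "\<bar>\<dots>\<bar> \<le> C * sqrt (real n) * (frob_rows n Z * r) + C * sqrt (real n) * (r * frob_rows n Z)
      + C * sqrt (real n) * (r * r)"
    using noise_bounded_rows[OF nb C, of Z D] noise_bounded_rows[OF nb C, of D Z]
      noise_bounded_rows[OF nb C, of D D]
    unfolding r_def D_def[symmetric] by linarith
  also have "\<dots> = C * sqrt (real n) * (2 * frob_rows n Z * r + r\<^sup>2)"
    by (simp add: algebra_simps power2_eq_square)
  finally show ?thesis .
qed

section \<open>Operator norm of the noise\<close>

text \<open>
  Divided by \<open>4 * sqrt n\<close>, these are the points of a cubic grid in the unit ball whose mesh is so fine
  that rounding moves a vector by at most \<open>1 / 4\<close>. The box makes finiteness immediate.
\<close>

definition integer_net :: "nat \<Rightarrow> (nat \<Rightarrow> int) set" where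
  "integer_net n = {k \<in> {..<n} \<rightarrow>\<^sub>E {- int (4 * n)..int (4 * n)}. (\<Sum>i<n. (k i)\<^sup>2) \<le> int (16 * n)}"

lemma finite_integer_net [simp]: "finite (integer_net n)"
  by (rule finite_subset[of _ "{..<n} \<rightarrow>\<^sub>E {- int (4 * n)..int (4 * n)}"])
    (auto simp: integer_net_def intro: finite_PiE)

lemma sum_half_powers_symmetric: "(\<Sum>k\<in>{- int m..int m}. (1 / 2 :: real) ^ nat \<bar>k\<bar>) \<le> 3"
proof -
  have "(\<Sum>k\<in>{- int m..int m}. (1 / 2 :: real) ^ nat \<bar>k\<bar>) = 3 - 2 * (1 / 2) ^ m"
  proof (induction m)
    case (Suc m)
    have "{- int (Suc m)..int (Suc m)} = insert (int (Suc m)) (insert (- int (Suc m)) {- int m..int m})"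
      by auto
    then show ?case using Suc by (simp add: nat_add_distrib)
  qed simp
  then show ?thesis by simp
qed

text \<open>
  The absolute values of the entries add up to at most \<open>16 n\<close>, so a member has weight at least
  \<open>2\<close> to the power \<open>- 16 n\<close> under the product of the weights \<open>(1 / 2) ^ |k|\<close>, whose total over the box is
  at most \<open>3 ^ n\<close>.
\<close>

lemma card_integer_net_le: "real (card (integer_net n)) \<le> 2 ^ (18 * n)"
proof -
  let ?B = "{..<n} \<rightarrow>\<^sub>E {- int (4 * n)..int (4 * n)}"
  have "real (card (integer_net n)) = (\<Sum>k\<in>integer_net n. 1)" by simp
  also have "\<dots> \<le> (\<Sum>k\<in>integer_net n. 2 ^ (16 * n) * (\<Prod>i<n. (1 / 2) ^ nat \<bar>k i\<bar>))"
  proof (rule sum_mono)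
    fix k assume k: "k \<in> integer_net n"
    have "int (\<Sum>i<n. nat \<bar>k i\<bar>) = (\<Sum>i<n. \<bar>k i\<bar>)" by simp
    also have "\<dots> \<le> (\<Sum>i<n. (k i)\<^sup>2)"
    proof (rule sum_mono)
      fix i
      have "\<bar>k i\<bar> * 1 \<le> \<bar>k i\<bar> * \<bar>k i\<bar>"
      proof (cases "k i = 0")
        case False
        then have "1 \<le> \<bar>k i\<bar>" by linarith
        then show ?thesis by (intro mult_left_mono) auto
      qed simp
      then show "\<bar>k i\<bar> \<le> (k i)\<^sup>2" by (simp add: power2_eq_square)
    qed
    also have "\<dots> \<le> int (16 * n)" using k by (simp add: integer_net_def)
    finally have le: "(\<Sum>i<n. nat \<bar>k i\<bar>) \<le> 16 * n" by linarith
    have "1 = 2 ^ (16 * n) * (1 / 2 :: real) ^ (16 * n)" by (simp add: power_one_over)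
    also have "\<dots> \<le> 2 ^ (16 * n) * (1 / 2) ^ (\<Sum>i<n. nat \<bar>k i\<bar>)"
      using le by (intro mult_left_mono power_decreasing) auto
    finally show "1 \<le> 2 ^ (16 * n) * (\<Prod>i<n. (1 / 2 :: real) ^ nat \<bar>k i\<bar>)"
      by (simp add: power_sum)
  qed
  also have "\<dots> \<le> (\<Sum>k\<in>?B. 2 ^ (16 * n) * (\<Prod>i<n. (1 / 2) ^ nat \<bar>k i\<bar>))"
  proof (rule sum_mono2)
    show "finite ?B" by (intro finite_PiE) auto
    show "integer_net n \<subseteq> ?B" by (auto simp: integer_net_def)
    show "0 \<le> 2 ^ (16 * n) * (\<Prod>i<n. (1 / 2 :: real) ^ nat \<bar>k i\<bar>)" for k
      by (intro mult_nonneg_nonneg prod_nonneg) auto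
  qed
  also have "\<dots> = 2 ^ (16 * n) * (\<Sum>k\<in>?B. \<Prod>i<n. (1 / 2) ^ nat \<bar>k i\<bar>)"
    by (simp add: sum_distrib_left)
  also have "(\<Sum>k\<in>?B. \<Prod>i<n. (1 / 2 :: real) ^ nat \<bar>k i\<bar>) =
      (\<Prod>i<n. \<Sum>k\<in>{- int (4 * n)..int (4 * n)}. (1 / 2) ^ nat \<bar>k\<bar>)"
    by (rule prod_sum_PiE[symmetric]) auto
  also have "\<dots> \<le> (\<Prod>i<n. 3)"
    by (intro prod_mono conjI sum_half_powers_symmetric sum_nonneg) auto
  also have "(\<Prod>i<n. 3 :: real) \<le> 4 ^ n" by (simp add: power_mono)
  also have "(2 :: real) ^ (16 * n) * 4 ^ n = 2 ^ (18 * n)"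
    by (simp add: power_mult flip: power_mult_distrib)
  finally show ?thesis by (simp add: mult_left_mono)
qed

definition net_vector :: "nat \<Rightarrow> (nat \<Rightarrow> int) \<Rightarrow> nat \<Rightarrow> real" where
  "net_vector n k i = real_of_int (k i) / (4 * sqrt (real n))"

text \<open>Rounding towards zero does not increase the norm.\<close>

lemma integer_net_dense:
  assumes u: "L2_set u {..<n} \<le> 1" and n: "n \<ge> 1"
  shows "\<exists>k\<in>integer_net n. L2_set (net_vector n k) {..<n} \<le> 1 \<and>
    L2_set (\<lambda>i. u i - net_vector n k i) {..<n} \<le> 1 / 4"
proof -
  define s where "s = 4 * sqrt (real n)"
  have s: "s > 0" using n by (simp add: s_def)
  have s2: "s\<^sup>2 = 16 * real n" by (simp add: s_def power_mult_distrib)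
  define rnd :: "real \<Rightarrow> int" where "rnd = (\<lambda>x. if x \<ge> 0 then \<lfloor>x\<rfloor> else - \<lfloor>- x\<rfloor>)"
  have rnd: "\<bar>real_of_int (rnd x)\<bar> \<le> \<bar>x\<bar>" "\<bar>x - real_of_int (rnd x)\<bar> \<le> 1" for x
    unfolding rnd_def by (auto split: if_splits) linarith+
  define k where "k = restrict (\<lambda>i. rnd (s * u i)) {..<n}"
  have usq: "(\<Sum>i<n. (u i)\<^sup>2) \<le> 1"
    using u by (simp add: L2_set_def real_sqrt_le_1_iff)
  have ki: "real_of_int (k i) = s * net_vector n k i" "\<bar>net_vector n k i\<bar> \<le> \<bar>u i\<bar>"
    "\<bar>u i - net_vector n k i\<bar> \<le> 1 / s" if "i < n" for i
  proof -
    show 1: "real_of_int (k i) = s * net_vector n k i" using s n by (simp add: net_vector_def s_def)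
    have "s * \<bar>net_vector n k i\<bar> \<le> s * \<bar>u i\<bar>"
      using rnd(1)[of "s * u i"] that s 1 by (simp add: k_def abs_mult)
    then show "\<bar>net_vector n k i\<bar> \<le> \<bar>u i\<bar>" using s by simp
    have "\<bar>s * (u i - net_vector n k i)\<bar> \<le> 1"
      using rnd(2)[of "s * u i"] that 1 by (simp add: k_def algebra_simps)
    then have "\<bar>u i - net_vector n k i\<bar> * s \<le> 1" using s by (simp only: abs_mult) (simp add: mult.commute)
    then show "\<bar>u i - net_vector n k i\<bar> \<le> 1 / s" using s by (simp only: pos_le_divide_eq)
  qed
  have nsq: "(\<Sum>i<n. (net_vector n k i)\<^sup>2) \<le> 1"
  proof -
    have "(\<Sum>i<n. (net_vector n k i)\<^sup>2) \<le> (\<Sum>i<n. (u i)\<^sup>2)"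
      using ki(2) by (intro sum_mono) (simp add: abs_le_square_iff)
    then show ?thesis using usq by linarith
  qed
  have "real_of_int (\<Sum>i<n. (k i)\<^sup>2) = (\<Sum>i<n. (s * net_vector n k i)\<^sup>2)"
    using ki(1) by simp
  also have "\<dots> = 16 * real n * (\<Sum>i<n. (net_vector n k i)\<^sup>2)"
    by (simp add: power_mult_distrib s2 sum_distrib_left)
  also have "\<dots> \<le> 16 * real n * 1" using nsq by (intro mult_left_mono) auto
  finally have ksq: "(\<Sum>i<n. (k i)\<^sup>2) \<le> int (16 * n)" by linarith
  have kb: "k i \<in> {- int (4 * n)..int (4 * n)}" if "i < n" for i
  proof -
    have "(k i)\<^sup>2 \<le> (\<Sum>i<n. (k i)\<^sup>2)" using that by (intro member_le_sum) auto
    also have "\<dots> \<le> 16 * int n * 1" using ksq by simp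
    also have "\<dots> \<le> 16 * int n * int n" using n by (intro mult_left_mono) auto
    also have "\<dots> = (int (4 * n))\<^sup>2" by (simp add: power2_eq_square)
    finally have "\<bar>k i\<bar> \<le> \<bar>int (4 * n)\<bar>" by (simp only: abs_le_square_iff)
    then show ?thesis by auto
  qed
  have "k \<in> integer_net n" using kb ksq by (auto simp: integer_net_def k_def)
  moreover have "L2_set (net_vector n k) {..<n} \<le> 1" using nsq by (simp add: L2_set_def)
  moreover have "L2_set (\<lambda>i. u i - net_vector n k i) {..<n} \<le> 1 / 4"
  proof -
    have "(\<Sum>i<n. (u i - net_vector n k i)\<^sup>2) \<le> (\<Sum>i<n. (1 / s)\<^sup>2)"
      using ki(3) s by (intro sum_mono) (metis abs_ge_zero lessThan_iff power2_abs power_mono)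
    also have "\<dots> = (1 / 4)\<^sup>2" using n by (simp add: power_divide s2)
    finally have "sqrt (\<Sum>i<n. (u i - net_vector n k i)\<^sup>2) \<le> sqrt ((1 / 4)\<^sup>2)"
      by (rule real_sqrt_le_mono)
    then show ?thesis unfolding L2_set_def real_sqrt_abs by simp
  qed
  ultimately show ?thesis by blast
qed

text \<open>
  The supremum \<open>s\<close> over the unit balls satisfies \<open>s \<le> T + s / 4 + s / 4\<close> after rounding one argument at
  a time.
\<close>

lemma bilinear_bound_from_net:
  fixes e :: "nat \<Rightarrow> nat \<Rightarrow> real"
  assumes P: "P \<subseteq> {..<n} \<times> {..<n}" and n: "n \<ge> 1" and T: "T \<ge> 0"
    and net: "\<And>k l. k \<in> integer_net n \<Longrightarrow> l \<in> integer_net n \<Longrightarrow>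
      L2_set (net_vector n k) {..<n} \<le> 1 \<Longrightarrow> L2_set (net_vector n l) {..<n} \<le> 1 \<Longrightarrow>
      \<bar>\<Sum>(i, j)\<in>P. e i j * (net_vector n k i * net_vector n l j)\<bar> \<le> T"
  shows "\<bar>\<Sum>(i, j)\<in>P. e i j * (u i * v j)\<bar> \<le> 2 * T * (L2_set u {..<n} * L2_set v {..<n})"
proof -
  define f where "f = (\<lambda>u v. \<Sum>(i, j)\<in>P. e i j * (u i * v j))"
  let ?N = "\<lambda>u. L2_set u {..<n}"
  have finP: "finite P" using P by (rule finite_subset) auto
  have f_lin: "f (\<lambda>i. a i - b i) v = f a v - f b v" "f u (\<lambda>i. a i - b i) = f u a - f u b"
    "f (\<lambda>i. c * a i) v = c * f a v" "f u (\<lambda>i. c * a i) = c * f u a" for a b c u v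
    by (simp_all add: f_def split_beta algebra_simps sum_subtractf sum_distrib_left)
  have small: "\<bar>w i\<bar> \<le> ?N w" if "i < n" for w i
  proof -
    have "(w i)\<^sup>2 \<le> (\<Sum>i<n. (w i)\<^sup>2)" using that by (intro member_le_sum) auto
    then show ?thesis unfolding L2_set_def by (metis real_sqrt_abs real_sqrt_le_iff)
  qed
  have triv: "\<bar>f u v\<bar> \<le> (\<Sum>(i, j)\<in>P. \<bar>e i j\<bar>) * (?N u * ?N v)" for u v
  proof -
    have "\<bar>f u v\<bar> \<le> (\<Sum>(i, j)\<in>P. \<bar>e i j * (u i * v j)\<bar>)"
      unfolding f_def split_beta by (rule sum_abs)
    also have "\<dots> \<le> (\<Sum>(i, j)\<in>P. \<bar>e i j\<bar> * (?N u * ?N v))"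
      unfolding split_beta abs_mult using P
      by (intro sum_mono mult_left_mono mult_mono small) auto
    finally show ?thesis by (simp add: sum_distrib_right split_beta)
  qed
  define S where "S = {\<bar>f u v\<bar> |u v. ?N u \<le> 1 \<and> ?N v \<le> 1}"
  have bdd: "bdd_above S"
  proof (rule bdd_aboveI[of _ "\<Sum>(i, j)\<in>P. \<bar>e i j\<bar>"])
    fix x assume "x \<in> S"
    then obtain u v where uv: "x = \<bar>f u v\<bar>" "?N u \<le> 1" "?N v \<le> 1" by (auto simp: S_def)
    have "?N u * ?N v \<le> 1" using uv by (simp add: mult_le_one)
    then have "(\<Sum>(i, j)\<in>P. \<bar>e i j\<bar>) * (?N u * ?N v) \<le> (\<Sum>(i, j)\<in>P. \<bar>e i j\<bar>)"
      by (intro mult_left_le sum_nonneg) (auto simp: split_beta)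
    then show "x \<le> (\<Sum>(i, j)\<in>P. \<bar>e i j\<bar>)" using triv[of u v] uv by linarith
  qed
  have ne: "S \<noteq> {}" unfolding S_def by (auto intro!: exI[of _ "\<lambda>_. 0"] simp: L2_set_def)
  define s where "s = Sup S"
  have le_s: "\<bar>f u v\<bar> \<le> s" if "?N u \<le> 1" "?N v \<le> 1" for u v
    unfolding s_def using that bdd by (intro cSup_upper) (auto simp: S_def)
  have s0: "s \<ge> 0" using le_s[of "\<lambda>_. 0" "\<lambda>_. 0"] by (simp add: L2_set_def)
  have hom: "\<bar>f u v\<bar> \<le> s * (?N u * ?N v)" for u v
  proof (cases "?N u = 0 \<or> ?N v = 0")
    case True
    then show ?thesis using triv[of u v] by auto
  next
    case False
    then have pos: "?N u > 0" "?N v > 0" by (auto simp: less_le)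
    have sc: "?N (\<lambda>i. (1 / ?N w) * w i) = 1" if "?N w > 0" for w
      using that by (subst L2_set_right_distrib[symmetric]) auto
    have "\<bar>f (\<lambda>i. (1 / ?N u) * u i) (\<lambda>i. (1 / ?N v) * v i)\<bar> \<le> s"
      using sc pos by (intro le_s) auto
    then have "1 / ?N u * (1 / ?N v * \<bar>f u v\<bar>) \<le> s"
      using pos by (simp only: f_lin abs_mult) simp
    then have "\<bar>f u v\<bar> / (?N u * ?N v) \<le> s" by simp
    then show ?thesis using pos by (simp add: pos_divide_le_eq)
  qed
  have "x \<le> T + s / 2" if "x \<in> S" for x
  proof -
    from that obtain u v where uv: "x = \<bar>f u v\<bar>" "?N u \<le> 1" "?N v \<le> 1" by (auto simp: S_def)
    obtain k where k: "k \<in> integer_net n" "?N (net_vector n k) \<le> 1"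
      "?N (\<lambda>i. u i - net_vector n k i) \<le> 1 / 4" using integer_net_dense[OF uv(2) n] by blast
    obtain l where l: "l \<in> integer_net n" "?N (net_vector n l) \<le> 1"
      "?N (\<lambda>i. v i - net_vector n l i) \<le> 1 / 4" using integer_net_dense[OF uv(3) n] by blast
    let ?a = "net_vector n k" and ?b = "net_vector n l"
    have "f u v = f ?a ?b + f (\<lambda>i. u i - ?a i) v + f ?a (\<lambda>i. v i - ?b i)"
      by (simp add: f_lin)
    moreover have "\<bar>f ?a ?b\<bar> \<le> T" unfolding f_def by (rule net) (use k l in auto)
    moreover have "\<bar>f (\<lambda>i. u i - ?a i) v\<bar> \<le> s * (1 / 4 * 1)"
      by (rule order_trans[OF hom]) (intro mult_left_mono mult_mono k uv s0, auto)
    moreover have "\<bar>f ?a (\<lambda>i. v i - ?b i)\<bar> \<le> s * (1 * (1 / 4))"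
      by (rule order_trans[OF hom]) (intro mult_left_mono mult_mono k l s0, auto)
    ultimately show ?thesis using uv(1) by linarith
  qed
  then have "s \<le> T + s / 2" unfolding s_def using ne by (intro cSup_least) auto
  then have "s \<le> 2 * T" by simp
  then have "s * (?N u * ?N v) \<le> 2 * T * (?N u * ?N v)" by (intro mult_right_mono) auto
  then show ?thesis using hom[of u v] by (simp add: f_def)
qed

lemma upper_pairsE:
  assumes "ij \<in> upper_pairs n"
  obtains i j where "ij = (i, j)" "i < n" "j < n"
  using assms by (cases ij) (auto simp: upper_pairs_def)

lemma rdpg_measurable:
  assumes "rdpg M n X Y" "(i, j) \<in> upper_pairs n" "prob_space M"
  shows "(\<lambda>\<omega>. Y \<omega> i j) \<in> measurable M (count_space UNIV)"
proof -
  interpret prob_space M by fact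
  have "indep_vars (\<lambda>_. count_space UNIV) (\<lambda>(i, j) \<omega>. Y \<omega> i j) (upper_pairs n)"
    using assms(1) by (simp add: rdpg_def)
  then have "random_variable (count_space UNIV) ((\<lambda>(i, j) \<omega>. Y \<omega> i j) (i, j))"
    using assms(2) unfolding indep_vars_def2 by blast
  then show ?thesis by simp
qed

lemma rdpg_expectation:
  assumes M: "prob_space M" and Y: "rdpg M n X Y" and ij: "(i, j) \<in> upper_pairs n"
    and p: "0 \<le> X i \<bullet> X j" "X i \<bullet> X j \<le> 1"
  shows "(\<integral>\<omega>. real (Y \<omega> i j) \<partial>M) = X i \<bullet> X j"
proof -
  have "distr M (count_space UNIV) (\<lambda>\<omega>. Y \<omega> i j) =
      measure_pmf (map_pmf of_bool (bernoulli_pmf (X i \<bullet> X j)))"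
    using Y ij unfolding rdpg_def by auto
  moreover have "(\<integral>\<omega>. real (Y \<omega> i j) \<partial>M) = (\<integral>y. real y \<partial>distr M (count_space UNIV) (\<lambda>\<omega>. Y \<omega> i j))"
    by (rule integral_distr[symmetric]) (use rdpg_measurable[OF Y ij M] in auto)
  ultimately show ?thesis using p by simp
qed

text \<open>
  Hoeffding's inequality: the summands are independent and centred, and their ranges have squared
  lengths \<open>4 / \<delta>\<^sup>2 * (u i)\<^sup>2 * (v j)\<^sup>2\<close>, which add up to at most \<open>4 / \<delta>\<^sup>2\<close>.
\<close>

lemma noise_bilinear_tail:
  fixes u v :: "nat \<Rightarrow> real"
  assumes M: "prob_space M" and Y: "rdpg M n X0 Y"
    and X0: "\<And>i j. i < n \<Longrightarrow> j < n \<Longrightarrow> \<delta> \<le> X0 i \<bullet> X0 j \<and> X0 i \<bullet> X0 j \<le> 1 - \<delta>"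
    and \<delta>: "0 < \<delta>" and u: "L2_set u {..<n} \<le> 1" and v: "L2_set v {..<n} \<le> 1" and T: "T > 0"
  shows "{\<omega> \<in> space M. T \<le> \<bar>\<Sum>(i, j)\<in>upper_pairs n. noise X0 (Y \<omega>) i j * (u i * v j)\<bar>} \<in> sets M"
    and "measure M {\<omega> \<in> space M. T \<le> \<bar>\<Sum>(i, j)\<in>upper_pairs n. noise X0 (Y \<omega>) i j * (u i * v j)\<bar>}
      \<le> 2 * exp (- (T\<^sup>2 * \<delta>\<^sup>2 / 2))"
proof -
  interpret prob_space M by (rule M)
  define Z where "Z = (\<lambda>(i, j) \<omega>. noise X0 (Y \<omega>) i j * (u i * v j))"
  define c where "c = (\<lambda>(i, j). \<bar>u i * v j\<bar> / \<delta>)"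
  have Y01: "Y \<omega> i j \<in> {0, 1}" if "\<omega> \<in> space M" "i < n" "j < n" for \<omega> i j
    using Y that unfolding rdpg_def by blast
  have ind: "indep_vars (\<lambda>_. borel) Z (upper_pairs n)"
  proof -
    have "indep_vars (\<lambda>_. count_space UNIV) (\<lambda>(i, j) \<omega>. Y \<omega> i j) (upper_pairs n)"
      using Y unfolding rdpg_def by simp
    then have "indep_vars (\<lambda>_. borel) (\<lambda>ij \<omega>. (\<lambda>(i, j) y. (real y - X0 i \<bullet> X0 j) /
        ((X0 i \<bullet> X0 j) * (1 - X0 i \<bullet> X0 j)) * (u i * v j)) ij ((\<lambda>(i, j) \<omega>. Y \<omega> i j) ij \<omega>)) (upper_pairs n)"
      by (rule indep_vars_compose2) auto
    moreover have "Z = (\<lambda>ij \<omega>. (\<lambda>(i, j) y. (real y - X0 i \<bullet> X0 j) /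
        ((X0 i \<bullet> X0 j) * (1 - X0 i \<bullet> X0 j)) * (u i * v j)) ij ((\<lambda>(i, j) \<omega>. Y \<omega> i j) ij \<omega>))"
      by (intro ext) (auto simp: Z_def noise_def)
    ultimately show ?thesis by (simp only:)
  qed
  have meas: "Z ij \<in> borel_measurable M" if "ij \<in> upper_pairs n" for ij
    using ind that unfolding indep_vars_def2 by auto
  have bnd: "Z ij \<omega> \<in> {- c ij..c ij}" if mem: "ij \<in> upper_pairs n" and \<omega>: "\<omega> \<in> space M" for ij \<omega>
  proof -
    obtain i j where ij: "ij = (i, j)" "i < n" "j < n" by (rule upper_pairsE[OF mem])
    have "\<bar>noise X0 (Y \<omega>) i j\<bar> \<le> 1 / \<delta>"
      using noise_bounds(1)[of "Y \<omega>" i j \<delta> X0] Y01[OF \<omega> ij(2,3)] X0[OF ij(2,3)] \<delta> by auto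
    then have "\<bar>noise X0 (Y \<omega>) i j\<bar> * \<bar>u i * v j\<bar> \<le> 1 / \<delta> * \<bar>u i * v j\<bar>" by (rule mult_right_mono) simp
    then have "\<bar>Z ij \<omega>\<bar> \<le> c ij" by (simp add: Z_def c_def ij abs_mult)
    then show ?thesis by auto
  qed
  have EZ: "expectation (Z ij) = 0" if mem: "ij \<in> upper_pairs n" for ij
  proof -
    obtain i j where ij: "ij = (i, j)" "i < n" "j < n" by (rule upper_pairsE[OF mem])
    have [simp]: "integrable M (\<lambda>\<omega>. real (Y \<omega> i j))"
    proof (rule integrable_const_bound[of _ 1])
      show "AE \<omega> in M. norm (real (Y \<omega> i j)) \<le> 1"
      proof (rule AE_I2)
        fix \<omega> assume "\<omega> \<in> space M"
        then show "norm (real (Y \<omega> i j)) \<le> 1" using Y01[of \<omega> i j] ij by auto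
      qed
      show "(\<lambda>\<omega>. real (Y \<omega> i j)) \<in> borel_measurable M"
        using rdpg_measurable[OF Y mem[unfolded ij(1)] M] by measurable
    qed
    have "expectation (\<lambda>\<omega>. real (Y \<omega> i j) - X0 i \<bullet> X0 j) = 0"
      using rdpg_expectation[OF M Y mem[unfolded ij(1)]] X0[OF ij(2,3)] \<delta> by (simp add: prob_space)
    then show ?thesis by (simp add: ij Z_def noise_def)
  qed
  have sumZ: "(\<Sum>(i, j)\<in>upper_pairs n. noise X0 (Y \<omega>) i j * (u i * v j)) = (\<Sum>ij\<in>upper_pairs n. Z ij \<omega>)" for \<omega>
    by (simp add: Z_def split_beta)
  have [measurable]: "(\<lambda>\<omega>. \<Sum>ij\<in>upper_pairs n. Z ij \<omega>) \<in> borel_measurable M"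
    by (intro borel_measurable_sum meas)
  show "{\<omega> \<in> space M. T \<le> \<bar>\<Sum>(i, j)\<in>upper_pairs n. noise X0 (Y \<omega>) i j * (u i * v j)\<bar>} \<in> sets M"
    unfolding sumZ by measurable
  define V where "V = (\<Sum>ij\<in>upper_pairs n. (c ij - (- c ij))\<^sup>2)"
  have "V \<le> 4 / \<delta>\<^sup>2"
  proof -
    have usq: "(\<Sum>i<n. (w i)\<^sup>2) \<le> 1" if "L2_set w {..<n} \<le> 1" for w
      using that by (simp add: L2_set_def)
    have "V = (\<Sum>(i, j)\<in>upper_pairs n. 4 / \<delta>\<^sup>2 * ((u i)\<^sup>2 * (v j)\<^sup>2))"
      unfolding V_def c_def by (intro sum.cong) (auto simp: power2_eq_square field_simps abs_mult)
    also have "\<dots> \<le> (\<Sum>(i, j)\<in>{..<n} \<times> {..<n}. 4 / \<delta>\<^sup>2 * ((u i)\<^sup>2 * (v j)\<^sup>2))"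
      using upper_pairs_subset by (intro sum_mono2) auto
    also have "\<dots> = 4 / \<delta>\<^sup>2 * ((\<Sum>i<n. (u i)\<^sup>2) * (\<Sum>j<n. (v j)\<^sup>2))"
      by (subst sum_product) (simp only: sum.cartesian_product sum_distrib_left case_prod_unfold)
    also have "\<dots> \<le> 4 / \<delta>\<^sup>2 * 1"
      using usq[OF u] usq[OF v] by (intro mult_left_mono mult_le_one sum_nonneg) auto
    finally show ?thesis by simp
  qed
  show "measure M {\<omega> \<in> space M. T \<le> \<bar>\<Sum>(i, j)\<in>upper_pairs n. noise X0 (Y \<omega>) i j * (u i * v j)\<bar>}
      \<le> 2 * exp (- (T\<^sup>2 * \<delta>\<^sup>2 / 2))"
  proof (cases "V > 0")
    case True
    interpret Hoeffding_ineq M "upper_pairs n" Z "\<lambda>ij. - c ij" c "\<Sum>ij\<in>upper_pairs n. expectation (Z ij)"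
      by unfold_locales (use ind bnd in auto)
    have "prob {\<omega> \<in> space M. \<bar>(\<Sum>ij\<in>upper_pairs n. Z ij \<omega>) - (\<Sum>ij\<in>upper_pairs n. expectation (Z ij))\<bar> \<ge> T}
        \<le> 2 * exp (- 2 * T\<^sup>2 / V)"
      unfolding V_def by (rule Hoeffding_ineq_abs_ge) (use T True in \<open>auto simp: V_def\<close>)
    moreover have "T\<^sup>2 * \<delta>\<^sup>2 / 2 \<le> 2 * T\<^sup>2 / V"
    proof -
      have "V * \<delta>\<^sup>2 \<le> 4" using \<open>V \<le> 4 / \<delta>\<^sup>2\<close> \<delta> by (simp add: field_simps)
      then have "T\<^sup>2 * (V * \<delta>\<^sup>2) \<le> T\<^sup>2 * 4" by (intro mult_left_mono) auto
      then show ?thesis using True by (simp add: field_simps)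
    qed
    ultimately have "prob {\<omega> \<in> space M. \<bar>\<Sum>ij\<in>upper_pairs n. Z ij \<omega>\<bar> \<ge> T} \<le> 2 * exp (- 2 * T\<^sup>2 / V)"
      "exp (- 2 * T\<^sup>2 / V) \<le> exp (- (T\<^sup>2 * \<delta>\<^sup>2 / 2))"
      by (simp_all add: EZ)
    then show ?thesis unfolding sumZ by linarith
  next
    case False
    have "0 \<le> V" unfolding V_def by (intro sum_nonneg) auto
    then have "V = 0" using False by simp
    then have "c ij = 0" if "ij \<in> upper_pairs n" for ij
      using that unfolding V_def by (subst (asm) sum_nonneg_eq_0_iff) auto
    then have "(\<Sum>ij\<in>upper_pairs n. Z ij \<omega>) = 0" if "\<omega> \<in> space M" for \<omega>
      using bnd that by (intro sum.neutral) fastforce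
    then have "{\<omega> \<in> space M. T \<le> \<bar>\<Sum>(i, j)\<in>upper_pairs n. noise X0 (Y \<omega>) i j * (u i * v j)\<bar>} = {}"
      unfolding sumZ using T by auto
    then show ?thesis by (simp only: measure_empty) simp
  qed
qed

text \<open>
  The number \<open>36\<close> pays for the union bound over pairs of net vectors, of which there are at most
  \<open>2 ^ (36 * n)\<close>.
\<close>

lemma noise_bounded_with_high_probability:
  assumes M: "prob_space M" and Y: "rdpg M n X0 Y" and n: "n \<ge> 1"
    and X0: "\<And>i j. i < n \<Longrightarrow> j < n \<Longrightarrow> \<delta> \<le> X0 i \<bullet> X0 j \<and> X0 i \<bullet> X0 j \<le> 1 - \<delta>"
    and \<delta>: "0 < \<delta>" and a: "a \<ge> 0"
  shows "\<exists>B\<in>sets M. measure M B \<le> 2 * exp (- (a * real n)) \<and>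
    (\<forall>\<omega>\<in>space M - B. noise_bounded n X0 (Y \<omega>) (2 * (sqrt (2 * (36 + a)) / \<delta>)))"
proof -
  interpret prob_space M by (rule M)
  define \<tau> where "\<tau> = sqrt (2 * (36 + a)) / \<delta>"
  define T where "T = \<tau> * sqrt (real n)"
  have \<tau>: "\<tau> > 0" using \<delta> a by (simp add: \<tau>_def)
  have T: "T > 0" using \<tau> n by (simp add: T_def)
  have T2: "T\<^sup>2 * \<delta>\<^sup>2 / 2 = (36 + a) * real n"
    using \<delta> a by (simp add: T_def \<tau>_def power_mult_distrib power_divide)
  define N where "N = {k \<in> integer_net n. L2_set (net_vector n k) {..<n} \<le> 1}"
  have finN: "finite N" by (simp add: N_def)
  define bad where "bad = (\<lambda>(k, l). {\<omega> \<in> space M. T \<le> \<bar>\<Sum>(i, j)\<in>upper_pairs n.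
    noise X0 (Y \<omega>) i j * (net_vector n k i * net_vector n l j)\<bar>})"
  have bad: "bad kl \<in> sets M" "measure M (bad kl) \<le> 2 * exp (- ((36 + a) * real n))" if "kl \<in> N \<times> N" for kl
    using that noise_bilinear_tail[OF M Y X0 \<delta> _ _ T] unfolding bad_def N_def T2[symmetric]
    by (auto split: prod.splits)
  define B where "B = (\<Union>kl\<in>N \<times> N. bad kl)"
  have Bs: "B \<in> sets M" unfolding B_def using finN bad by (intro sets.finite_UN) auto
  have "measure M B \<le> (\<Sum>kl\<in>N \<times> N. measure M (bad kl))"
    unfolding B_def using finN bad by (intro finite_measure_subadditive_finite) auto
  also have "\<dots> \<le> (\<Sum>kl\<in>N \<times> N. 2 * exp (- ((36 + a) * real n)))" by (intro sum_mono bad)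
  also have "\<dots> = (real (card N))\<^sup>2 * (2 * exp (- ((36 + a) * real n)))"
    by (simp add: card_cartesian_product power2_eq_square)
  also have "\<dots> \<le> exp (36 * real n) * (2 * exp (- ((36 + a) * real n)))"
  proof (intro mult_right_mono)
    have "card N \<le> card (integer_net n)" unfolding N_def by (intro card_mono) auto
    then have "real (card N) \<le> 2 ^ (18 * n)" using card_integer_net_le[of n] by linarith
    then have "(real (card N))\<^sup>2 \<le> (2 ^ (18 * n))\<^sup>2" by (intro power_mono) auto
    also have "\<dots> = 2 ^ (36 * n)" by (simp flip: power_mult)
    also have "\<dots> \<le> (exp 1 :: real) ^ (36 * n)" using exp_ge_add_one_self[of 1] by (intro power_mono) auto
    also have "\<dots> = exp (36 * real n)" by (simp flip: exp_of_nat_mult)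
    finally show "(real (card N))\<^sup>2 \<le> exp (36 * real n)" .
  qed auto
  also have "\<dots> = 2 * exp (- (a * real n))" by (simp add: algebra_simps flip: exp_add)
  finally have PB: "measure M B \<le> 2 * exp (- (a * real n))" .
  have "noise_bounded n X0 (Y \<omega>) (2 * \<tau>)" if \<omega>: "\<omega> \<in> space M - B" for \<omega>
    unfolding noise_bounded_def
  proof (intro allI)
    fix u v
    have "\<bar>\<Sum>(i, j)\<in>upper_pairs n. noise X0 (Y \<omega>) i j * (u i * v j)\<bar>
        \<le> 2 * T * (L2_set u {..<n} * L2_set v {..<n})"
    proof (rule bilinear_bound_from_net[OF upper_pairs_subset n less_imp_le[OF T]])
      fix k l
      assume "k \<in> integer_net n" "l \<in> integer_net n"
        "L2_set (net_vector n k) {..<n} \<le> 1" "L2_set (net_vector n l) {..<n} \<le> 1"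
      then have "(k, l) \<in> N \<times> N" by (simp add: N_def)
      then have "\<omega> \<notin> bad (k, l)" using \<omega> unfolding B_def by blast
      then show "\<bar>\<Sum>(i, j)\<in>upper_pairs n. noise X0 (Y \<omega>) i j * (net_vector n k i * net_vector n l j)\<bar> \<le> T"
        using \<omega> unfolding bad_def by (simp only: prod.case) (simp add: not_le)
    qed
    then show "\<bar>\<Sum>(i, j)\<in>upper_pairs n. noise X0 (Y \<omega>) i j * (u i * v j)\<bar>
        \<le> 2 * \<tau> * sqrt (real n) * (L2_set u {..<n} * L2_set v {..<n})"
      by (simp add: T_def mult_ac)
  qed
  then show ?thesis using Bs PB unfolding \<tau>_def by blast
qed

section \<open>Prior integrals of Gaussians and boxes\<close>

lemma nn_integral_gaussian_1d:
  fixes s \<mu> :: real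
  assumes s: "s > 0"
  shows "(\<integral>\<^sup>+x. ennreal (exp (- (s * (x - \<mu>)\<^sup>2))) \<partial>lborel) = ennreal (sqrt (pi / s))"
proof -
  define \<sigma> where "\<sigma> = sqrt (1 / (2 * s))"
  have \<sigma>: "\<sigma> > 0" "2 * \<sigma>\<^sup>2 = 1 / s" using s by (auto simp: \<sigma>_def)
  have eq: "exp (- (s * (x - \<mu>)\<^sup>2)) = sqrt (pi / s) * normal_density \<mu> \<sigma> x" for x
  proof -
    have "2 * pi * \<sigma>\<^sup>2 = pi / s" using \<sigma>(2) by (simp add: algebra_simps)
    moreover have "(x - \<mu>)\<^sup>2 / (2 * \<sigma>\<^sup>2) = s * (x - \<mu>)\<^sup>2" unfolding \<sigma>(2) by simp
    moreover have "sqrt (pi / s) \<noteq> 0" using s by simp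
    ultimately show ?thesis
      unfolding normal_density_def by (simp add: minus_divide_left[symmetric])
  qed
  have "(\<integral>\<^sup>+x. ennreal (exp (- (s * (x - \<mu>)\<^sup>2))) \<partial>lborel) =
      (\<integral>\<^sup>+x. ennreal (sqrt (pi / s)) * ennreal (normal_density \<mu> \<sigma> x) \<partial>lborel)"
    unfolding eq using s by (simp add: ennreal_mult)
  also have "\<dots> = ennreal (sqrt (pi / s)) * (\<integral>\<^sup>+x. ennreal (normal_density \<mu> \<sigma> x) \<partial>lborel)"
    by (rule nn_integral_cmult) simp
  also have "(\<integral>\<^sup>+x. ennreal (normal_density \<mu> \<sigma> x) \<partial>lborel) = 1"
    using \<sigma> by (subst nn_integral_eq_integral) auto
  finally show ?thesis by simp
qed

lemma nn_integral_gaussian: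
  fixes b :: "real ^ 'd"
  assumes s: "s > 0"
  shows "(\<integral>\<^sup>+x. ennreal (exp (- (s * (norm (x - b))\<^sup>2))) \<partial>lborel) = ennreal (sqrt (pi / s) ^ CARD('d))"
proof -
  have "(norm (x - b))\<^sup>2 = (\<Sum>i\<in>Basis. (x \<bullet> i - b \<bullet> i)\<^sup>2)" for x
    unfolding power2_norm_eq_inner
    by (subst euclidean_inner) (simp add: inner_diff_left power2_eq_square)
  then have "ennreal (exp (- (s * (norm (x - b))\<^sup>2))) =
      (\<Prod>i\<in>Basis. ennreal (exp (- (s * (x \<bullet> i - b \<bullet> i)\<^sup>2))))" for x
    by (simp add: prod_ennreal exp_sum[symmetric] sum_distrib_left sum_negf)
  then have "(\<integral>\<^sup>+x. ennreal (exp (- (s * (norm (x - b))\<^sup>2))) \<partial>lborel) =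
      (\<integral>\<^sup>+x. (\<Prod>i\<in>Basis. ennreal (exp (- (s * (x \<bullet> i - b \<bullet> i)\<^sup>2)))) \<partial>lborel)"
    by simp
  also have "\<dots> = (\<Prod>i\<in>(Basis :: (real ^ 'd) set). ennreal (sqrt (pi / s)))"
    by (subst nn_integral_lborel_prod) (simp_all add: nn_integral_gaussian_1d[OF s])
  also have "\<dots> = ennreal (sqrt (pi / s) ^ CARD('d))"
    using s by (simp add: ennreal_power)
  finally show ?thesis .
qed

lemma latent_space_closed: "closed (latent_space :: (real ^ 'd) set)"
proof -
  have "latent_space = cball (0 :: real ^ 'd) 1 \<inter> (\<Inter>a. {x. 0 \<le> x $ a})"
    by (auto simp: latent_space_def)
  moreover have "closed \<dots>" by (intro closed_Int closed_INT ballI closed_Collect_le continuous_intros) auto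
  ultimately show ?thesis by simp
qed

lemma latent_matrices_measurable:
  "(latent_matrices n :: (nat \<Rightarrow> real ^ 'd) set) \<in> sets (prior n \<pi>)"
  unfolding latent_matrices_def prior_def
  by (intro sets_PiM_I_finite) (auto intro: borel_closed latent_space_closed)

lemma row_measurable [measurable]: "i < n \<Longrightarrow> (\<lambda>X. X i) \<in> borel_measurable (prior n \<pi>)"
proof -
  assume "i < n"
  then have "(\<lambda>X. X i) \<in> measurable (prior n \<pi>) (density lborel (\<lambda>x. ennreal (\<pi> x)))"
    unfolding prior_def by (intro measurable_component_singleton) auto
  then show ?thesis by (simp cong: measurable_cong_sets)
qed

lemma prior_density_bounds:
  assumes "prior_density \<pi>"
  obtains c C where "0 < c" "0 < C" "\<forall>x\<in>latent_space. c \<le> \<pi> x" "\<forall>x. \<pi> x \<le> C"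
proof -
  from assms obtain c C where cC: "0 < c" "\<And>x. x \<in> latent_space \<Longrightarrow> c \<le> \<pi> x \<and> \<pi> x \<le> C"
    "\<And>x. x \<notin> latent_space \<Longrightarrow> \<pi> x = 0" unfolding prior_density_def by blast
  have "0 \<in> (latent_space :: (real ^ 'a) set)" by (simp add: latent_space_def)
  then have "0 < C" using cC by (meson less_le_trans order_trans)
  moreover have "\<pi> x \<le> C" for x using cC \<open>0 < C\<close> by (cases "x \<in> latent_space") auto
  ultimately show ?thesis using cC by (intro that[of c C]) auto
qed

lemma product_sigma_finite_prior:
  assumes "prior_density \<pi>"
  shows "product_sigma_finite (\<lambda>_ :: nat. density lborel (\<lambda>x. ennreal (\<pi> x)))"
  using assms unfolding prior_density_def product_sigma_finite_def
  by (auto intro: prob_space_imp_sigma_finite)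

lemma prob_space_prior:
  assumes "prior_density \<pi>"
  shows "prob_space (prior n \<pi>)"
  unfolding prior_def using assms by (intro prob_space_PiM) (auto simp: prior_density_def)

lemma AE_prior_latent:
  fixes \<pi> :: "real ^ 'd \<Rightarrow> real"
  assumes \<pi>: "prior_density \<pi>"
  shows "AE X in prior n \<pi>. X \<in> latent_matrices n"
proof -
  interpret P: prob_space "prior n \<pi>" by (rule prob_space_prior[OF \<pi>])
  interpret product_sigma_finite "\<lambda>_ :: nat. density lborel (\<lambda>x. ennreal (\<pi> x))"
    by (rule product_sigma_finite_prior[OF \<pi>])
  interpret D: prob_space "density lborel (\<lambda>x. ennreal (\<pi> x))"
    using \<pi> by (simp add: prior_density_def)
  have [measurable]: "\<pi> \<in> borel_measurable borel" using \<pi> by (simp add: prior_density_def)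
  have lm: "latent_space \<in> sets (lborel :: (real ^ 'd) measure)"
    by (simp add: borel_closed latent_space_closed)
  have "emeasure (density lborel (\<lambda>x. ennreal (\<pi> x))) latent_space = emeasure (density lborel (\<lambda>x. ennreal (\<pi> x))) (space lborel)"
    using \<pi> lm by (simp add: emeasure_density)
      (intro nn_integral_cong, auto simp: prior_density_def indicator_def)
  also have "\<dots> = 1" using D.emeasure_space_1 by simp
  finally have one: "emeasure (density lborel (\<lambda>x. ennreal (\<pi> x))) latent_space = 1" .
  have "emeasure (prior n \<pi>) (latent_matrices n) = 1"
    unfolding prior_def latent_matrices_def using lm one by (subst emeasure_PiM) auto
  then have "P.prob (latent_matrices n) = 1" by (simp add: P.emeasure_eq_measure)
  then show ?thesis using P.prob_eq_1[OF latent_matrices_measurable] by simp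
qed

text \<open>
  With \<open>s\<close> proportional to \<open>n\<close>, each row contributes a factor of order \<open>n\<close> to the power \<open>- d / 2\<close>, the
  same as a box of side proportional to \<open>1 / sqrt n\<close>.
\<close>

lemma prior_gaussian_integral_le:
  fixes b :: "nat \<Rightarrow> real ^ 'd"
  assumes \<pi>: "prior_density \<pi>" and C: "\<And>x. \<pi> x \<le> C" "0 < C" and s: "s > 0"
  shows "(\<integral>\<^sup>+X. ennreal (exp (- (s * (\<Sum>i<n. (norm (X i - b i))\<^sup>2)))) \<partial>prior n \<pi>)
    \<le> ennreal ((C * sqrt (pi / s) ^ CARD('d)) ^ n)"
proof -
  interpret product_sigma_finite "\<lambda>_ :: nat. density lborel (\<lambda>x. ennreal (\<pi> x))"
    by (rule product_sigma_finite_prior[OF \<pi>])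
  have [measurable]: "\<pi> \<in> borel_measurable borel" using \<pi> by (simp add: prior_density_def)
  have one: "(\<integral>\<^sup>+x. ennreal (exp (- (s * (norm (x - b i))\<^sup>2))) \<partial>density lborel (\<lambda>x. ennreal (\<pi> x)))
      \<le> ennreal (C * sqrt (pi / s) ^ CARD('d))" for i
  proof -
    have "(\<integral>\<^sup>+x. ennreal (exp (- (s * (norm (x - b i))\<^sup>2))) \<partial>density lborel (\<lambda>x. ennreal (\<pi> x)))
      = (\<integral>\<^sup>+x. ennreal (\<pi> x) * ennreal (exp (- (s * (norm (x - b i))\<^sup>2))) \<partial>lborel)"
      by (rule nn_integral_density) auto
    also have "\<dots> \<le> (\<integral>\<^sup>+x. ennreal C * ennreal (exp (- (s * (norm (x - b i))\<^sup>2))) \<partial>lborel)"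
      using C by (intro nn_integral_mono mult_right_mono ennreal_leI) auto
    also have "\<dots> = ennreal C * ennreal (sqrt (pi / s) ^ CARD('d))"
      by (subst nn_integral_cmult) (simp_all add: nn_integral_gaussian[OF s])
    also have "\<dots> = ennreal (C * sqrt (pi / s) ^ CARD('d))" using C s by (simp add: ennreal_mult)
    finally show ?thesis .
  qed
  have "ennreal (exp (- (s * (\<Sum>i<n. (norm (X i - b i))\<^sup>2)))) =
      (\<Prod>i<n. ennreal (exp (- (s * (norm (X i - b i))\<^sup>2))))" for X
    by (simp add: prod_ennreal exp_sum[symmetric] sum_distrib_left sum_negf)
  then have "(\<integral>\<^sup>+X. ennreal (exp (- (s * (\<Sum>i<n. (norm (X i - b i))\<^sup>2)))) \<partial>prior n \<pi>) =
      (\<integral>\<^sup>+X. (\<Prod>i<n. ennreal (exp (- (s * (norm (X i - b i))\<^sup>2)))) \<partial>prior n \<pi>)" by simp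
  also have "\<dots> = (\<Prod>i<n. \<integral>\<^sup>+x. ennreal (exp (- (s * (norm (x - b i))\<^sup>2))) \<partial>density lborel (\<lambda>x. ennreal (\<pi> x)))"
    unfolding prior_def by (rule product_nn_integral_prod) auto
  also have "\<dots> \<le> (\<Prod>i<n. ennreal (C * sqrt (pi / s) ^ CARD('d)))"
    by (intro prod_mono_ennreal one)
  also have "\<dots> = ennreal ((C * sqrt (pi / s) ^ CARD('d)) ^ n)"
    using C s by (simp add: ennreal_power)
  finally show ?thesis .
qed

lemma prior_box_ge:
  fixes a :: "nat \<Rightarrow> real ^ 'd"
  assumes \<pi>: "prior_density \<pi>" and c: "\<And>x. x \<in> latent_space \<Longrightarrow> c \<le> \<pi> x" "0 < c" and h: "h \<ge> 0"
    and sub: "\<And>i. i < n \<Longrightarrow> cbox (a i) (a i + (\<chi> k. h)) \<subseteq> latent_space"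
  shows "(\<Pi>\<^sub>E i\<in>{..<n}. cbox (a i) (a i + (\<chi> k. h))) \<in> sets (prior n \<pi>)"
    and "ennreal ((c * h ^ CARD('d)) ^ n) \<le>
      emeasure (prior n \<pi>) (\<Pi>\<^sub>E i\<in>{..<n}. cbox (a i) (a i + (\<chi> k. h)))"
proof -
  interpret product_sigma_finite "\<lambda>_ :: nat. density lborel (\<lambda>x. ennreal (\<pi> x))"
    by (rule product_sigma_finite_prior[OF \<pi>])
  have [measurable]: "\<pi> \<in> borel_measurable borel" using \<pi> by (simp add: prior_density_def)
  have one: "ennreal (c * h ^ CARD('d)) \<le>
     emeasure (density lborel (\<lambda>x. ennreal (\<pi> x))) (cbox (a i) (a i + (\<chi> k. h)))" if i: "i < n" for i
  proof -
    have vol: "emeasure lborel (cbox (a i) (a i + (\<chi> k. h))) = ennreal (h ^ CARD('d))"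
    proof -
      have "(\<chi> k. h) \<bullet> b = h" if "b \<in> (Basis :: (real ^ 'd) set)" for b
        using that by (auto simp: Basis_vec_def inner_axis)
      then show ?thesis using h
        by (subst emeasure_lborel_cbox) (auto simp: inner_add_left)
    qed
    have "ennreal (c * h ^ CARD('d)) = ennreal c * emeasure lborel (cbox (a i) (a i + (\<chi> k. h)))"
      unfolding vol using c h by (simp add: ennreal_mult)
    also have "\<dots> = (\<integral>\<^sup>+x. ennreal c * indicator (cbox (a i) (a i + (\<chi> k. h))) x \<partial>lborel)"
      by (subst nn_integral_cmult_indicator) auto
    also have "\<dots> \<le> (\<integral>\<^sup>+x. ennreal (\<pi> x) * indicator (cbox (a i) (a i + (\<chi> k. h))) x \<partial>lborel)"
      using c(1) sub[OF i] by (intro nn_integral_mono) (auto simp: indicator_def intro!: ennreal_leI)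
    also have "\<dots> = emeasure (density lborel (\<lambda>x. ennreal (\<pi> x))) (cbox (a i) (a i + (\<chi> k. h)))"
      by (rule emeasure_density[symmetric]) auto
    finally show ?thesis .
  qed
  show "(\<Pi>\<^sub>E i\<in>{..<n}. cbox (a i) (a i + (\<chi> k. h))) \<in> sets (prior n \<pi>)"
    unfolding prior_def by (intro sets_PiM_I_finite) auto
  have "ennreal ((c * h ^ CARD('d)) ^ n) = (\<Prod>i<n. ennreal (c * h ^ CARD('d)))"
    using c h by (simp add: ennreal_power)
  also have "\<dots> \<le> (\<Prod>i<n. emeasure (density lborel (\<lambda>x. ennreal (\<pi> x))) (cbox (a i) (a i + (\<chi> k. h))))"
    using one by (intro prod_mono_ennreal) auto
  also have "\<dots> = emeasure (prior n \<pi>) (\<Pi>\<^sub>E i\<in>{..<n}. cbox (a i) (a i + (\<chi> k. h)))"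
    unfolding prior_def by (subst emeasure_PiM) auto
  finally show "ennreal ((c * h ^ CARD('d)) ^ n) \<le>
      emeasure (prior n \<pi>) (\<Pi>\<^sub>E i\<in>{..<n}. cbox (a i) (a i + (\<chi> k. h)))" .
qed

text \<open>
  The latent space is convex and contains the cube \<open>[0, 1 / d]\<^sup>d\<close>, hence also the cube scaled by \<open>\<rho>\<close> and
  moved by \<open>(1 - \<rho>) x\<close>. This gives a box of volume of order \<open>\<rho>\<^sup>d\<close> near \<open>x\<close>, also when \<open>x\<close> lies on the
  boundary.
\<close>

lemma prior_near_latent_point:
  fixes x :: "real ^ 'd"
  assumes x: "x \<in> latent_space" and \<rho>: "0 \<le> \<rho>" "\<rho> \<le> 1"
    and y: "y \<in> cbox ((1 - \<rho>) *\<^sub>R x) ((1 - \<rho>) *\<^sub>R x + (\<chi> k. \<rho> / real CARD('d)))"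
  shows "y \<in> latent_space" "norm (y - x) \<le> 2 * \<rho>"
proof -
  define z where "z = y - (1 - \<rho>) *\<^sub>R x"
  have z: "0 \<le> z $ k" "z $ k \<le> \<rho> / real CARD('d)" for k
    using y by (auto simp: z_def mem_box_cart algebra_simps)
  have "norm z \<le> (\<Sum>k\<in>UNIV. \<bar>z $ k\<bar>)" by (rule norm_le_l1_cart)
  also have "\<dots> \<le> (\<Sum>k\<in>(UNIV :: 'd set). \<rho> / real CARD('d))" using z by (intro sum_mono) auto
  also have "\<dots> = \<rho>" by simp
  finally have nz: "norm z \<le> \<rho>" .
  have nx: "norm x \<le> 1" "0 \<le> x $ k" for k using x by (auto simp: latent_space_def)
  have y': "y = (1 - \<rho>) *\<^sub>R x + z" by (simp add: z_def)
  have "norm y \<le> (1 - \<rho>) * norm x + norm z"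
    unfolding y' using \<rho> norm_triangle_ineq[of "(1 - \<rho>) *\<^sub>R x" z] by simp
  also have "\<dots> \<le> (1 - \<rho>) * 1 + \<rho>" using nx nz \<rho> by (intro add_mono mult_left_mono) auto
  finally have "norm y \<le> 1" by simp
  moreover have "0 \<le> y $ k" for k using nx(2) z(1) \<rho> by (simp add: y')
  ultimately show "y \<in> latent_space" by (simp add: latent_space_def)
  have "y - x = z - \<rho> *\<^sub>R x" by (simp add: y' algebra_simps)
  then have "norm (y - x) \<le> norm z + norm (\<rho> *\<^sub>R x)"
    using norm_triangle_ineq4[of z "\<rho> *\<^sub>R x"] by simp
  also have "\<dots> \<le> \<rho> + \<rho> * 1" unfolding norm_scaleR abs_of_nonneg[OF \<rho>(1)]
    using nz nx(1) \<rho> by (intro add_mono mult_left_mono) auto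
  finally show "norm (y - x) \<le> 2 * \<rho>" by simp
qed

section \<open>Posterior mass far from the truth\<close>

definition matrix_net :: "nat \<Rightarrow> (real ^ 'd ^ 'd) set" where
  "matrix_net n = (\<lambda>k. \<chi> a b. real_of_int (k (a, b)) / real n) ` (UNIV \<rightarrow>\<^sub>E {- int n..int n})"

lemma finite_matrix_net [simp]: "finite (matrix_net n)"
  unfolding matrix_net_def by (intro finite_imageI finite_PiE) auto

lemma card_matrix_net_le:
  "real (card (matrix_net n :: (real ^ 'd ^ 'd) set)) \<le> (2 * real n + 1) ^ (CARD('d) * CARD('d))"
proof -
  have "card (matrix_net n :: (real ^ 'd ^ 'd) set) \<le> card ((UNIV :: ('d \<times> 'd) set) \<rightarrow>\<^sub>E {- int n..int n})"
    unfolding matrix_net_def by (intro card_image_le finite_PiE) auto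
  also have "\<dots> = (2 * n + 1) ^ (CARD('d) * CARD('d))"
    by (simp add: card_PiE nat_add_distrib nat_mult_distrib)
  finally have "real (card (matrix_net n :: (real ^ 'd ^ 'd) set)) \<le> real ((2 * n + 1) ^ (CARD('d) * CARD('d)))"
    by (simp only: of_nat_le_iff)
  then show ?thesis by (simp add: add.commute)
qed

lemma matrix_net_dense:
  fixes W :: "real ^ 'd ^ 'd"
  assumes W: "orthogonal_matrix W" and n: "n \<ge> 1"
  shows "\<exists>B\<in>matrix_net n. \<forall>a b. \<bar>(W - B) $ a $ b\<bar> \<le> 1 / real n"
proof -
  have Wab: "\<bar>W $ a $ b\<bar> \<le> 1" for a b
  proof -
    have "norm (W $ a) = 1"
      using W by (simp add: orthogonal_matrix_orthonormal_rows row_def vec_lambda_eta)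
    then show ?thesis using component_le_norm_cart[of "W $ a" b] by simp
  qed
  define k where "k = (\<lambda>(a, b). \<lfloor>real n * W $ a $ b\<rfloor>)"
  define B :: "real ^ 'd ^ 'd" where "B = (\<chi> a b. real_of_int (k (a, b)) / real n)"
  have kb: "k (a, b) \<in> {- int n..int n}" for a b
  proof -
    have "\<bar>real n * W $ a $ b\<bar> \<le> real n" using Wab[of a b] by (simp add: abs_mult mult_left_le)
    then show ?thesis by (auto simp: k_def le_floor_iff floor_le_iff)
  qed
  then have "B \<in> matrix_net n" unfolding matrix_net_def B_def by (intro image_eqI[of _ _ k]) auto
  moreover have "\<bar>(W - B) $ a $ b\<bar> \<le> 1 / real n" for a b
  proof -
    have "\<bar>real n * W $ a $ b - real_of_int (k (a, b))\<bar> \<le> 1" by (simp add: k_def) linarith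
    then have "\<bar>real n * (W - B) $ a $ b\<bar> \<le> 1" using n by (simp add: B_def right_diff_distrib)
    then have "\<bar>(W - B) $ a $ b\<bar> * real n \<le> 1" by (simp only: abs_mult) (simp add: mult.commute)
    then show ?thesis using n by (simp add: pos_le_divide_eq)
  qed
  ultimately show ?thesis by blast
qed

lemma norm_vector_matrix_mult_le:
  fixes M :: "real ^ 'd ^ 'd"
  assumes "\<And>a b. \<bar>M $ a $ b\<bar> \<le> h"
  shows "norm (x v* M) \<le> (real CARD('d))\<^sup>2 * h * norm x"
proof -
  have "norm (x v* M) \<le> norm (transpose M) * norm x"
    using norm_matrix_vector_mult_le[of "transpose M" x] by simp
  also have "norm (transpose M) \<le> (\<Sum>a\<in>UNIV. norm (transpose M $ a))"
    unfolding norm_vec_def[of "transpose M"] by (rule L2_set_le_sum) simp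
  also have "\<dots> \<le> (\<Sum>a\<in>(UNIV :: 'd set). \<Sum>b\<in>(UNIV :: 'd set). h)"
  proof (rule sum_mono)
    fix a
    have "norm (transpose M $ a) \<le> (\<Sum>b\<in>UNIV. \<bar>transpose M $ a $ b\<bar>)" by (rule norm_le_l1_cart)
    also have "\<dots> \<le> (\<Sum>b\<in>(UNIV :: 'd set). h)" using assms by (intro sum_mono) (simp add: transpose_def)
    finally show "norm (transpose M $ a) \<le> (\<Sum>b\<in>(UNIV :: 'd set). h)" .
  qed
  also have "\<dots> = (real CARD('d))\<^sup>2 * h" by (simp add: power2_eq_square)
  finally show ?thesis by (simp add: mult_right_mono)
qed

text \<open>
  The mesh \<open>1 / n\<close> changes \<open>X0 W\<close> by a bounded amount in Frobenius norm, although \<open>X0\<close> has \<open>n\<close> rows.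
\<close>

lemma distance_to_net_rotation:
  fixes X X0 :: "nat \<Rightarrow> real ^ 'd" and W :: "real ^ 'd ^ 'd"
  assumes X0: "\<And>i. i < n \<Longrightarrow> norm (X0 i) \<le> 1" and n: "n \<ge> 1"
    and B: "\<And>a b. \<bar>(W - B) $ a $ b\<bar> \<le> 1 / real n"
  shows "(\<Sum>i<n. (norm (X i - X0 i v* B))\<^sup>2) \<le> 2 * (\<Sum>i<n. (norm (X i - X0 i v* W))\<^sup>2) + 2 * real CARD('d) ^ 4"
proof -
  let ?d = "real CARD('d)"
  have "(norm (X i - X0 i v* B))\<^sup>2 \<le> 2 * (norm (X i - X0 i v* W))\<^sup>2 + 2 * (?d ^ 4 / real n)" if i: "i < n" for i
  proof -
    have "X i - X0 i v* B = (X i - X0 i v* W) + X0 i v* (W - B)"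
      by (simp add: vector_matrix_mult_def vec_eq_iff algebra_simps sum_subtractf)
    then have "(norm (X i - X0 i v* B))\<^sup>2 \<le> 2 * (norm (X i - X0 i v* W))\<^sup>2 + 2 * (norm (X0 i v* (W - B)))\<^sup>2"
      using power2_norm_add_le by metis
    moreover have "(norm (X0 i v* (W - B)))\<^sup>2 \<le> (?d\<^sup>2 * (1 / real n))\<^sup>2"
    proof (intro power_mono)
      have "norm (X0 i v* (W - B)) \<le> ?d\<^sup>2 * (1 / real n) * norm (X0 i)"
        by (rule norm_vector_matrix_mult_le) (rule B)
      also have "\<dots> \<le> ?d\<^sup>2 * (1 / real n) * 1" using X0[OF i] by (intro mult_left_mono) auto
      finally show "norm (X0 i v* (W - B)) \<le> ?d\<^sup>2 * (1 / real n)" by simp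
    qed simp
    moreover have "(?d\<^sup>2 * (1 / real n))\<^sup>2 \<le> ?d ^ 4 / real n"
    proof -
      have "(?d\<^sup>2 * (1 / real n))\<^sup>2 = (?d ^ 4 / real n) * (1 / real n)"
        by (simp add: power2_eq_square power4_eq_xxxx)
      also have "\<dots> \<le> (?d ^ 4 / real n) * 1" using n by (intro mult_left_mono) auto
      finally show ?thesis by simp
    qed
    ultimately show ?thesis by linarith
  qed
  then have "(\<Sum>i<n. (norm (X i - X0 i v* B))\<^sup>2) \<le>
      (\<Sum>i<n. 2 * (norm (X i - X0 i v* W))\<^sup>2 + 2 * (?d ^ 4 / real n))" by (intro sum_mono) auto
  also have "\<dots> = 2 * (\<Sum>i<n. (norm (X i - X0 i v* W))\<^sup>2) + 2 * ?d ^ 4"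
    using n by (simp add: sum.distrib flip: sum_distrib_left)
  finally show ?thesis .
qed

lemma latent_inner:
  assumes "x \<in> latent_space" "y \<in> latent_space"
  shows "0 \<le> x \<bullet> y" "x \<bullet> y \<le> 1"
proof -
  show "0 \<le> x \<bullet> y" using assms by (auto simp: latent_space_def inner_vec_def intro!: sum_nonneg)
  have "x \<bullet> y \<le> norm x * norm y" by (rule norm_cauchy_schwarz)
  also have "\<dots> \<le> 1" using assms by (intro mult_le_one) (auto simp: latent_space_def)
  finally show "x \<bullet> y \<le> 1" .
qed

lemma latent_matrices_row: "X \<in> latent_matrices n \<Longrightarrow> i < n \<Longrightarrow> X i \<in> latent_space"
  by (auto simp: latent_matrices_def)

lemma latent_norm: "x \<in> latent_space \<Longrightarrow> norm x \<le> 1"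
  by (simp add: latent_space_def)

lemma frob_rows_le_sqrt:
  assumes "\<And>i. i < n \<Longrightarrow> norm (Z i) \<le> c" "c \<ge> 0"
  shows "frob_rows n Z \<le> c * sqrt (real n)"
proof -
  have "(\<Sum>i<n. (norm (Z i))\<^sup>2) \<le> (\<Sum>i<n. c\<^sup>2)" using assms by (intro sum_mono power_mono) auto
  then have "sqrt (\<Sum>i<n. (norm (Z i))\<^sup>2) \<le> sqrt (c\<^sup>2 * real n)"
    by (intro real_sqrt_le_mono) (simp add: mult.commute)
  then show ?thesis using assms(2) by (simp add: frob_rows_def L2_set_def real_sqrt_mult)
qed

lemma orthogonal_matrix_rows:
  fixes W :: "real ^ 'd ^ 'd"
  assumes "orthogonal_matrix W"
  shows "(x v* W) \<bullet> (y v* W) = x \<bullet> y" "norm (x v* W) = norm x"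
proof -
  have WW: "W ** transpose W = mat 1" using assms by (simp add: orthogonal_matrix_def)
  have *: "(x v* W) \<bullet> (y v* W) = x \<bullet> y" for x y
  proof -
    have "(x v* W) \<bullet> (y v* W) = x \<bullet> (W *v (transpose W *v y))" by (simp add: dot_lmul_matrix)
    also have "\<dots> = x \<bullet> y" by (simp only: matrix_vector_mul_assoc WW matrix_vector_mul_lid)
    finally show ?thesis .
  qed
  then show "(x v* W) \<bullet> (y v* W) = x \<bullet> y" "norm (x v* W) = norm x"
    by (simp_all add: norm_eq_sqrt_inner)
qed

text \<open>
  In this locale the graph is fixed. The bound \<open>\<mu>\<close> holds for the spectrum of \<open>X0\<^sup>T X0 / n\<close>, and \<open>C0\<close>
  is the constant of the event on which the noise is under control.
\<close>

locale rdpg_setting =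
  fixes n :: nat and X0 :: "nat \<Rightarrow> real ^ 'd" and Y :: "nat \<Rightarrow> nat \<Rightarrow> nat"
    and \<pi> :: "real ^ 'd \<Rightarrow> real" and \<delta> \<mu> C0 :: real
  assumes n: "n \<ge> 1"
    and Y: "\<And>i j. i < n \<Longrightarrow> j < n \<Longrightarrow> Y i j \<in> {0, 1}"
    and X0: "\<And>i j. i < n \<Longrightarrow> j < n \<Longrightarrow> \<delta> \<le> X0 i \<bullet> X0 j \<and> X0 i \<bullet> X0 j \<le> 1 - \<delta>"
    and X0_latent: "\<And>i. i < n \<Longrightarrow> X0 i \<in> latent_space"
    and \<delta>: "0 < \<delta>" "\<delta> < 1 / 2"
    and \<pi>: "prior_density \<pi>"
    and \<mu>: "\<mu> > 0" "\<And>v. real n * \<mu> * (norm v)\<^sup>2 \<le> (\<Sum>i<n. (X0 i \<bullet> v)\<^sup>2)"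
    and nb: "noise_bounded n X0 Y C0" and C0: "C0 \<ge> 0"
begin

abbreviation gap :: "(nat \<Rightarrow> real ^ 'd) \<Rightarrow> real" where
  "gap X \<equiv> (\<Sum>i<n. \<Sum>j<n. (gram X i j - gram X0 i j)\<^sup>2)"

abbreviation \<kappa> :: real where "\<kappa> \<equiv> \<delta> * \<mu> / 12"

text \<open>
  The linear term for \<open>Z = X0 W\<close> is at most \<open>C0 * sqrt n * (2 * sqrt n * r + r\<^sup>2)\<close>, and \<open>r \<le> 2 * sqrt n\<close>
  absorbs the square.
\<close>

lemma lik_ratio_le:
  assumes X: "X \<in> latent_matrices n" and W: "orthogonal_matrix W"
  defines "r \<equiv> frob_rows n (\<lambda>i. X i - X0 i v* W)"
  shows "lik_ratio n X0 Y X \<le> exp (4 * C0 * real n * r - \<delta> / 4 * gap X)"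
proof -
  define T where "T = (\<Sum>(i, j)\<in>upper_pairs n. noise X0 Y i j * (gram X i j - gram X0 i j))"
  have nZ: "norm (X0 i v* W) \<le> 1" if "i < n" for i
    using latent_norm[OF X0_latent[OF that]] by (simp add: orthogonal_matrix_rows[OF W])
  have "norm (X i - X0 i v* W) \<le> 2" if "i < n" for i
    using norm_triangle_ineq4[of "X i" "X0 i v* W"] nZ[OF that] latent_norm[OF latent_matrices_row[OF X that]]
    by linarith
  then have r2: "r \<le> 2 * sqrt (real n)" unfolding r_def by (rule frob_rows_le_sqrt) auto
  have r0: "r \<ge> 0" by (simp add: r_def frob_rows_def)
  have fZ: "frob_rows n (\<lambda>i. X0 i v* W) \<le> 1 * sqrt (real n)" by (rule frob_rows_le_sqrt) (use nZ in auto)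
  have "T \<le> C0 * sqrt (real n) * (2 * frob_rows n (\<lambda>i. X0 i v* W) * r + r\<^sup>2)"
    unfolding T_def r_def
    by (rule order_trans[OF abs_ge_self noise_bounded_gram[OF nb C0]])
      (simp add: gram_def orthogonal_matrix_rows[OF W])
  also have "\<dots> \<le> C0 * sqrt (real n) * (2 * sqrt (real n) * r + 2 * sqrt (real n) * r)"
    using fZ r2 r0 C0 unfolding power2_eq_square
    by (intro mult_left_mono add_mono mult_right_mono) auto
  also have "\<dots> = 4 * C0 * (sqrt (real n) * sqrt (real n)) * r" by (simp add: algebra_simps)
  also have "\<dots> = 4 * C0 * real n * r" by simp
  finally have T: "T \<le> 4 * C0 * real n * r" .
  have "lik_ratio n X0 Y X \<le> exp (T - \<delta> / 4 * gap X)"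
    unfolding T_def using Y X0 \<delta> latent_inner latent_matrices_row[OF X]
    by (intro lik_ratio_upper_bound(2)) blast+
  then show ?thesis using T by (meson exp_le_cancel_iff order_trans diff_right_mono)
qed

lemma procrustes_gap:
  obtains W where "orthogonal_matrix W"
    "2 / 3 * (real n * \<mu>) * (\<Sum>i<n. (norm (X i - X0 i v* W))\<^sup>2) \<le> gap X"
proof -
  obtain W where "orthogonal_matrix W"
    "2 / 3 * (real n * \<mu>) * (\<Sum>i<n. (norm (X i - X0 i v* W))\<^sup>2) \<le> gap X"
    by (rule procrustes_bound[OF \<mu>(2)])
  then show ?thesis by (rule that)
qed

text \<open>
  Half of the quadratic term pays for \<open>M\<close>. The other half is at least \<open>\<kappa> * n * r\<^sup>2\<close> by Procrustes, where
  \<open>r\<close> is the distance of \<open>X\<close> to the best rotation of \<open>X0\<close>; it absorbs the linear term and leaves a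
  Gaussian in \<open>X\<close>, recentred at a member of the net.
\<close>

lemma lik_ratio_far_le:
  assumes X: "X \<in> latent_matrices n" and far: "M\<^sup>2 * real n \<le> gap X"
  shows "\<exists>B\<in>matrix_net n. lik_ratio n X0 Y X \<le>
    exp (real n * (8 * C0\<^sup>2 / \<kappa> - \<delta> * M\<^sup>2 / 8 + \<kappa> * real CARD('d) ^ 4))
      * exp (- (\<kappa> * real n / 4 * (\<Sum>i<n. (norm (X i - X0 i v* B))\<^sup>2)))"
proof -
  obtain W where W: "orthogonal_matrix W"
    "2 / 3 * (real n * \<mu>) * (\<Sum>i<n. (norm (X i - X0 i v* W))\<^sup>2) \<le> gap X" by (rule procrustes_gap)
  obtain B where B: "B \<in> matrix_net n" "\<And>a b. \<bar>(W - B) $ a $ b\<bar> \<le> 1 / real n"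
    using matrix_net_dense[OF W(1) n] by blast
  define r where "r = frob_rows n (\<lambda>i. X i - X0 i v* W)"
  define q where "q = (\<Sum>i<n. (norm (X i - X0 i v* B))\<^sup>2)"
  have \<kappa>: "\<kappa> > 0" using \<delta> \<mu> by simp
  have q: "q \<le> 2 * r\<^sup>2 + 2 * real CARD('d) ^ 4"
    unfolding q_def r_def frob_rows_power2
    by (rule distance_to_net_rotation[OF latent_norm[OF X0_latent] n B(2)])
  have "\<delta> / 8 * (2 / 3 * (real n * \<mu>) * r\<^sup>2) \<le> \<delta> / 8 * gap X"
    using W(2) \<delta> unfolding r_def frob_rows_power2 by (intro mult_left_mono) auto
  then have g1: "\<kappa> * real n * r\<^sup>2 \<le> \<delta> / 8 * gap X" by (simp add: algebra_simps)
  have g2: "\<delta> / 8 * (M\<^sup>2 * real n) \<le> \<delta> / 8 * gap X" using far \<delta> by (intro mult_left_mono) auto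
  \<comment> \<open>Young's inequality for the linear term.\<close>
  have "0 \<le> (\<kappa> * r - 4 * C0)\<^sup>2 / (2 * \<kappa>)" using \<kappa> by (intro divide_nonneg_pos) auto
  also have "\<dots> = \<kappa> / 2 * r\<^sup>2 - 4 * C0 * r + 8 * C0\<^sup>2 / \<kappa>"
  proof -
    have "(k * r - 4 * C0)\<^sup>2 / (2 * k) = k / 2 * r\<^sup>2 - 4 * C0 * r + 8 * C0\<^sup>2 / k" if "k > 0" for k :: real
      using that by (simp add: field_simps power2_eq_square)
    then show ?thesis using \<kappa> by blast
  qed
  finally have "real n * (4 * C0 * r) \<le> real n * (\<kappa> / 2 * r\<^sup>2 + 8 * C0\<^sup>2 / \<kappa>)"
    by (intro mult_left_mono) auto
  then have t: "4 * C0 * real n * r \<le> \<kappa> * real n * r\<^sup>2 / 2 + real n * (8 * C0\<^sup>2 / \<kappa>)"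
    by (simp add: algebra_simps)
  have "\<kappa> * real n / 4 * q \<le> \<kappa> * real n / 4 * (2 * r\<^sup>2 + 2 * real CARD('d) ^ 4)"
    using q \<kappa> by (intro mult_left_mono) auto
  also have "\<dots> = \<kappa> * real n * r\<^sup>2 / 2 + real n * (\<kappa> * real CARD('d) ^ 4) / 2" by (simp add: algebra_simps)
  finally have u: "\<kappa> * real n / 4 * q \<le> \<kappa> * real n * r\<^sup>2 / 2 + real n * (\<kappa> * real CARD('d) ^ 4) / 2" .
  have v: "0 \<le> real n * (\<kappa> * real CARD('d) ^ 4)" using \<kappa> by simp
  have "4 * C0 * real n * r - \<delta> / 4 * gap X \<le>
     real n * (8 * C0\<^sup>2 / \<kappa>) - \<delta> / 8 * (M\<^sup>2 * real n) + real n * (\<kappa> * real CARD('d) ^ 4) - \<kappa> * real n / 4 * q"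
    using t u g1 g2 v by linarith
  also have "\<dots> = real n * (8 * C0\<^sup>2 / \<kappa> - \<delta> * M\<^sup>2 / 8 + \<kappa> * real CARD('d) ^ 4) + (- (\<kappa> * real n / 4 * q))"
    by (simp add: algebra_simps)
  finally have "exp (4 * C0 * real n * r - \<delta> / 4 * gap X) \<le>
     exp (real n * (8 * C0\<^sup>2 / \<kappa> - \<delta> * M\<^sup>2 / 8 + \<kappa> * real CARD('d) ^ 4)) * exp (- (\<kappa> * real n / 4 * q))"
    by (simp only: exp_add[symmetric] exp_le_cancel_iff)
  with lik_ratio_le[OF X W(1)] B(1) show ?thesis unfolding r_def q_def by (meson order_trans)
qed

text \<open>
  Summation over the net removes the dependence of the centre on \<open>X\<close>, and every single Gaussian
  factorises over the rows.
\<close>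

lemma far_weight_le:
  assumes A: "A \<subseteq> latent_matrices n" and far: "\<And>X. X \<in> A \<Longrightarrow> M\<^sup>2 * real n \<le> gap X"
    and C: "\<And>x. \<pi> x \<le> C" "0 < C"
  shows "posterior_weight n \<pi> X0 Y A \<le>
    ennreal (exp (real n * (8 * C0\<^sup>2 / \<kappa> - \<delta> * M\<^sup>2 / 8 + \<kappa> * real CARD('d) ^ 4))
      * ((2 * real n + 1) ^ (CARD('d) * CARD('d)) * (C * sqrt (pi / (\<kappa> * real n / 4)) ^ CARD('d)) ^ n))"
proof -
  define K where "K = exp (real n * (8 * C0\<^sup>2 / \<kappa> - \<delta> * M\<^sup>2 / 8 + \<kappa> * real CARD('d) ^ 4))"
  define s where "s = \<kappa> * real n / 4"
  define I where "I = (C * sqrt (pi / s) ^ CARD('d)) ^ n"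
  have s: "s > 0" using \<delta> \<mu> n by (simp add: s_def)
  have I: "I \<ge> 0" using C s by (simp add: I_def)
  define f where "f = (\<lambda>(B :: real ^ 'd ^ 'd) (X :: nat \<Rightarrow> real ^ 'd). exp (- (s * (\<Sum>i<n. (norm (X i - X0 i v* B))\<^sup>2))))"
  have fm: "(\<lambda>X. ennreal (f B X)) \<in> borel_measurable (prior n \<pi>)" for B
    unfolding f_def by (intro measurable_compose[OF _ measurable_ennreal] borel_measurable_exp[THEN measurable_compose[rotated]]
      borel_measurable_uminus borel_measurable_times borel_measurable_const borel_measurable_sum borel_measurable_power
      borel_measurable_norm borel_measurable_diff row_measurable) auto
  have "posterior_weight n \<pi> X0 Y A \<le> (\<integral>\<^sup>+X. ennreal K * (\<Sum>B\<in>matrix_net n. ennreal (f B X)) \<partial>prior n \<pi>)"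
    unfolding posterior_weight_def
  proof (rule nn_integral_mono)
    fix X
    show "ennreal (lik_ratio n X0 Y X) * indicator A X \<le> ennreal K * (\<Sum>B\<in>matrix_net n. ennreal (f B X))"
    proof (cases "X \<in> A")
      case True
      then obtain B where B: "B \<in> matrix_net n" "lik_ratio n X0 Y X \<le> K * f B X"
        using lik_ratio_far_le[of X M] A far unfolding K_def f_def s_def by blast
      have "ennreal (lik_ratio n X0 Y X) \<le> ennreal K * ennreal (f B X)"
        using B(2) by (simp add: K_def f_def flip: ennreal_mult)
      also have "ennreal (f B X) \<le> (\<Sum>B\<in>matrix_net n. ennreal (f B X))"
        using B(1) by (intro member_le_sum) auto
      finally show ?thesis using True by (simp add: mult_left_mono)
    qed simp
  qed
  also have "\<dots> = ennreal K * (\<integral>\<^sup>+X. (\<Sum>B\<in>matrix_net n. ennreal (f B X)) \<partial>prior n \<pi>)"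
    by (intro nn_integral_cmult borel_measurable_sum fm)
  also have "(\<integral>\<^sup>+X. (\<Sum>B\<in>matrix_net n. ennreal (f B X)) \<partial>prior n \<pi>) =
      (\<Sum>B\<in>matrix_net n. \<integral>\<^sup>+X. ennreal (f B X) \<partial>prior n \<pi>)"
    by (intro nn_integral_sum fm)
  also have "\<dots> \<le> (\<Sum>B\<in>(matrix_net n :: (real ^ 'd ^ 'd) set). ennreal I)"
    unfolding f_def I_def by (intro sum_mono prior_gaussian_integral_le[OF \<pi> C s])
  also have "\<dots> = ennreal (real (card (matrix_net n :: (real ^ 'd ^ 'd) set)) * I)"
    using I by (simp add: ennreal_mult ennreal_of_nat_eq_real_of_nat)
  also have "\<dots> \<le> ennreal ((2 * real n + 1) ^ (CARD('d) * CARD('d)) * I)"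
    using I card_matrix_net_le by (intro ennreal_leI mult_right_mono) auto
  finally have "posterior_weight n \<pi> X0 Y A \<le> ennreal K * ennreal ((2 * real n + 1) ^ (CARD('d) * CARD('d)) * I)"
    by (simp add: mult_left_mono)
  also have "\<dots> = ennreal (K * ((2 * real n + 1) ^ (CARD('d) * CARD('d)) * I))"
    using I by (simp add: K_def ennreal_mult)
  finally show ?thesis by (simp add: K_def I_def s_def)
qed

text \<open>
  In boxes of side \<open>1 / (sqrt n * d)\<close> around the rows of \<open>X0\<close> the Gram matrix changes by at most
  \<open>4 / sqrt n\<close> in each entry, so that the log-likelihood ratio is at least a negative multiple of \<open>n\<close>.
\<close>

lemma evidence_ge:
  assumes c: "\<And>x. x \<in> latent_space \<Longrightarrow> c \<le> \<pi> x" "0 < c" and large: "64 / \<delta>\<^sup>2 \<le> real n"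
  shows "ennreal (exp (- (real n * (8 * C0 + 32 / \<delta>\<^sup>2))) * (c * (1 / (sqrt (real n) * real CARD('d))) ^ CARD('d)) ^ n)
    \<le> posterior_weight n \<pi> X0 Y (latent_matrices n)"
proof -
  define \<rho> where "\<rho> = 1 / sqrt (real n)"
  have \<rho>: "0 < \<rho>" "\<rho> \<le> 1" "\<rho>\<^sup>2 = 1 / real n" using n by (auto simp: \<rho>_def power_divide)
  have \<rho>\<delta>: "4 * \<rho> \<le> \<delta> / 2"
  proof -
    have "(8 / \<delta>)\<^sup>2 \<le> real n" using large by (simp add: power_divide)
    then have "8 / \<delta> \<le> sqrt (real n)" by (rule real_le_rsqrt)
    then show ?thesis using \<delta> n by (simp add: \<rho>_def field_simps)
  qed
  define a where "a = (\<lambda>i. (1 - \<rho>) *\<^sub>R X0 i)"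
  define h where "h = \<rho> / real CARD('d)"
  define Box where "Box = (\<Pi>\<^sub>E i\<in>{..<n}. cbox (a i) (a i + (\<chi> k. h)))"
  define e where "e = exp (- (real n * (8 * C0 + 32 / \<delta>\<^sup>2)))"
  have near: "y \<in> latent_space" "norm (y - X0 i) \<le> 2 * \<rho>"
    if "i < n" "y \<in> cbox (a i) (a i + (\<chi> k. h))" for i y
    using prior_near_latent_point[of "X0 i" \<rho> y] X0_latent[OF that(1)] \<rho> that(2) by (auto simp: a_def h_def)
  have box: "Box \<in> sets (prior n \<pi>)" "ennreal ((c * h ^ CARD('d)) ^ n) \<le> emeasure (prior n \<pi>) Box"
    unfolding Box_def by (rule prior_box_ge[OF \<pi> c]; use \<rho> near in \<open>auto simp: h_def\<close>)+
  have lik: "e \<le> lik_ratio n X0 Y X" and lat: "X \<in> latent_matrices n" if X: "X \<in> Box" for X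
  proof -
    have row: "X i \<in> latent_space" "norm (X i - X0 i) \<le> 2 * \<rho>" if "i < n" for i
      using X near[OF that] that by (auto simp: Box_def)
    show "X \<in> latent_matrices n" using X row by (auto simp: Box_def latent_matrices_def)
    have dif: "\<bar>gram X i j - gram X0 i j\<bar> \<le> 4 * \<rho>" if ij: "i < n" "j < n" for i j
    proof -
      have "gram X i j - gram X0 i j = X i \<bullet> (X j - X0 j) + (X i - X0 i) \<bullet> X0 j"
        by (simp add: gram_def inner_diff_left inner_diff_right)
      also have "\<bar>\<dots>\<bar> \<le> norm (X i) * norm (X j - X0 j) + norm (X i - X0 i) * norm (X0 j)"
        by (intro order_trans[OF abs_triangle_ineq] add_mono Cauchy_Schwarz_ineq2)
      also have "\<dots> \<le> 1 * (2 * \<rho>) + 2 * \<rho> * 1"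
        using row ij latent_norm X0_latent \<rho> by (intro add_mono mult_mono) auto
      finally show ?thesis by simp
    qed
    have gapX: "gap X \<le> 16 * real n"
    proof -
      have "gap X \<le> (\<Sum>i<n. \<Sum>j<n. (4 * \<rho>)\<^sup>2)"
        using dif by (intro sum_mono) (metis abs_ge_zero lessThan_iff power2_abs power_mono)
      also have "\<dots> = 16 * real n" using n by (simp add: power_mult_distrib \<rho>(3))
      finally show ?thesis .
    qed
    define r where "r = frob_rows n (\<lambda>i. X i - X0 i)"
    have r: "0 \<le> r" "r \<le> 2"
    proof -
      have "r \<le> 2 * \<rho> * sqrt (real n)" unfolding r_def by (rule frob_rows_le_sqrt) (use row \<rho> in auto)
      then show "r \<le> 2" using n by (simp add: \<rho>_def)
    qed (simp add: r_def frob_rows_def)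
    have f0: "frob_rows n X0 \<le> 1 * sqrt (real n)"
      by (rule frob_rows_le_sqrt) (use X0_latent latent_norm in auto)
    have sn: "1 \<le> sqrt (real n)" using n by simp
    have "\<bar>\<Sum>(i, j)\<in>upper_pairs n. noise X0 Y i j * (gram X i j - gram X0 i j)\<bar>
      \<le> C0 * sqrt (real n) * (2 * frob_rows n X0 * r + r\<^sup>2)"
      unfolding r_def by (rule noise_bounded_gram[OF nb C0]) simp
    also have "\<dots> \<le> C0 * sqrt (real n) * (2 * sqrt (real n) * 2 + 2 * 2 * sqrt (real n))"
    proof -
      have "2 * frob_rows n X0 * r \<le> 2 * sqrt (real n) * 2" using f0 r by (intro mult_mono) (auto simp: frob_rows_def)
      moreover have "r\<^sup>2 \<le> 2 * 2" using r unfolding power2_eq_square by (intro mult_mono) auto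
      ultimately have "2 * frob_rows n X0 * r + r\<^sup>2 \<le> 2 * sqrt (real n) * 2 + 2 * 2 * sqrt (real n)"
        using sn by linarith
      then show ?thesis using C0 by (intro mult_left_mono) auto
    qed
    also have "\<dots> = 8 * C0 * (sqrt (real n) * sqrt (real n))" by (simp add: algebra_simps)
    also have "\<dots> = 8 * C0 * real n" by simp
    finally have T: "\<bar>\<Sum>(i, j)\<in>upper_pairs n. noise X0 Y i j * (gram X i j - gram X0 i j)\<bar> \<le> 8 * C0 * real n" .
    have "2 / \<delta>\<^sup>2 * gap X \<le> 2 / \<delta>\<^sup>2 * (16 * real n)" using gapX by (intro mult_left_mono) auto
    then have "- (real n * (8 * C0 + 32 / \<delta>\<^sup>2)) \<le>
      (\<Sum>(i, j)\<in>upper_pairs n. noise X0 Y i j * (gram X i j - gram X0 i j)) - 2 / \<delta>\<^sup>2 * gap X"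
      using T by (simp add: algebra_simps)
    then have "e \<le> exp ((\<Sum>(i, j)\<in>upper_pairs n. noise X0 Y i j * (gram X i j - gram X0 i j)) - 2 / \<delta>\<^sup>2 * gap X)"
      unfolding e_def by (simp only: exp_le_cancel_iff)
    also have "\<dots> \<le> lik_ratio n X0 Y X"
      by (rule lik_ratio_lower_bound[OF Y X0 \<delta>(1)]) (use dif \<rho>\<delta> in force)+
    finally show "e \<le> lik_ratio n X0 Y X" .
  qed
  have "ennreal (e * (c * h ^ CARD('d)) ^ n) = ennreal e * ennreal ((c * h ^ CARD('d)) ^ n)"
    using c \<rho> by (simp add: e_def h_def ennreal_mult)
  also have "\<dots> \<le> ennreal e * emeasure (prior n \<pi>) Box" using box(2) by (intro mult_left_mono) auto
  also have "\<dots> = (\<integral>\<^sup>+X. ennreal e * indicator Box X \<partial>prior n \<pi>)"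
    by (rule nn_integral_cmult_indicator[symmetric]) (rule box(1))
  also have "\<dots> \<le> posterior_weight n \<pi> X0 Y (latent_matrices n)"
    unfolding posterior_weight_def using lik lat
    by (intro nn_integral_mono) (auto simp: indicator_def intro!: ennreal_leI)
  finally show ?thesis by (simp add: e_def h_def \<rho>_def)
qed

end

lemma posterior_weight_mono:
  "A \<subseteq> B \<Longrightarrow> posterior_weight n \<pi> X0 Y A \<le> posterior_weight n \<pi> X0 Y B"
  unfolding posterior_weight_def by (intro nn_integral_mono) (auto simp: indicator_def)

lemma sets_posterior [simp, measurable_cong]: "sets (posterior n \<pi> X0 Y) = sets (prior n \<pi>)"
  by (simp add: posterior_def)

lemma space_posterior: "space (posterior n \<pi> X0 Y) = space (prior n \<pi>)"
  by (simp add: posterior_def)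

text \<open>
  Applies to arbitrary sets, as the measure of a non-measurable set is zero. The events that involve an
  infimum over rotations or the existence of assignments are treated this way.
\<close>

lemma measure_posterior_le:
  assumes "posterior_weight n \<pi> X0 Y A \<le> ennreal t * posterior_weight n \<pi> X0 Y (latent_matrices n)" "0 \<le> t"
    and D: "posterior_weight n \<pi> X0 Y (latent_matrices n) \<noteq> 0"
  shows "measure (posterior n \<pi> X0 Y) A \<le> t"
proof (cases "A \<in> sets (prior n \<pi>)")
  case True
  let ?D = "posterior_weight n \<pi> X0 Y (latent_matrices n)"
  have "emeasure (posterior n \<pi> X0 Y) A = posterior_weight n \<pi> X0 Y A / ?D"
    by (rule emeasure_posterior[OF True])
  also have "\<dots> \<le> ennreal t"
  proof (cases "?D = top")
    case False
    have "posterior_weight n \<pi> X0 Y A / ?D \<le> ennreal t * ?D / ?D"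
      by (rule divide_right_mono_ennreal) (rule assms(1))
    also have "\<dots> = ennreal t" using D False by (rule ennreal_mult_divide_eq)
    finally show ?thesis .
  qed simp
  finally show ?thesis using assms(2) by (simp add: measure_def enn2real_leI)
qed (simp add: measure_notin_sets assms)

lemma measure_posterior_le_1:
  assumes "A \<subseteq> latent_matrices n"
  shows "measure (posterior n \<pi> X0 Y) A \<le> 1"
proof -
  have le: "posterior_weight n \<pi> X0 Y A \<le> posterior_weight n \<pi> X0 Y (latent_matrices n)"
    by (rule posterior_weight_mono[OF assms])
  show ?thesis
  proof (cases "posterior_weight n \<pi> X0 Y (latent_matrices n) = 0")
    case True
    then have "posterior_weight n \<pi> X0 Y A = 0" using le by simp
    then show ?thesis
      using emeasure_posterior[of A n \<pi> X0 Y]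
      by (cases "A \<in> sets (prior n \<pi>)") (auto simp: measure_def measure_notin_sets emeasure_notin_sets)
  next
    case False
    then show ?thesis using le by (intro measure_posterior_le) auto
  qed
qed

definition far_matrices :: "nat \<Rightarrow> (nat \<Rightarrow> real ^ 'd) \<Rightarrow> real \<Rightarrow> (nat \<Rightarrow> real ^ 'd) set" where
  "far_matrices n X0 M = {X \<in> latent_matrices n.
     1 / real n * frob_sq n (\<lambda>i j. gram X i j - gram X0 i j) > M / sqrt (real n)}"

context rdpg_setting
begin

abbreviation far :: "real \<Rightarrow> (nat \<Rightarrow> real ^ 'd) set" where
  "far \<equiv> far_matrices n X0"

lemma far_iff:
  assumes "M \<ge> 0"
  shows "X \<in> far M \<longleftrightarrow> X \<in> latent_matrices n \<and> M\<^sup>2 * real n < gap X"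
proof -
  define F where "F = frob_sq n (\<lambda>i j. gram X i j - gram X0 i j)"
  have F: "F = sqrt (gap X)"
    by (simp add: F_def frob_sq_def L2_set_def sum.cartesian_product case_prod_unfold)
  have "M / sqrt (real n) < 1 / real n * F \<longleftrightarrow> M * sqrt (real n) < F"
  proof -
    have "M / sqrt (real n) < 1 / real n * F \<longleftrightarrow> real n * (M / sqrt (real n)) < real n * (1 / real n * F)"
      using n by (subst mult_less_cancel_left_pos) auto
    moreover have "real n * (M / sqrt (real n)) = M * (real n / sqrt (real n))" by simp
    then have "real n * (M / sqrt (real n)) = M * sqrt (real n)" by (simp only: real_div_sqrt of_nat_0_le_iff)
    moreover have "real n * (1 / real n * F) = F" using n by simp
    ultimately show ?thesis by (simp only:)
  qed
  also have "M * sqrt (real n) = sqrt (M\<^sup>2 * real n)" using assms by (simp add: real_sqrt_mult)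
  also have "\<dots> < F \<longleftrightarrow> M\<^sup>2 * real n < gap X" unfolding F by (rule real_sqrt_less_iff)
  finally show ?thesis by (simp add: far_matrices_def F_def)
qed

lemma gram_measurable: "i < n \<Longrightarrow> j < n \<Longrightarrow> (\<lambda>X. gram X i j) \<in> borel_measurable (prior n \<pi>)"
  unfolding gram_def by (intro borel_measurable_inner row_measurable)

lemma gap_measurable: "gap \<in> borel_measurable (prior n \<pi>)"
  by (intro borel_measurable_sum borel_measurable_power borel_measurable_diff gram_measurable) auto

lemma far_sets: "M \<ge> 0 \<Longrightarrow> far M \<in> sets (prior n \<pi>)"
proof -
  assume M: "M \<ge> 0"
  have "far M = latent_matrices n \<inter> {X \<in> space (prior n \<pi>). M\<^sup>2 * real n < gap X}"
    using sets.sets_into_space[OF latent_matrices_measurable[of n \<pi>]] by (auto simp: far_iff[OF M])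
  moreover have "{X \<in> space (prior n \<pi>). M\<^sup>2 * real n < gap X} \<in> sets (prior n \<pi>)"
    by (rule borel_measurable_less) (auto intro: gap_measurable)
  ultimately show ?thesis using latent_matrices_measurable by auto
qed

lemma not_far_close:
  assumes M: "M \<ge> 0" and X: "X \<in> latent_matrices n" "X \<notin> far M"
  obtains W where "orthogonal_matrix W"
    "(\<Sum>i<n. (norm (X i - X0 i v* W))\<^sup>2) \<le> 3 * M\<^sup>2 / (2 * \<mu>)"
proof -
  obtain W where W: "orthogonal_matrix W"
    "2 / 3 * (real n * \<mu>) * (\<Sum>i<n. (norm (X i - X0 i v* W))\<^sup>2) \<le> gap X" by (rule procrustes_gap)
  define r2 where "r2 = (\<Sum>i<n. (norm (X i - X0 i v* W))\<^sup>2)"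
  have "gap X \<le> M\<^sup>2 * real n" using X far_iff[OF M, of X] by auto
  then have "(2 / 3 * \<mu> * r2) * real n \<le> M\<^sup>2 * real n"
    using W(2) unfolding r2_def[symmetric] by (simp add: algebra_simps)
  then have "2 / 3 * \<mu> * r2 \<le> M\<^sup>2" using n by simp
  then have "r2 \<le> 3 * M\<^sup>2 / (2 * \<mu>)" using \<mu>(1) by (simp add: field_simps)
  then show ?thesis using W(1) by (intro that[of W]) (simp_all add: r2_def)
qed

lemma evidence_finite_nonzero:
  assumes large: "64 / \<delta>\<^sup>2 \<le> real n"
  shows "posterior_weight n \<pi> X0 Y (latent_matrices n) \<noteq> 0"
    and "posterior_weight n \<pi> X0 Y (latent_matrices n) < top"
proof -
  obtain c C where c: "0 < c" "0 < C" "\<forall>x\<in>latent_space. c \<le> \<pi> x" "\<forall>x. \<pi> x \<le> C"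
    by (rule prior_density_bounds[OF \<pi>])
  have "0 < exp (- (real n * (8 * C0 + 32 / \<delta>\<^sup>2))) * (c * (1 / (sqrt (real n) * real CARD('d))) ^ CARD('d)) ^ n"
    using c n by simp
  then show "posterior_weight n \<pi> X0 Y (latent_matrices n) \<noteq> 0"
    using evidence_ge[OF c(3)[rule_format] c(1) large] by (auto simp: ennreal_eq_0_iff)
  define K where "K = exp (4 * C0 * real n * (2 * sqrt (real n)))"
  have lik: "lik_ratio n X0 Y X \<le> K" if X: "X \<in> latent_matrices n" for X
  proof -
    have "norm (X i - X0 i v* mat 1) \<le> 2" if "i < n" for i
      using norm_triangle_ineq4[of "X i" "X0 i"] latent_norm[OF latent_matrices_row[OF X that]]
        latent_norm[OF X0_latent[OF that]] by simp
    then have "frob_rows n (\<lambda>i. X i - X0 i v* mat 1) \<le> 2 * sqrt (real n)" by (rule frob_rows_le_sqrt) auto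
    then have "4 * C0 * real n * frob_rows n (\<lambda>i. X i - X0 i v* mat 1) \<le> 4 * C0 * real n * (2 * sqrt (real n))"
      using C0 by (intro mult_left_mono) auto
    moreover have "0 \<le> \<delta> / 4 * gap X" using \<delta> by (intro mult_nonneg_nonneg sum_nonneg) auto
    ultimately have "exp (4 * C0 * real n * frob_rows n (\<lambda>i. X i - X0 i v* mat 1) - \<delta> / 4 * gap X) \<le> K"
      unfolding K_def by (simp only: exp_le_cancel_iff)
    then show ?thesis using lik_ratio_le[OF X orthogonal_matrix_id] by linarith
  qed
  interpret P: prob_space "prior n \<pi>" by (rule prob_space_prior[OF \<pi>])
  have "posterior_weight n \<pi> X0 Y (latent_matrices n) \<le> (\<integral>\<^sup>+X. ennreal K \<partial>prior n \<pi>)"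
    unfolding posterior_weight_def using lik
    by (intro nn_integral_mono) (auto simp: indicator_def intro!: ennreal_leI)
  also have "\<dots> = ennreal K" by (simp add: P.emeasure_space_1)
  finally show "posterior_weight n \<pi> X0 Y (latent_matrices n) < top"
    by (rule le_less_trans) simp
qed

text \<open>
  The number \<open>R\<close> is what remains per row from the ratio of the Gaussian integral to the volume of the
  box once the powers of \<open>n\<close> have cancelled.
\<close>

lemma posterior_far_le:
  fixes M c C :: real
  defines "R \<equiv> C / c * (real CARD('d) * sqrt (4 * pi / \<kappa>)) ^ CARD('d)"
  assumes c: "\<And>x. x \<in> latent_space \<Longrightarrow> c \<le> \<pi> x" "0 < c" and C: "\<And>x. \<pi> x \<le> C" "0 < C"
    and large: "64 / \<delta>\<^sup>2 \<le> real n"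
    and poly: "(2 * real n + 1) ^ (CARD('d) * CARD('d)) \<le> exp (real n)"
    and M: "M \<ge> 0" "8 * C0\<^sup>2 / \<kappa> + \<kappa> * real CARD('d) ^ 4 + (8 * C0 + 32 / \<delta>\<^sup>2) + 1 + ln R + real CARD('d) / 2
      \<le> \<delta> * M\<^sup>2 / 8"
    and A: "A \<subseteq> far M"
  shows "measure (posterior n \<pi> X0 Y) A \<le> exp (- (real n * real CARD('d) / 2))"
proof (rule measure_posterior_le)
  let ?d = "CARD('d)"
  define t where "t = exp (- (real n * real ?d / 2))"
  define K where "K = 8 * C0\<^sup>2 / \<kappa> - \<delta> * M\<^sup>2 / 8 + \<kappa> * real ?d ^ 4"
  define K2 where "K2 = 8 * C0 + 32 / \<delta>\<^sup>2"
  define g where "g = c * (1 / (sqrt (real n) * real ?d)) ^ ?d"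
  have \<kappa>: "\<kappa> > 0" using \<delta> \<mu> by simp
  have sn: "sqrt (real n) > 0" using n by simp
  have R: "R > 0" using c C \<kappa> by (simp add: R_def)
  have g: "g > 0" using c sn by (simp add: g_def)
  have Rg: "C * sqrt (pi / (\<kappa> * real n / 4)) ^ ?d = R * g"
  proof -
    have "sqrt (pi / (\<kappa> * real n / 4)) = sqrt (4 * pi / \<kappa> / real n)" by (simp add: field_simps)
    also have "\<dots> = sqrt (4 * pi / \<kappa>) / sqrt (real n)" by (rule real_sqrt_divide)
    also have "\<dots> = (real ?d * sqrt (4 * pi / \<kappa>)) * (1 / (sqrt (real n) * real ?d))" by simp
    finally have s: "sqrt (pi / (\<kappa> * real n / 4)) =
      (real ?d * sqrt (4 * pi / \<kappa>)) * (1 / (sqrt (real n) * real ?d))" .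
    show ?thesis unfolding s power_mult_distrib[of _ "1 / (sqrt (real n) * real ?d)"] R_def g_def using c by simp
  qed
  have "exp (real n * K) * ((2 * real n + 1) ^ (?d * ?d) * (R * g) ^ n)
      \<le> exp (real n * K) * (exp (real n) * (R * g) ^ n)"
    using poly R g by (intro mult_left_mono mult_right_mono) auto
  also have "R ^ n = exp (real n * ln R)" using R by (simp add: exp_of_nat_mult)
  then have "exp (real n * K) * (exp (real n) * (R * g) ^ n) = exp (real n * (K + 1 + ln R)) * g ^ n"
    by (simp add: power_mult_distrib distrib_left exp_add mult_ac)
  also have "\<dots> \<le> exp (real n * (- real ?d / 2 - K2)) * g ^ n"
  proof (intro mult_right_mono)
    have "K + 1 + ln R \<le> - real ?d / 2 - K2" using M(2) by (simp add: K_def K2_def)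
    then have "real n * (K + 1 + ln R) \<le> real n * (- real ?d / 2 - K2)" by (intro mult_left_mono) auto
    then show "exp (real n * (K + 1 + ln R)) \<le> exp (real n * (- real ?d / 2 - K2))" by simp
  qed (use g in simp)
  also have "\<dots> = t * (exp (- (real n * K2)) * g ^ n)"
    by (simp add: t_def algebra_simps flip: exp_add)
  finally have num: "exp (real n * K) * ((2 * real n + 1) ^ (?d * ?d) * (R * g) ^ n) \<le> t * (exp (- (real n * K2)) * g ^ n)" .
  have "posterior_weight n \<pi> X0 Y A \<le> ennreal (exp (real n * K) * ((2 * real n + 1) ^ (?d * ?d) * (R * g) ^ n))"
    unfolding K_def Rg[symmetric]
    by (rule far_weight_le[OF _ _ C]) (use A far_iff[OF M(1)] in auto)
  also have "\<dots> \<le> ennreal (t * (exp (- (real n * K2)) * g ^ n))" using num by (rule ennreal_leI)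
  also have "\<dots> = ennreal t * ennreal (exp (- (real n * K2)) * g ^ n)"
    using g by (simp add: t_def ennreal_mult)
  also have "\<dots> \<le> ennreal t * posterior_weight n \<pi> X0 Y (latent_matrices n)"
    using evidence_ge[OF c large] unfolding K2_def g_def by (intro mult_left_mono) auto
  finally show "posterior_weight n \<pi> X0 Y A \<le>
    ennreal (exp (- (real n * real ?d / 2))) * posterior_weight n \<pi> X0 Y (latent_matrices n)"
    by (simp add: t_def)
  show "posterior_weight n \<pi> X0 Y (latent_matrices n) \<noteq> 0" by (rule evidence_finite_nonzero[OF large])
qed simp

lemma prob_space_posterior:
  assumes large: "64 / \<delta>\<^sup>2 \<le> real n"
  shows "prob_space (posterior n \<pi> X0 Y)" and "AE X in posterior n \<pi> X0 Y. X \<in> latent_matrices n"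
proof -
  let ?D = "posterior_weight n \<pi> X0 Y (latent_matrices n)"
  note D = evidence_finite_nonzero[OF large]
  have "posterior_weight n \<pi> X0 Y (space (prior n \<pi>)) = ?D"
    unfolding posterior_weight_def
    by (rule nn_integral_cong_AE) (use AE_prior_latent[OF \<pi>, of n] in \<open>auto simp: indicator_def elim!: AE_mp\<close>)
  then have "emeasure (posterior n \<pi> X0 Y) (space (posterior n \<pi> X0 Y)) = ?D / ?D"
    by (simp add: emeasure_posterior space_posterior)
  also have "\<dots> = 1" using D by (intro ennreal_divide_self) (auto simp: less_top)
  finally show "prob_space (posterior n \<pi> X0 Y)" by (rule prob_spaceI)
  show "AE X in posterior n \<pi> X0 Y. X \<in> latent_matrices n"
    unfolding posterior_def
    by (subst AE_density) (use AE_prior_latent[OF \<pi>, of n] in auto)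
qed

text \<open>
  Jensen's inequality entry by entry; on the far set the squared difference is at most \<open>1\<close> in each of
  the \<open>n\<^sup>2\<close> entries.
\<close>

lemma posterior_mean_gram_close:
  assumes large: "64 / \<delta>\<^sup>2 \<le> real n" and M: "M \<ge> 0"
    and far: "measure (posterior n \<pi> X0 Y) (far M) \<le> t"
  shows "(\<Sum>i<n. \<Sum>j<n. (posterior_mean_gram n \<pi> X0 Y i j - gram X0 i j)\<^sup>2) \<le> M\<^sup>2 * real n + (real n)\<^sup>2 * t"
proof -
  interpret Q: prob_space "posterior n \<pi> X0 Y" by (rule prob_space_posterior[OF large])
  note lat = prob_space_posterior(2)[OF large]
  define f where "f = (\<lambda>i j (X :: nat \<Rightarrow> real ^ 'd). gram X i j - gram X0 i j)"
  have fb: "\<bar>f i j X\<bar> \<le> 1" if "i < n" "j < n" "X \<in> latent_matrices n" for i j X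
    using latent_inner[OF latent_matrices_row[OF that(3,1)] latent_matrices_row[OF that(3,2)]]
      latent_inner[OF X0_latent[OF that(1)] X0_latent[OF that(2)]] by (simp add: f_def gram_def)
  have fm: "f i j \<in> borel_measurable (posterior n \<pi> X0 Y)" if "i < n" "j < n" for i j
    using gram_measurable[OF that] by (simp add: f_def)
  have fi: "integrable (posterior n \<pi> X0 Y) (f i j)" if "i < n" "j < n" for i j
    by (rule Q.integrable_const_bound[of _ 1]) (use lat fb[OF that] fm[OF that] in auto)
  have f2: "\<bar>(f i j X)\<^sup>2\<bar> \<le> 1" if "i < n" "j < n" "X \<in> latent_matrices n" for i j X
    using fb[OF that] by (simp add: abs_square_le_1)
  have f2i: "integrable (posterior n \<pi> X0 Y) (\<lambda>X. (f i j X)\<^sup>2)" if "i < n" "j < n" for i j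
    by (rule Q.integrable_const_bound[of _ 1]) (use lat f2[OF that] fm[OF that] in auto)
  have mean: "(posterior_mean_gram n \<pi> X0 Y i j - gram X0 i j)\<^sup>2 \<le> (\<integral>X. (f i j X)\<^sup>2 \<partial>posterior n \<pi> X0 Y)"
    if ij: "i < n" "j < n" for i j
  proof -
    have "posterior_mean_gram n \<pi> X0 Y i j = (\<integral>X. f i j X + gram X0 i j \<partial>posterior n \<pi> X0 Y)"
      by (simp add: posterior_mean_gram_def f_def)
    also have "\<dots> = (\<integral>X. f i j X \<partial>posterior n \<pi> X0 Y) + gram X0 i j"
      using fi[OF ij] by (simp add: Q.prob_space)
    finally have "(posterior_mean_gram n \<pi> X0 Y i j - gram X0 i j)\<^sup>2 = (\<integral>X. f i j X \<partial>posterior n \<pi> X0 Y)\<^sup>2" by simp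
    moreover have "0 \<le> (\<integral>X. (f i j X)\<^sup>2 \<partial>posterior n \<pi> X0 Y) - (\<integral>X. f i j X \<partial>posterior n \<pi> X0 Y)\<^sup>2"
      using Q.variance_positive[of "f i j"] Q.variance_eq[OF fi[OF ij] f2i[OF ij]] by simp
    ultimately show ?thesis by simp
  qed
  have "(\<Sum>i<n. \<Sum>j<n. (posterior_mean_gram n \<pi> X0 Y i j - gram X0 i j)\<^sup>2) \<le>
      (\<Sum>i<n. \<Sum>j<n. \<integral>X. (f i j X)\<^sup>2 \<partial>posterior n \<pi> X0 Y)"
    using mean by (intro sum_mono) auto
  also have "\<dots> = (\<integral>X. (\<Sum>i<n. \<Sum>j<n. (f i j X)\<^sup>2) \<partial>posterior n \<pi> X0 Y)"
    using f2i by (subst Bochner_Integration.integral_sum, force)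
      (intro sum.cong refl, subst Bochner_Integration.integral_sum, auto)
  also have "\<dots> \<le> (\<integral>X. M\<^sup>2 * real n + (real n)\<^sup>2 * indicator (far M) X \<partial>posterior n \<pi> X0 Y)"
  proof (rule integral_mono_AE)
    show "integrable (posterior n \<pi> X0 Y) (\<lambda>X. \<Sum>i<n. \<Sum>j<n. (f i j X)\<^sup>2)"
      using f2i by (intro Bochner_Integration.integrable_sum) auto
    show "integrable (posterior n \<pi> X0 Y) (\<lambda>X. M\<^sup>2 * real n + (real n)\<^sup>2 * indicator (far M) X)"
      using far_sets[OF M] by (intro Bochner_Integration.integrable_add integrable_mult_right)
        (auto intro!: integrable_real_indicator Q.emeasure_finite[THEN less_top[THEN iffD1]])
    show "AE X in posterior n \<pi> X0 Y. (\<Sum>i<n. \<Sum>j<n. (f i j X)\<^sup>2) \<le> M\<^sup>2 * real n + (real n)\<^sup>2 * indicator (far M) X"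
      using lat
    proof eventually_elim
      case (elim X)
      show ?case
      proof (cases "X \<in> far M")
        case True
        have "(\<Sum>i<n. \<Sum>j<n. (f i j X)\<^sup>2) \<le> (\<Sum>i<n. \<Sum>j<n. 1)"
          using f2 elim by (intro sum_mono) auto
        also have "\<dots> = (real n)\<^sup>2" by (simp add: power2_eq_square)
        finally show ?thesis using True by (simp add: add_increasing)
      next
        case False
        then show ?thesis using elim far_iff[OF M, of X] by (simp add: f_def not_less)
      qed
    qed
  qed
  also have "\<dots> = M\<^sup>2 * real n + (real n)\<^sup>2 * measure (posterior n \<pi> X0 Y) (far M)"
    using far_sets[OF M] by (subst Bochner_Integration.integral_add)
      (auto simp: Q.prob_space intro!: integrable_mult_right integrable_real_indicator Q.emeasure_finite[THEN less_top[THEN iffD1]])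
  also have "\<dots> \<le> M\<^sup>2 * real n + (real n)\<^sup>2 * t"
    using far by (intro add_mono mult_left_mono) auto
  finally show ?thesis .
qed

section \<open>Clustering by the posterior and by its mean\<close>

text \<open>
  The separated target is \<open>X0 W\<close>; a rotation changes neither the classes nor the distances.
\<close>

lemma posterior_clustering_error:
  assumes M: "M \<ge> 0" and X: "X \<in> latent_matrices n" "X \<notin> far M"
    and K: "card (X0 ` {..<n}) = K" and \<xi>: "\<xi> > 0"
    and sep: "\<And>i j. i < n \<Longrightarrow> j < n \<Longrightarrow> X0 i \<noteq> X0 j \<Longrightarrow> \<xi> \<le> norm (X0 i - X0 j)"
    and big: "\<And>j. j < n \<Longrightarrow> 16 * (3 * M\<^sup>2 / (2 * \<mu>)) / \<xi>\<^sup>2 < real (card {i\<in>{..<n}. X0 i = X0 j})"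
    and \<tau>0: "cluster_assignment n K X0 \<tau>0" and \<tau>: "cluster_assignment n K X \<tau>"
  shows "real (clustering_error n K \<tau>0 \<tau>) \<le> 16 * (3 * M\<^sup>2 / (2 * \<mu>)) / \<xi>\<^sup>2"
proof -
  obtain W where W: "orthogonal_matrix W"
    "(\<Sum>i<n. (norm (X i - X0 i v* W))\<^sup>2) \<le> 3 * M\<^sup>2 / (2 * \<mu>)"
    by (rule not_far_close[OF M X])
  define T where "T = (\<lambda>i. X0 i v* W)"
  have WT: "(\<Sum>i<n. (norm (X i - T i))\<^sup>2) \<le> 3 * M\<^sup>2 / (2 * \<mu>)" using W(2) by (simp add: T_def)
  have Tn: "norm (T i - T j) = norm (X0 i - X0 j)" for i j
    using orthogonal_matrix_rows(2)[OF W(1), of "X0 i - X0 j"]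
    by (simp add: T_def vector_matrix_mult_def vec_eq_iff algebra_simps sum_subtractf
        norm_vec_def L2_set_def)
  have Teq: "T i = T j \<longleftrightarrow> X0 i = X0 j" for i j
    using Tn[of i j] by (metis norm_eq_zero right_minus_eq)
  have inj: "inj_on (\<lambda>x. x v* W) (X0 ` {..<n})"
    by (rule inj_onI) (use Teq in \<open>auto simp: T_def\<close>)
  have "T ` {..<n} = (\<lambda>x. x v* W) ` X0 ` {..<n}" by (auto simp: T_def)
  then have KT: "card (T ` {..<n}) = K" using card_image[OF inj] K by simp
  show ?thesis
  proof (rule clustering_error_le(1)[OF KT n \<xi> _ WT _ \<tau>])
    show "\<tau>0 i < K" if "i < n" for i using \<tau>0 that by (simp add: cluster_assignment_def)
    show "\<tau>0 i = \<tau>0 j \<longleftrightarrow> T i = T j" if "i < n" "j < n" for i j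
      using cluster_assignment_exact[OF K \<tau>0 that] Teq by simp
  qed (use sep big Tn Teq in auto)
qed

text \<open>
  The separated target is \<open>X0 B\<close>, whose rows are at distance at least \<open>\<xi> / (2 * sqrt n)\<close> across
  classes. The squared distance of \<open>U\<close> from it is of order \<open>1 / n\<close> as well, so \<open>n\<close> drops out.
\<close>

lemma spectral_clustering_error:
  fixes U U0 :: "nat \<Rightarrow> real ^ 'd"
  assumes P: "(\<Sum>i<n. \<Sum>j<n. (P i j - gram X0 i j)\<^sup>2) \<le> 2 * M\<^sup>2 * real n" and M: "M \<ge> 0"
    and nM: "32 * M\<^sup>2 \<le> real n * \<mu>\<^sup>2"
    and K: "card (X0 ` {..<n}) = K" and \<xi>: "\<xi> > 0"
    and sep: "\<And>i j. i < n \<Longrightarrow> j < n \<Longrightarrow> X0 i \<noteq> X0 j \<Longrightarrow> \<xi> \<le> norm (X0 i - X0 j)"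
    and big: "\<And>j. j < n \<Longrightarrow> 512 * M\<^sup>2 / (\<mu>\<^sup>2 * \<xi>\<^sup>2) < real (card {i\<in>{..<n}. X0 i = X0 j})"
    and U: "top_eigenvectors n P U" and U0: "left_singular_matrix n X0 U0"
    and \<tau>: "cluster_assignment n K U \<tau>" and \<tau>0: "cluster_assignment n K U0 \<tau>0"
  shows "real (clustering_error n K \<tau> \<tau>0) \<le> 512 * M\<^sup>2 / (\<mu>\<^sup>2 * \<xi>\<^sup>2)"
proof -
  define \<epsilon> where "\<epsilon> = sqrt (2 * M\<^sup>2 * real n)"
  have \<epsilon>2: "\<epsilon>\<^sup>2 = 2 * M\<^sup>2 * real n" "\<epsilon> \<ge> 0" by (auto simp: \<epsilon>_def)
  have rn: "real n > 0" using n by simp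
  have m0: "real n * \<mu> > 0" using \<mu> rn by simp
  have "(4 * \<epsilon>)\<^sup>2 \<le> (real n * \<mu>)\<^sup>2"
  proof -
    have "(4 * \<epsilon>)\<^sup>2 = 32 * M\<^sup>2 * real n" by (simp add: power_mult_distrib \<epsilon>2)
    also have "\<dots> \<le> real n * \<mu>\<^sup>2 * real n" using nM by (intro mult_right_mono) auto
    also have "\<dots> = (real n * \<mu>)\<^sup>2" by (simp add: power2_eq_square mult_ac)
    finally show ?thesis .
  qed
  then have \<epsilon>m: "4 * \<epsilon> \<le> real n * \<mu>" by (rule power2_le_imp_le) (use m0 in simp)
  define s where "s = 8 * M\<^sup>2 / (real n * \<mu>\<^sup>2)"
  have "\<epsilon> / (real n * \<mu> - \<epsilon>) \<le> \<epsilon> / (real n * \<mu> / 2)"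
    by (rule frac_le) (use \<epsilon>m \<epsilon>2(2) m0 in linarith)+
  moreover have "0 \<le> \<epsilon> / (real n * \<mu> - \<epsilon>)"
    by (rule divide_nonneg_nonneg) (use \<epsilon>m \<epsilon>2(2) m0 in linarith)+
  ultimately have "(\<epsilon> / (real n * \<mu> - \<epsilon>))\<^sup>2 \<le> (\<epsilon> / (real n * \<mu> / 2))\<^sup>2" by (rule power_mono)
  also have "\<dots> = s" using rn \<mu>(1) by (simp add: power_divide power_mult_distrib \<epsilon>2 s_def) (simp add: power2_eq_square)
  finally have es: "(\<epsilon> / (real n * \<mu> - \<epsilon>))\<^sup>2 \<le> s" .
  have "\<exists>B. (\<Sum>i<n. (norm (U i - X0 i v* B))\<^sup>2) \<le> (\<epsilon> / (real n * \<mu> - \<epsilon>))\<^sup>2"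
    by (rule top_eigenvectors_close_to_range(2)[where P = P and \<epsilon> = \<epsilon>, OF \<mu>(2) m0])
      (use P \<epsilon>2 \<epsilon>m m0 U in auto)
  then obtain B where "(\<Sum>i<n. (norm (U i - X0 i v* B))\<^sup>2) \<le> (\<epsilon> / (real n * \<mu> - \<epsilon>))\<^sup>2" by blast
  with es have B: "(\<Sum>i<n. (norm (U i - X0 i v* B))\<^sup>2) \<le> s" by linarith
  have onU: "orthonormal_columns n U"
    by (rule top_eigenvectors_close_to_range(1)[where P = P and \<epsilon> = \<epsilon>, OF \<mu>(2) m0 _ _ _ U])
      (use P \<epsilon>2 \<epsilon>m m0 in auto)
  have s4: "s \<le> (1 / 2)\<^sup>2" using nM rn \<mu>(1) by (simp add: s_def pos_divide_le_eq power2_eq_square)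
  define T where "T = (\<lambda>i. X0 i v* B)"
  have BT: "(\<Sum>i<n. (norm (U i - T i))\<^sup>2) \<le> s" using B by (simp add: T_def)
  have Tdiff: "T i - T j = (X0 i - X0 j) v* B" for i j
    by (simp add: T_def vector_matrix_mult_def vec_eq_iff algebra_simps sum_subtractf)
  have Tn: "norm (X0 i - X0 j) \<le> 2 * sqrt (real n) * norm (T i - T j)" for i j
    unfolding Tdiff
    by (rule near_orthonormal_expands[OF latent_norm[OF X0_latent] onU order_trans[OF B s4]])
  have Teq: "T i = T j \<longleftrightarrow> X0 i = X0 j" for i j
    using Tn[of i j] by (auto simp: T_def)
  have inj: "inj_on (\<lambda>x. x v* B) (X0 ` {..<n})"
    by (rule inj_onI) (use Teq in \<open>auto simp: T_def\<close>)
  have "T ` {..<n} = (\<lambda>x. x v* B) ` X0 ` {..<n}" by (auto simp: T_def)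
  then have KT: "card (T ` {..<n}) = K" using card_image[OF inj] K by simp
  define \<zeta> where "\<zeta> = \<xi> / (2 * sqrt (real n))"
  have \<zeta>: "\<zeta> > 0" using \<xi> rn by (simp add: \<zeta>_def)
  have \<zeta>2: "16 * s / \<zeta>\<^sup>2 = 512 * M\<^sup>2 / (\<mu>\<^sup>2 * \<xi>\<^sup>2)"
    using rn \<mu>(1) \<xi> by (simp add: s_def \<zeta>_def power_divide power_mult_distrib)
  have rank: "0 < (\<Sum>i<n. (X0 i \<bullet> v)\<^sup>2)" if "v \<noteq> 0" for v
  proof -
    have "0 < real n * \<mu> * (norm v)\<^sup>2" using m0 that by simp
    then show ?thesis using \<mu>(2)[of v] by linarith
  qed
  have U0eq: "U0 i = U0 j \<longleftrightarrow> X0 i = X0 j" if "i < n" "j < n" for i j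
    by (rule left_singular_rows_eq_iff[OF U0 rank that])
  have KU: "card (U0 ` {..<n}) = K"
    using card_image_eq_if_same_kernel[of "{..<n}" U0 X0] U0eq K by simp
  show ?thesis
    unfolding \<zeta>2[symmetric]
  proof (rule clustering_error_le(2)[OF KT n \<zeta> _ BT _ \<tau>])
    show "\<zeta> \<le> norm (T i - T j)" if ij: "i < n" "j < n" "T i \<noteq> T j" for i j
    proof -
      have "\<xi> \<le> 2 * sqrt (real n) * norm (T i - T j)" using sep[OF ij(1,2)] ij(3) Teq Tn[of i j] by force
      then show ?thesis using rn by (simp add: \<zeta>_def pos_divide_le_eq mult_ac)
    qed
    show "16 * s / \<zeta>\<^sup>2 < real (card {i\<in>{..<n}. T i = T j})" if "j < n" for j
      unfolding \<zeta>2 Teq by (rule big[OF that])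
    show "\<tau>0 i < K" if "i < n" for i using \<tau>0 that by (simp add: cluster_assignment_def)
    show "\<tau>0 i = \<tau>0 j \<longleftrightarrow> T i = T j" if "i < n" "j < n" for i j
      using cluster_assignment_exact[OF KU \<tau>0 that] Teq U0eq[OF that] by simp
  qed
qed

end

section \<open>Asymptotics\<close>

text \<open>
  Only finitely many edge indicators with finitely many values enter, so the event is a finite
  union of intersections of the events that fix one indicator.
\<close>

lemma rdpg_event_measurable:
  assumes M: "prob_space M" and Y: "rdpg M n X Y"
    and dep: "\<And>y y'. (\<And>i j. (i, j) \<in> upper_pairs n \<Longrightarrow> y i j = y' i j) \<Longrightarrow> Q y \<longleftrightarrow> Q y'"
  shows "{\<omega> \<in> space M. Q (Y \<omega>)} \<in> sets M"
proof -
  define T where "T = {t \<in> upper_pairs n \<rightarrow>\<^sub>E {0, 1 :: nat}. Q (\<lambda>i j. t (i, j))}"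
  define E where "E = (\<lambda>t. space M \<inter> (\<Inter>p\<in>upper_pairs n. {\<omega> \<in> space M. Y \<omega> (fst p) (snd p) = t p}))"
  have Es: "E t \<in> sets M" for t
  proof -
    have "{\<omega> \<in> space M. Y \<omega> (fst p) (snd p) = t p} \<in> sets M" if "p \<in> upper_pairs n" for p
    proof -
      have "(\<lambda>\<omega>. Y \<omega> (fst p) (snd p)) \<in> measurable M (count_space UNIV)"
        using rdpg_measurable[OF Y _ M, of "fst p" "snd p"] that by simp
      from measurable_sets[OF this, of "{t p}"] show ?thesis
        by (simp add: vimage_def Int_def conj_commute)
    qed
    then have *: "(\<lambda>p. {\<omega> \<in> space M. Y \<omega> (fst p) (snd p) = t p}) ` upper_pairs n \<subseteq> sets M" by auto
    show ?thesis
    proof (cases "upper_pairs n = {}")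
      case False
      have "(\<Inter>p\<in>upper_pairs n. {\<omega> \<in> space M. Y \<omega> (fst p) (snd p) = t p}) \<in> sets M"
        using * False by (intro sets.finite_INT) auto
      then show ?thesis unfolding E_def by (rule sets.Int[OF sets.top])
    qed (simp add: E_def)
  qed
  have finT: "finite T"
    unfolding T_def by (rule finite_subset[of _ "upper_pairs n \<rightarrow>\<^sub>E {0, 1 :: nat}"]) (auto intro: finite_PiE)
  have "{\<omega> \<in> space M. Q (Y \<omega>)} = (\<Union>t\<in>T. E t)"
  proof (intro set_eqI iffI)
    fix \<omega> assume \<omega>: "\<omega> \<in> {\<omega> \<in> space M. Q (Y \<omega>)}"
    define t where "t = restrict (\<lambda>p. Y \<omega> (fst p) (snd p)) (upper_pairs n)"
    have "Y \<omega> i j \<in> {0, 1}" if "(i, j) \<in> upper_pairs n" for i j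
      using Y \<omega> that unfolding rdpg_def by (auto simp: upper_pairs_def)
    then have "t \<in> upper_pairs n \<rightarrow>\<^sub>E {0, 1}" by (auto simp: t_def)
    moreover have "Q (\<lambda>i j. t (i, j)) \<longleftrightarrow> Q (Y \<omega>)" by (rule dep) (simp add: t_def)
    ultimately have "t \<in> T" using \<omega> by (simp add: T_def)
    moreover have "\<omega> \<in> E t" using \<omega> by (auto simp: E_def t_def)
    ultimately show "\<omega> \<in> (\<Union>t\<in>T. E t)" by blast
  next
    fix \<omega> assume "\<omega> \<in> (\<Union>t\<in>T. E t)"
    then obtain t where t: "t \<in> T" "\<omega> \<in> E t" by blast
    have "Q (\<lambda>i j. t (i, j)) \<longleftrightarrow> Q (Y \<omega>)" by (rule dep) (use t(2) in \<open>auto simp: E_def\<close>)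
    then show "\<omega> \<in> {\<omega> \<in> space M. Q (Y \<omega>)}" using t by (auto simp: T_def E_def)
  qed
  then show ?thesis using finT Es by (simp add: sets.finite_UN)
qed

lemma posterior_cong:
  assumes "\<And>i j. (i, j) \<in> upper_pairs n \<Longrightarrow> Y i j = Y' i j"
  shows "posterior n \<pi> X0 Y = posterior n \<pi> X0 Y'"
proof -
  have "lik_ratio n X0 Y = lik_ratio n X0 Y'"
    unfolding lik_ratio_def using assms by (intro ext prod.cong) auto
  then show ?thesis unfolding posterior_def posterior_weight_def by simp
qed

lemma eventually_power_le_exp: "\<forall>\<^sub>F n in sequentially. (2 * real n + 1) ^ k \<le> exp (real n)"
proof -
  have "((\<lambda>n. real n ^ k / exp (real n)) \<longlongrightarrow> 0) sequentially"
    by (rule filterlim_compose[OF tendsto_power_div_exp_0 filterlim_real_sequentially])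
  then have "\<forall>\<^sub>F n in sequentially. real n ^ k / exp (real n) < 1 / 3 ^ k"
    by (rule order_tendstoD) simp
  then show ?thesis using eventually_ge_at_top[of 1]
  proof eventually_elim
    case (elim n)
    have "(2 * real n + 1) ^ k \<le> (3 * real n) ^ k" using elim by (intro power_mono) auto
    also have "\<dots> = 3 ^ k * real n ^ k" by (rule power_mult_distrib)
    also have "\<dots> \<le> exp (real n)" using elim(1) by (simp add: field_simps)
    finally show ?case .
  qed
qed

lemma nat_mult_exp_minus_half_le: "d \<ge> 1 \<Longrightarrow> real n * exp (- (real n * d / 2)) \<le> 1"
proof -
  assume d: "d \<ge> 1"
  have "0 \<le> (real n / 4 - 1)\<^sup>2" by simp
  then have "real n \<le> (1 + real n / 4)\<^sup>2" by (simp add: power2_eq_square algebra_simps)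
  also have "\<dots> \<le> (exp (real n / 4))\<^sup>2" by (intro power_mono exp_ge_add_one_self) auto
  also have "\<dots> = exp (real n / 2)" by (simp add: power2_eq_square flip: exp_add)
  also have "\<dots> \<le> exp (real n * d / 2)" using d by (simp add: mult_left_mono[of 1 d "real n", simplified])
  finally show ?thesis by (simp add: exp_minus field_simps)
qed

lemma eventually_all_classes_large:
  assumes "filterlim (\<lambda>n. MIN x\<in>X0 n ` {..<n}. card {i\<in>{..<n}. X0 n i = x}) at_top sequentially"
  shows "\<forall>\<^sub>F n in sequentially. \<forall>j<n. c < real (card {i\<in>{..<n}. X0 n i = X0 n j})"
proof -
  have "\<forall>\<^sub>F n in sequentially. nat \<lceil>c\<rceil> < (MIN x\<in>X0 n ` {..<n}. card {i\<in>{..<n}. X0 n i = x})"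
    using assms[unfolded filterlim_at_top, rule_format, of "Suc (nat \<lceil>c\<rceil>)"] by (simp only: Suc_le_eq)
  then show ?thesis
  proof eventually_elim
    case (elim n)
    show ?case
    proof (intro allI impI)
      fix j assume "j < n"
      then have "(MIN x\<in>X0 n ` {..<n}. card {i\<in>{..<n}. X0 n i = x}) \<le> card {i\<in>{..<n}. X0 n i = X0 n j}"
        by (intro Min_le) auto
      with elim have "nat \<lceil>c\<rceil> < card {i\<in>{..<n}. X0 n i = X0 n j}" by linarith
      then show "c < real (card {i\<in>{..<n}. X0 n i = X0 n j})" by linarith
    qed
  qed
qed

text \<open>
  By Borel and Cantelli. Measurability of the events \<open>E n\<close> themselves matters, because almost
  always is expressed by the measure of the limit set.
\<close>

lemma almost_always_of_summable:
  assumes M: "prob_space M" and E: "\<And>n. n \<ge> 1 \<Longrightarrow> E n \<in> sets M"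
    and B: "\<And>n. n \<ge> 1 \<Longrightarrow> B n \<in> sets M \<and> measure M (B n) \<le> b n" and b: "summable b"
    and sub: "\<forall>\<^sub>F n in sequentially. space M - B n \<subseteq> E n"
  shows "almost_always M E"
proof -
  interpret prob_space M by (rule M)
  \<comment> \<open>The index \<open>0\<close> is outside the hypotheses and has to be neutralised.\<close>
  define B' where "B' = (\<lambda>n. if n \<ge> 1 then B n else {})"
  have B': "B' n \<in> sets M" for n using B by (simp add: B'_def)
  have "summable (\<lambda>n. measure M (B' n))"
  proof (rule summable_comparison_test[OF _ b], intro exI[of _ 1] allI impI)
    fix n :: nat assume "1 \<le> n"
    then show "norm (measure M (B' n)) \<le> b n" using B[of n] by (simp add: B'_def)
  qed
  then have "AE x in M. \<forall>\<^sub>F n in sequentially. x \<in> space M - B' n"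
    by (intro borel_cantelli_AE1 B') (simp_all add: emeasure_eq_measure)
  then have "AE x in M. x \<in> (\<Union>n\<in>{1..}. \<Inter>k\<in>{n..}. E k)"
  proof eventually_elim
    case (elim x)
    have "\<forall>\<^sub>F n in sequentially. x \<in> E n"
      using elim sub eventually_ge_at_top[of 1] by eventually_elim (auto simp: B'_def)
    then obtain N where N: "\<And>n. n \<ge> N \<Longrightarrow> x \<in> E n" by (auto simp: eventually_sequentially)
    then have "x \<in> (\<Inter>k\<in>{max 1 N..}. E k)" by auto
    then show ?case by (intro UN_I[of "max 1 N"]) auto
  qed
  moreover have "(\<Union>n\<in>{1..}. \<Inter>k\<in>{n..}. E k) \<in> sets M"
    using E by (intro sets.countable_UN'' sets.countable_INT') auto
  ultimately show ?thesis unfolding almost_always_def by (simp add: prob_eq_1)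
qed

theorem theorem5:
  fixes \<Delta> :: "real ^ 'd ^ 'd" and \<pi> :: "real ^ 'd \<Rightarrow> real" and \<delta> :: real
  assumes "positive_definite \<Delta>"
    and "prior_density \<pi>"
    and "0 < \<delta>" and "\<delta> < 1/2"
  shows "\<exists>M1>0. \<exists>M2>0.
    \<forall>(X0 :: nat \<Rightarrow> nat \<Rightarrow> real ^ 'd) (K :: nat \<Rightarrow> nat) (\<xi> :: real)
      (M :: 'w measure) (Y :: nat \<Rightarrow> 'w \<Rightarrow> nat \<Rightarrow> nat \<Rightarrow> nat).
      prob_space M \<and>
      (\<forall>n\<ge>1. rdpg M n (X0 n) (Y n)) \<and>
      (\<forall>n\<ge>1. \<forall>i<n. X0 n i \<in> latent_space) \<and>
      (\<lambda>n. (1 / real n) *\<^sub>R second_moment n (X0 n)) \<longlonglongrightarrow> \<Delta> \<and>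
      (\<forall>n\<ge>1. \<forall>i<n. \<forall>j<n. \<delta> \<le> X0 n i \<bullet> X0 n j \<and> X0 n i \<bullet> X0 n j \<le> 1 - \<delta>) \<and>
      (\<forall>n\<ge>1. card (X0 n ` {..<n}) = K n) \<and>
      \<xi> > 0 \<and>
      (\<forall>n\<ge>1. \<forall>x\<in>X0 n ` {..<n}. \<forall>x'\<in>X0 n ` {..<n}. x \<noteq> x' \<longrightarrow> norm (x - x') > \<xi>) \<and>
      filterlim (\<lambda>n. MIN x\<in>X0 n ` {..<n}. card {i\<in>{..<n}. X0 n i = x}) at_top sequentially
      \<longrightarrow>
      (\<forall>\<^sub>F n in sequentially.
         (\<integral>\<omega>. measure (posterior n \<pi> (X0 n) (Y n \<omega>))
            {X \<in> latent_matrices n.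
               1 / real n * frob_sq n (\<lambda>i j. gram X i j - gram (X0 n) i j) > M1 / sqrt (real n)} \<partial>M)
         \<le> 8 * exp (- (real n * real CARD('d) / 2))) \<and>
      (\<forall>\<^sub>F n in sequentially.
         (\<integral>\<omega>. measure (posterior n \<pi> (X0 n) (Y n \<omega>))
            {X \<in> latent_matrices n.
               1 / real n * (INF W\<in>{W. orthogonal_matrix W}.
                 (frob_rows n (\<lambda>i. X i - X0 n i v* W))\<^sup>2) > M2 / real n} \<partial>M)
         \<le> 8 * exp (- (real n * real CARD('d) / 2))) \<and>
      (\<forall>\<^sub>F n in sequentially.
         (\<integral>\<omega>. measure (posterior n \<pi> (X0 n) (Y n \<omega>))
            {X \<in> latent_matrices n.
               \<exists>\<tau>0 \<tau>. cluster_assignment n (K n) (X0 n) \<tau>0 \<and> cluster_assignment n (K n) X \<tau> \<and>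
                 real (clustering_error n (K n) \<tau>0 \<tau>) \<ge> 16 * M2\<^sup>2 / \<xi>\<^sup>2} \<partial>M)
         \<le> 8 * exp (- (real n * real CARD('d) / 2))) \<and>
      almost_always M (\<lambda>n. {\<omega> \<in> space M.
         \<forall>(U :: nat \<Rightarrow> real ^ 'd) (U0 :: nat \<Rightarrow> real ^ 'd) \<tau> \<tau>0.
           top_eigenvectors n (posterior_mean_gram n \<pi> (X0 n) (Y n \<omega>)) U \<and>
           left_singular_matrix n (X0 n) U0 \<and>
           cluster_assignment n (K n) U \<tau> \<and> cluster_assignment n (K n) U0 \<tau>0 \<longrightarrow>
           real (clustering_error n (K n) \<tau> \<tau>0)
             \<le> 16 / \<xi>\<^sup>2 * (8 * M1 * sqrt (2 * real CARD('d)) / smallest_eigenvalue \<Delta>)\<^sup>2})"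
proof -
  note \<pi> = assms(2) and \<delta> = assms(3,4)
  obtain c C where cC: "0 < c" "0 < C" "\<forall>x\<in>latent_space. c \<le> \<pi> x" "\<forall>x. \<pi> x \<le> C"
    by (rule prior_density_bounds[OF \<pi>])
  let ?d = "real CARD('d)"
  have d1: "?d \<ge> 1" using zero_less_card_finite[where 'a = 'd] by linarith
  define \<Lambda> where "\<Lambda> = smallest_eigenvalue \<Delta>"
  define \<mu> where "\<mu> = \<Lambda> / 2"
  have \<Lambda>: "\<Lambda> > 0" unfolding \<Lambda>_def by (rule smallest_eigenvalue_rayleigh(1)[OF assms(1)])
  then have \<mu>: "\<mu> > 0" by (simp add: \<mu>_def)
  define C0 where "C0 = 2 * (sqrt (2 * (36 + ?d)) / \<delta>)"
  have C0: "C0 \<ge> 0" using \<delta> by (simp add: C0_def)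
  define S where "S = 8 * C0\<^sup>2 / (\<delta> * \<mu> / 12) + \<delta> * \<mu> / 12 * ?d ^ 4 + (8 * C0 + 32 / \<delta>\<^sup>2) + 1
    + ln (C / c * (?d * sqrt (4 * pi / (\<delta> * \<mu> / 12))) ^ CARD('d)) + ?d / 2"
  \<comment> \<open>Large enough to pay for the noise, the net, the evidence and the ratio left per row.\<close>
  define M1 where "M1 = sqrt (8 / \<delta> * max 0 S) + 1"
  define s0 where "s0 = 3 * M1\<^sup>2 / (2 * \<mu>)"
  \<comment> \<open>Beyond \<open>s0\<close> and beyond \<open>1\<close>: the clustering bound has \<open>M2\<^sup>2\<close> where the argument yields \<open>s0\<close>.\<close>
  define M2 where "M2 = s0 + 2"
  have M1: "M1 \<ge> 1" using \<delta> by (simp add: M1_def)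
  have s0: "s0 \<ge> 0" using \<mu> by (simp add: s0_def)
  have M1S: "S \<le> \<delta> * M1\<^sup>2 / 8"
  proof -
    have "8 / \<delta> * max 0 S = (sqrt (8 / \<delta> * max 0 S))\<^sup>2" using \<delta> by simp
    also have "\<dots> \<le> M1\<^sup>2" using \<delta> by (intro power_mono) (auto simp: M1_def)
    finally have "\<delta> / 8 * (8 / \<delta> * max 0 S) \<le> \<delta> / 8 * M1\<^sup>2" using \<delta> by (intro mult_left_mono) auto
    then show ?thesis using \<delta> by simp
  qed
  have M1pos: "M1 > 0" and M2pos: "M2 > 0" using M1 s0 by (simp_all add: M2_def)
  show ?thesis
  proof (rule exI[of _ M1], rule conjI[OF M1pos], rule exI[of _ M2], rule conjI[OF M2pos],
      intro allI impI, elim conjE, goal_cases)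
    case (1 X0 K \<xi> M Y)
    note M = 1(1) and Y = 1(2)[rule_format] and lat = 1(3)[rule_format] and lim = 1(4)
      and X0 = 1(5)[rule_format] and K = 1(6)[rule_format] and \<xi> = 1(7)
      and sep = 1(8)[rule_format] and cls = 1(9)
    interpret prob_space M by (rule M)
    have "\<forall>n. \<exists>B. 1 \<le> n \<longrightarrow> B \<in> sets M \<and> measure M B \<le> 2 * exp (- (?d * real n)) \<and>
        (\<forall>\<omega>\<in>space M - B. noise_bounded n (X0 n) (Y n \<omega>) C0)"
      using noise_bounded_with_high_probability[OF M Y _ X0 \<delta>(1), of _ ?d] unfolding C0_def
      by (metis of_nat_0_le_iff)
    then obtain B where "\<forall>n. 1 \<le> n \<longrightarrow> B n \<in> sets M \<and> measure M (B n) \<le> 2 * exp (- (?d * real n)) \<and>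
        (\<forall>\<omega>\<in>space M - B n. noise_bounded n (X0 n) (Y n \<omega>) C0)" by metis
    then have B: "\<And>n. 1 \<le> n \<Longrightarrow> B n \<in> sets M" "\<And>n. 1 \<le> n \<Longrightarrow> measure M (B n) \<le> 2 * exp (- (?d * real n))"
      "\<And>n \<omega>. 1 \<le> n \<Longrightarrow> \<omega> \<in> space M - B n \<Longrightarrow> noise_bounded n (X0 n) (Y n \<omega>) C0" by blast+
    define e where "e = (\<lambda>n. exp (- (real n * ?d / 2)))"
    define good where "good = (\<lambda>n. 1 \<le> n \<and> 64 / \<delta>\<^sup>2 \<le> real n \<and> (2 * real n + 1) ^ (CARD('d) * CARD('d)) \<le> exp (real n)
      \<and> 32 * M1\<^sup>2 / \<mu>\<^sup>2 \<le> real n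
      \<and> (\<forall>v. real n * \<mu> * (norm v)\<^sup>2 \<le> (\<Sum>i<n. (X0 n i \<bullet> v)\<^sup>2))
      \<and> (\<forall>j<n. 16 * s0 / \<xi>\<^sup>2 < real (card {i\<in>{..<n}. X0 n i = X0 n j}))
      \<and> (\<forall>j<n. 512 * M1\<^sup>2 / (\<mu>\<^sup>2 * \<xi>\<^sup>2) < real (card {i\<in>{..<n}. X0 n i = X0 n j})))"
    have real_ev: "\<forall>\<^sub>F n in sequentially. x \<le> real n" for x
      using filterlim_real_sequentially by (simp add: filterlim_at_top)
    have ev_good: "\<forall>\<^sub>F n in sequentially. good n"
      unfolding good_def \<mu>_def \<Lambda>_def
      by (intro eventually_conj eventually_ge_at_top real_ev eventually_power_le_exp
          eventually_second_moment_ge[OF assms(1) lim] eventually_all_classes_large[OF cls])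
    have setting: "rdpg_setting n (X0 n) (Y n \<omega>) \<pi> \<delta> \<mu> C0" if g: "good n" and \<omega>: "\<omega> \<in> space M - B n" for n \<omega>
    proof
      have n: "1 \<le> n" using g by (simp add: good_def)
      show "1 \<le> n" "0 < \<delta>" "\<delta> < 1 / 2" "prior_density \<pi>" "0 < \<mu>" "0 \<le> C0" by fact+
      show "Y n \<omega> i j \<in> {0, 1}" if "i < n" "j < n" for i j
        using Y[OF n] \<omega> that unfolding rdpg_def by blast
      show "\<delta> \<le> X0 n i \<bullet> X0 n j \<and> X0 n i \<bullet> X0 n j \<le> 1 - \<delta>" if "i < n" "j < n" for i j
        by (rule X0[OF n that])
      show "X0 n i \<in> latent_space" if "i < n" for i by (rule lat[OF n that])
      show "real n * \<mu> * (norm v)\<^sup>2 \<le> (\<Sum>i<n. (X0 n i \<bullet> v)\<^sup>2)" for v using g by (simp add: good_def)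
      show "noise_bounded n (X0 n) (Y n \<omega>) C0" by (rule B(3)[OF n \<omega>])
    qed
    have small: "measure (posterior n \<pi> (X0 n) (Y n \<omega>)) A \<le> e n"
      if g: "good n" and \<omega>: "\<omega> \<in> space M - B n" and A: "A \<subseteq> far_matrices n (X0 n) M1" for n \<omega> A
      unfolding e_def
      by (rule rdpg_setting.posterior_far_le[OF setting[OF g \<omega>] cC(3)[rule_format] cC(1) cC(4)[rule_format] cC(2) _ _ _ _ A])
        (use g M1 M1S in \<open>auto simp: good_def S_def\<close>)
    have expected: "(\<integral>\<omega>. measure (posterior n \<pi> (X0 n) (Y n \<omega>)) A \<partial>M) \<le> 8 * exp (- (real n * ?d / 2))"
      if g: "good n" and A: "A \<subseteq> latent_matrices n"
        and far: "\<And>\<omega>. \<omega> \<in> space M - B n \<Longrightarrow> A \<subseteq> far_matrices n (X0 n) M1" for n A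
    proof -
      have n: "1 \<le> n" using g by (simp add: good_def)
      have "(\<integral>\<omega>. measure (posterior n \<pi> (X0 n) (Y n \<omega>)) A \<partial>M) \<le> (\<integral>\<omega>. indicator (B n) \<omega> + e n \<partial>M)"
      proof (rule integral_mono')
        show "integrable M (\<lambda>\<omega>. indicator (B n) \<omega> + e n)"
          using B(1)[OF n] by (intro Bochner_Integration.integrable_add integrable_real_indicator)
            (auto simp: emeasure_eq_measure)
        fix \<omega> assume \<omega>: "\<omega> \<in> space M"
        have e0: "e n \<ge> 0" by (simp add: e_def)
        show "0 \<le> indicator (B n) \<omega> + e n" using e0 by simp
        show "measure (posterior n \<pi> (X0 n) (Y n \<omega>)) A \<le> indicator (B n) \<omega> + e n"
        proof (cases "\<omega> \<in> B n")
          case True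
          then show ?thesis using measure_posterior_le_1[OF A, of \<pi> "X0 n" "Y n \<omega>"] e0 by simp
        next
          case False
          then show ?thesis using small[OF g _ far, of \<omega> \<omega>] \<omega> by simp
        qed
      qed
      also have "\<dots> = measure M (B n) + e n"
        using B(1)[OF n] by (subst Bochner_Integration.integral_add)
          (auto simp: emeasure_eq_measure prob_space intro!: integrable_real_indicator)
      also have "\<dots> \<le> 2 * e n + e n"
      proof -
        have "real n * ?d / 2 \<le> ?d * real n" using d1 by simp
        then have "exp (- (?d * real n)) \<le> e n" by (simp add: e_def)
        then show ?thesis using B(2)[OF n] by linarith
      qed
      also have "\<dots> \<le> 8 * e n" by (simp add: e_def)
      finally show ?thesis by (simp add: e_def)
    qed
    have sepn: "\<xi> \<le> norm (X0 n i - X0 n j)" if "1 \<le> n" "i < n" "j < n" "X0 n i \<noteq> X0 n j" for n i j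
      using sep[OF that(1), of "X0 n i" "X0 n j"] that by auto
    define Q where "Q = (\<lambda>n y. \<forall>(U :: nat \<Rightarrow> real ^ 'd) (U0 :: nat \<Rightarrow> real ^ 'd) \<tau> \<tau>0.
           top_eigenvectors n (posterior_mean_gram n \<pi> (X0 n) y) U \<and>
           left_singular_matrix n (X0 n) U0 \<and>
           cluster_assignment n (K n) U \<tau> \<and> cluster_assignment n (K n) U0 \<tau>0 \<longrightarrow>
           real (clustering_error n (K n) \<tau> \<tau>0)
             \<le> 16 / \<xi>\<^sup>2 * (8 * M1 * sqrt (2 * ?d) / smallest_eigenvalue \<Delta>)\<^sup>2)"
    have part4: "almost_always M (\<lambda>n. {\<omega> \<in> space M. Q n (Y n \<omega>)})"
    proof (rule almost_always_of_summable[OF M, where b = "\<lambda>n. 2 * exp (- ?d) ^ n" and B = B])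
      fix n :: nat assume n: "1 \<le> n"
      show "{\<omega> \<in> space M. Q n (Y n \<omega>)} \<in> sets M"
      proof (rule rdpg_event_measurable[OF M Y[OF n], where Q = "Q n"])
        fix y y' :: "nat \<Rightarrow> nat \<Rightarrow> nat"
        assume "\<And>i j. (i, j) \<in> upper_pairs n \<Longrightarrow> y i j = y' i j"
        then have "posterior n \<pi> (X0 n) y = posterior n \<pi> (X0 n) y'" by (rule posterior_cong)
        then have "posterior_mean_gram n \<pi> (X0 n) y = posterior_mean_gram n \<pi> (X0 n) y'"
          by (intro ext) (simp only: posterior_mean_gram_def)
        then show "Q n y \<longleftrightarrow> Q n y'" by (simp only: Q_def)
      qed
      have "exp (- (?d * real n)) = exp (- ?d) ^ n" by (simp add: mult.commute flip: exp_of_nat_mult)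
      then show "B n \<in> sets M \<and> measure M (B n) \<le> 2 * exp (- ?d) ^ n" using B(1,2)[OF n] by simp
    next
      show "summable (\<lambda>n. 2 * exp (- ?d) ^ n)" using d1 by (intro summable_mult summable_geometric) auto
    next
      show "\<forall>\<^sub>F n in sequentially. space M - B n \<subseteq> {\<omega> \<in> space M. Q n (Y n \<omega>)}"
        using ev_good
      proof eventually_elim
        case (elim n)
        have n: "1 \<le> n" using elim by (simp add: good_def)
        show ?case
        unfolding Q_def
        proof (rule subsetI, rule CollectI, intro conjI allI impI; (elim conjE)?)
          fix \<omega> assume \<omega>: "\<omega> \<in> space M - B n"
          then show "\<omega> \<in> space M" by simp
          fix U U0 :: "nat \<Rightarrow> real ^ 'd" and \<tau> \<tau>0
          assume U: "top_eigenvectors n (posterior_mean_gram n \<pi> (X0 n) (Y n \<omega>)) U"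
            "left_singular_matrix n (X0 n) U0" "cluster_assignment n (K n) U \<tau>" "cluster_assignment n (K n) U0 \<tau>0"
          note set = setting[OF elim \<omega>]
          have "(\<Sum>i<n. \<Sum>j<n. (posterior_mean_gram n \<pi> (X0 n) (Y n \<omega>) i j - gram (X0 n) i j)\<^sup>2)
              \<le> M1\<^sup>2 * real n + (real n)\<^sup>2 * e n"
            by (rule rdpg_setting.posterior_mean_gram_close[OF set _ _ small[OF elim \<omega>]])
              (use elim M1 in \<open>auto simp: good_def\<close>)
          also have "\<dots> \<le> 2 * M1\<^sup>2 * real n"
          proof -
            have "real n * (real n * e n) \<le> real n * 1"
              using nat_mult_exp_minus_half_le[OF d1, of n] unfolding e_def by (intro mult_left_mono) auto
            also have "\<dots> \<le> real n * M1\<^sup>2" using M1 by (intro mult_left_mono) (auto simp: one_le_power)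
            finally show ?thesis by (simp add: power2_eq_square algebra_simps)
          qed
          finally have close: "(\<Sum>i<n. \<Sum>j<n. (posterior_mean_gram n \<pi> (X0 n) (Y n \<omega>) i j - gram (X0 n) i j)\<^sup>2)
              \<le> 2 * M1\<^sup>2 * real n" .
          have "real (clustering_error n (K n) \<tau> \<tau>0) \<le> 512 * M1\<^sup>2 / (\<mu>\<^sup>2 * \<xi>\<^sup>2)"
            by (rule rdpg_setting.spectral_clustering_error[OF set close _ _ K[OF n] \<xi> _ _ U])
              (use M1 sepn[OF n] elim \<mu> in \<open>auto simp: good_def pos_divide_le_eq\<close>)
          also have "\<dots> \<le> ?d * (512 * M1\<^sup>2 / (\<mu>\<^sup>2 * \<xi>\<^sup>2))"
            using d1 mult_right_mono[OF d1, of "512 * M1\<^sup>2 / (\<mu>\<^sup>2 * \<xi>\<^sup>2)"] by simp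
          also have "\<dots> = 16 / \<xi>\<^sup>2 * (8 * M1 * sqrt (2 * ?d) / smallest_eigenvalue \<Delta>)\<^sup>2"
            unfolding \<mu>_def \<Lambda>_def[symmetric] using \<Lambda> \<xi>
            by (simp add: power_divide power_mult_distrib mult_ac)
          finally show "real (clustering_error n (K n) \<tau> \<tau>0)
             \<le> 16 / \<xi>\<^sup>2 * (8 * M1 * sqrt (2 * ?d) / smallest_eigenvalue \<Delta>)\<^sup>2" .
        qed
      qed
    qed
    show ?case
    proof (intro conjI, goal_cases)
      case 1
      show ?case using ev_good by eventually_elim (rule expected, auto simp: far_matrices_def)
    next
      case 2
      show ?case
        using ev_good
      proof eventually_elim
        case (elim n)
        show ?case
        proof (rule expected[OF elim], blast, rule subsetI, rule ccontr, clarify)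
          fix \<omega> X
          assume \<omega>: "\<omega> \<in> space M" "\<omega> \<notin> B n"
            and X: "X \<in> latent_matrices n" "X \<notin> far_matrices n (X0 n) M1"
            and inf: "1 / real n * (INF W\<in>{W. orthogonal_matrix W}.
             (frob_rows n (\<lambda>i. X i - X0 n i v* W))\<^sup>2) > M2 / real n"
          have "rdpg_setting n (X0 n) (Y n \<omega>) \<pi> \<delta> \<mu> C0" using setting[OF elim] \<omega> by blast
          then obtain W where W: "orthogonal_matrix W" "(\<Sum>i<n. (norm (X i - X0 n i v* W))\<^sup>2) \<le> s0"
            unfolding s0_def by (rule rdpg_setting.not_far_close[OF _ less_imp_le[OF M1pos] X])
          have "(INF W\<in>{W. orthogonal_matrix W}. (frob_rows n (\<lambda>i. X i - X0 n i v* W))\<^sup>2)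
              \<le> (frob_rows n (\<lambda>i. X i - X0 n i v* W))\<^sup>2"
            using W(1) by (intro cINF_lower bdd_belowI2[of _ 0]) auto
          also have "\<dots> \<le> M2" using W(2) by (simp add: frob_rows_power2 M2_def)
          finally have "1 / real n * (INF W\<in>{W. orthogonal_matrix W}. (frob_rows n (\<lambda>i. X i - X0 n i v* W))\<^sup>2)
              \<le> 1 / real n * M2" by (intro mult_left_mono) auto
          then show False using inf by simp
        qed
      qed
    next
      case 3
      show ?case
        using ev_good
      proof eventually_elim
        case (elim n)
        have n: "1 \<le> n" using elim by (simp add: good_def)
        show ?case
        proof (rule expected[OF elim], blast, rule subsetI, rule ccontr, clarify)
          fix \<omega> X \<tau>0 \<tau>
          assume \<omega>: "\<omega> \<in> space M" "\<omega> \<notin> B n"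
            and X: "X \<in> latent_matrices n" "X \<notin> far_matrices n (X0 n) M1"
            and \<tau>: "cluster_assignment n (K n) (X0 n) \<tau>0" "cluster_assignment n (K n) X \<tau>"
            and err: "real (clustering_error n (K n) \<tau>0 \<tau>) \<ge> 16 * M2\<^sup>2 / \<xi>\<^sup>2"
          have "rdpg_setting n (X0 n) (Y n \<omega>) \<pi> \<delta> \<mu> C0" using setting[OF elim] \<omega> by blast
          then have "real (clustering_error n (K n) \<tau>0 \<tau>) \<le> 16 * s0 / \<xi>\<^sup>2"
            unfolding s0_def
            by (rule rdpg_setting.posterior_clustering_error[OF _ _ X K[OF n] \<xi> _ _ \<tau>])
              (use M1 sepn[OF n] elim in \<open>auto simp: good_def s0_def\<close>)
          moreover have "16 * s0 / \<xi>\<^sup>2 < 16 * M2\<^sup>2 / \<xi>\<^sup>2"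
          proof -
            have "s0 < M2 * 1" by (simp add: M2_def)
            also have "\<dots> \<le> M2 * M2" using s0 by (intro mult_left_mono) (auto simp: M2_def)
            finally show ?thesis using \<xi> by (simp add: power2_eq_square divide_strict_right_mono)
          qed
          ultimately show False using err by linarith
        qed
      qed
    next
      case 4
      show ?case using part4 unfolding Q_def .
    qed
  qed
qed

end
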